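(* Let $\Pi=\mathbb{R}/\mathbb{Z}$ be the circle, let $\sigma,b\in C^2(\Pi)$ with $a:=\sigma^2/2>0$, and assume that $b$ is separated from $0$ on $\Pi$ (i.e. $b(x)\ne0$ for all $x\in\Pi$). For $\varepsilon>0$ let $(X^\varepsilon_t)_{t\ge0}$ be the diffusion on $\Pi$ solving $dX^\varepsilon_t=\sqrt{\varepsilon}\,\sigma(X^\varepsilon_t)\,dW_t+b(X^\varepsilon_t)\,dt$ from a given initial point $x\in\Pi$, and let $\mu_T^\varepsilon:=\frac1T\int_0^T\delta_{X^\varepsilon_t}\,dt$ be its empirical measure. Then for every open set $O\subset P(\Pi)$ and every closed set $F\subset P(\Pi)$, $$\liminf_{\varepsilon\to0}\,\liminf_{T\to\infty}\frac1T\ln\mathbb{P}(\mu_T^\varepsilon\in O)\ge-\inf_{\mu\in O}J(\mu),$$ $$\limsup_{\varepsilon\to0}\,\limsup_{T\to\infty}\frac1T\ln\mathbb{P}(\mu_T^\varepsilon\in F)\le-\inf_{\mu\in F}J(\mu).$$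
   Context: $P(\Pi)$ is the space of probability measures on $\Pi$ with the weak topology (convergence tested against $C^0(\Pi)$ functions), and $W$ is a standard Brownian motion. For $c\in C^0(\Pi)$ and $\varepsilon>0$, let $\lambda_\varepsilon^c$ be the principal eigenvalue (the eigenvalue with maximal real part) of the operator $u\mapsto\varepsilon\,a\,u''+b\,u'+c\,u$ on $\Pi$. Let $\Lambda(c):=\lim_{\varepsilon\to0}\lambda_\varepsilon^c$ (this limit exists under the present assumptions), and for $\mu\in P(\Pi)$ $$J(\mu):=\sup_{c\in C^0(\Pi)}\Bigl\{\int_\Pi c\,d\mu-\Lambda(c)\Bigr\}.$$ Conventions: $\inf\emptyset=+\infty$ and $\ln0=-\infty$. *)

theory Defs
  imports "HOL-Probability.Probability"
begin

section \<open>The circle \<open>\<real>/\<int>\<close>\<close>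

quotient_type circle = real / "\<lambda>s t::real. s - t \<in> \<int>"
  morphisms rep_circle to_circle
proof (rule equivpI)
  show "reflp (\<lambda>s t::real. s - t \<in> \<int>)"
    by (simp add: reflp_def)
  show "symp (\<lambda>s t::real. s - t \<in> \<int>)"
  proof (rule sympI)
    fix s t :: real
    assume "s - t \<in> \<int>"
    then have "- (s - t) \<in> \<int>" by (rule Ints_minus)
    then show "t - s \<in> \<int>" by simp
  qed
  show "transp (\<lambda>s t::real. s - t \<in> \<int>)"
  proof (rule transpI)
    fix r s t :: real
    assume "r - s \<in> \<int>" "s - t \<in> \<int>"
    then have "(r - s) + (s - t) \<in> \<int>" by (rule Ints_add)
    then show "r - t \<in> \<int>" by simp
  qed
qed

instantiation circle :: topological_space
begin

definition open_circle :: "circle set \<Rightarrow> bool"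
  where "open_circle U \<longleftrightarrow> open (to_circle -` U)"

instance
proof
  show "open (UNIV :: circle set)"
    by (simp add: open_circle_def)
  show "open (S \<inter> T)" if "open S" "open T" for S T :: "circle set"
    using that by (simp add: open_circle_def vimage_Int open_Int)
  show "open (\<Union>K)" if "\<forall>S\<in>K. open S" for K :: "circle set set"
    using that by (auto simp: open_circle_def vimage_Union intro!: open_UN)
qed

end

lemma continuous_on_circle_iff:
  fixes f :: "circle \<Rightarrow> 'a::topological_space"
  shows "continuous_on UNIV f \<longleftrightarrow> continuous_on UNIV (\<lambda>t. f (to_circle t))"
  by (simp add: continuous_on_open_vimage open_circle_def vimage_def)

text \<open>Derivatives on the circle are derivatives of the 1-periodic lift.\<close>

definition has_circle_derivative ::
    "(circle \<Rightarrow> 'a::real_normed_vector) \<Rightarrow> (circle \<Rightarrow> 'a) \<Rightarrow> bool"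
  where "has_circle_derivative u u' \<longleftrightarrow>
    (\<forall>t::real. ((\<lambda>s. u (to_circle s)) has_vector_derivative u' (to_circle t)) (at t))"

definition C2_circle :: "(circle \<Rightarrow> 'a::real_normed_vector) \<Rightarrow> bool"
  where "C2_circle u \<longleftrightarrow>
    (\<exists>u' u''. has_circle_derivative u u' \<and> has_circle_derivative u' u'' \<and> continuous_on UNIV u'')"


section \<open>Principal eigenvalues and the rate function\<close>

definition is_eigenvalue ::
    "(circle \<Rightarrow> real) \<Rightarrow> (circle \<Rightarrow> real) \<Rightarrow> (circle \<Rightarrow> real) \<Rightarrow> real \<Rightarrow> complex \<Rightarrow> bool"
  where "is_eigenvalue a b c \<epsilon> \<kappa> \<longleftrightarrow>
    (\<exists>u u' u'' :: circle \<Rightarrow> complex.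
       (\<exists>z. u z \<noteq> 0) \<and>
       has_circle_derivative u u' \<and> has_circle_derivative u' u'' \<and> continuous_on UNIV u'' \<and>
       (\<forall>z. of_real (\<epsilon> * a z) * u'' z + of_real (b z) * u' z + of_real (c z) * u z = \<kappa> * u z))"

definition principal_eigenvalue ::
    "(circle \<Rightarrow> real) \<Rightarrow> (circle \<Rightarrow> real) \<Rightarrow> (circle \<Rightarrow> real) \<Rightarrow> real \<Rightarrow> complex"
  where "principal_eigenvalue a b c \<epsilon> =
    (THE \<kappa>. is_eigenvalue a b c \<epsilon> \<kappa> \<and> (\<forall>\<nu>. is_eigenvalue a b c \<epsilon> \<nu> \<longrightarrow> Re \<nu> \<le> Re \<kappa>))"

text \<open>The principal eigenvalue is real, so taking the real part only changes the type.\<close>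

definition limit_eigenvalue ::
    "(circle \<Rightarrow> real) \<Rightarrow> (circle \<Rightarrow> real) \<Rightarrow> (circle \<Rightarrow> real) \<Rightarrow> real"
  where "limit_eigenvalue a b c = Lim (at_right 0) (\<lambda>\<epsilon>. Re (principal_eigenvalue a b c \<epsilon>))"

definition rate_function ::
    "(circle \<Rightarrow> real) \<Rightarrow> (circle \<Rightarrow> real) \<Rightarrow> circle measure \<Rightarrow> ereal"
  where "rate_function a b \<mu> =
    (SUP c\<in>{c. continuous_on UNIV c}. ereal (integral\<^sup>L \<mu> c - limit_eigenvalue a b c))"


section \<open>Probability measures on the circle with the weak topology\<close>

definition circle_prob_measures :: "circle measure set"
  where "circle_prob_measures = {\<mu>. prob_space \<mu> \<and> sets \<mu> = sets borel}"

text \<open>The coarsest topology that makes integration of every continuous function continuous.\<close>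

definition weak_topology :: "circle measure topology"
  where "weak_topology = topology_generated_by
    {{\<mu> \<in> circle_prob_measures. integral\<^sup>L \<mu> c \<in> U} | (c :: circle \<Rightarrow> real) (U :: real set).
       continuous_on UNIV c \<and> open U}"

text \<open>The image of the normalised Lebesgue measure on \<open>[0, T]\<close> under the path.\<close>

definition empirical_measure :: "(real \<Rightarrow> circle) \<Rightarrow> real \<Rightarrow> circle measure"
  where "empirical_measure p T =
    distr (scale_measure (ennreal (1 / T)) (restrict_space lborel {0..T})) borel p"


section \<open>Brownian motion, the Ito integral and diffusions on the circle\<close>

definition adapted :: "(real \<Rightarrow> 'w measure) \<Rightarrow> (real \<Rightarrow> 'w \<Rightarrow> real) \<Rightarrow> bool"
  where "adapted F X \<longleftrightarrow> (\<forall>t\<ge>0. X t \<in> borel_measurable (F t))"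

definition standard_brownian_motion ::
    "'w measure \<Rightarrow> (real \<Rightarrow> 'w measure) \<Rightarrow> (real \<Rightarrow> 'w \<Rightarrow> real) \<Rightarrow> bool"
  where "standard_brownian_motion M F W \<longleftrightarrow>
    adapted F W \<and>
    (AE \<omega> in M. W 0 \<omega> = 0) \<and>
    (AE \<omega> in M. continuous_on {0..} (\<lambda>t. W t \<omega>)) \<and>
    (\<forall>s t. 0 \<le> s \<and> s < t \<longrightarrow>
       distributed M lborel (\<lambda>\<omega>. W t \<omega> - W s \<omega>) (normal_density 0 (sqrt (t - s))) \<and>
       prob_space.indep_set M (sets (F s))
         {(\<lambda>\<omega>. W t \<omega> - W s \<omega>) -` A \<inter> space M | A. A \<in> sets borel})"

text \<open>
  A simple integrand is \<open>\<Sum>i<n. \<xi> i \<cdot> 1_(\<tau> i, \<tau> (i+1)]\<close> with bounded \<open>\<xi> i\<close> measurable at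
  time \<open>\<tau> i\<close>. The Ito integral on \<open>[0, t]\<close> of a square integrable progressively measurable
  integrand is the \<open>L\<^sup>2\<close>-limit of the integrals of simple integrands that approximate it in
  \<open>L\<^sup>2(ds \<otimes> dP)\<close>. It is determined only almost surely, hence a relation.
\<close>

definition simple_integrand ::
    "'w measure \<Rightarrow> (real \<Rightarrow> 'w measure) \<Rightarrow> nat \<Rightarrow> (nat \<Rightarrow> real) \<Rightarrow> (nat \<Rightarrow> 'w \<Rightarrow> real) \<Rightarrow> bool"
  where "simple_integrand M F n \<tau> \<xi> \<longleftrightarrow>
    0 \<le> \<tau> 0 \<and>
    (\<forall>i<n. \<tau> i \<le> \<tau> (Suc i) \<and> \<xi> i \<in> borel_measurable (F (\<tau> i)) \<and> bounded (\<xi> i ` space M))"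

definition simple_value ::
    "nat \<Rightarrow> (nat \<Rightarrow> real) \<Rightarrow> (nat \<Rightarrow> 'w \<Rightarrow> real) \<Rightarrow> real \<Rightarrow> 'w \<Rightarrow> real"
  where "simple_value n \<tau> \<xi> s \<omega> = (\<Sum>i<n. \<xi> i \<omega> * indicator {\<tau> i<..\<tau> (Suc i)} s)"

definition simple_integral ::
    "(real \<Rightarrow> 'w \<Rightarrow> real) \<Rightarrow> nat \<Rightarrow> (nat \<Rightarrow> real) \<Rightarrow> (nat \<Rightarrow> 'w \<Rightarrow> real) \<Rightarrow> real \<Rightarrow> 'w \<Rightarrow> real"
  where "simple_integral W n \<tau> \<xi> t \<omega> =
    (\<Sum>i<n. \<xi> i \<omega> * (W (min (\<tau> (Suc i)) t) \<omega> - W (min (\<tau> i) t) \<omega>))"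

definition has_ito_integral ::
    "'w measure \<Rightarrow> (real \<Rightarrow> 'w measure) \<Rightarrow> (real \<Rightarrow> 'w \<Rightarrow> real) \<Rightarrow> (real \<Rightarrow> 'w \<Rightarrow> real) \<Rightarrow>
     real \<Rightarrow> ('w \<Rightarrow> real) \<Rightarrow> bool"
  where "has_ito_integral M F W H t I \<longleftrightarrow>
    (\<forall>s\<in>{0..t}. (\<lambda>(r, \<omega>). H r \<omega>) \<in> borel_measurable (restrict_space borel {0..s} \<Otimes>\<^sub>M F s)) \<and>
    I \<in> borel_measurable M \<and>
    (\<exists>(n :: nat \<Rightarrow> nat) (\<tau> :: nat \<Rightarrow> nat \<Rightarrow> real) (\<xi> :: nat \<Rightarrow> nat \<Rightarrow> 'w \<Rightarrow> real).
       (\<forall>k. simple_integrand M F (n k) (\<tau> k) (\<xi> k)) \<and>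
       ((\<lambda>k. \<integral>\<^sup>+\<omega>. (\<integral>\<^sup>+s\<in>{0..t}. ennreal ((H s \<omega> - simple_value (n k) (\<tau> k) (\<xi> k) s \<omega>)\<^sup>2) \<partial>lborel) \<partial>M)
          \<longlonglongrightarrow> 0) \<and>
       ((\<lambda>k. \<integral>\<^sup>+\<omega>. ennreal ((I \<omega> - simple_integral W (n k) (\<tau> k) (\<xi> k) t \<omega>)\<^sup>2) \<partial>M)
          \<longlonglongrightarrow> 0))"

text \<open>
  \<open>X\<close> solves \<open>dX = s(X) dW + b(X) dt\<close> on the circle from \<open>x\<close>: it is the projection of a
  continuous adapted real process \<open>Y\<close> solving the equation with the 1-periodic lifts of \<open>s\<close> and \<open>b\<close>.
\<close>

definition circle_diffusion ::
    "'w measure \<Rightarrow> (real \<Rightarrow> 'w measure) \<Rightarrow> (real \<Rightarrow> 'w \<Rightarrow> real) \<Rightarrow>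
     (circle \<Rightarrow> real) \<Rightarrow> (circle \<Rightarrow> real) \<Rightarrow> circle \<Rightarrow> (real \<Rightarrow> 'w \<Rightarrow> circle) \<Rightarrow> bool"
  where "circle_diffusion M F W s b x X \<longleftrightarrow>
    (\<exists>(Y :: real \<Rightarrow> 'w \<Rightarrow> real) (y0 :: real).
       to_circle y0 = x \<and>
       (\<forall>t\<ge>0. \<forall>\<omega>\<in>space M. X t \<omega> = to_circle (Y t \<omega>)) \<and>
       adapted F Y \<and>
       (\<forall>\<omega>\<in>space M. continuous_on {0..} (\<lambda>t. Y t \<omega>)) \<and>
       (\<forall>t\<ge>0. \<exists>I. has_ito_integral M F W (\<lambda>r \<omega>. s (X r \<omega>)) t I \<and>
          (AE \<omega> in M. Y t \<omega> = y0 + I \<omega> + (LINT r:{0..t}|lborel. b (X r \<omega>)))))"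

definition ereal_ln :: "real \<Rightarrow> ereal"
  where "ereal_ln p = (if p = 0 then -\<infinity> else ereal (ln p))"

end

theory Submission
  imports Defs
begin

text \<open>
  Since \<open>b\<close> has no zeros, the flow of \<open>b\<close> has a single invariant probability measure, whose density
  is proportional to \<open>1 / b\<close>; write \<open>m(c)\<close> for the mean of \<open>c\<close> with respect to it. The principal
  eigenvalue of \<open>\<epsilon> a u'' + b u' + c u\<close> tends to \<open>m(c)\<close>, hence the rate function is \<open>0\<close> at the
  invariant measure and \<open>\<infinity>\<close> elsewhere, and both bounds say that the empirical measure leaves a
  neighbourhood of the invariant measure with superexponentially small probability as \<open>\<epsilon> \<rightarrow> 0\<close>.
  To see this, solve \<open>b \<phi>' = c - m(c)\<close> on the circle. Along the flow of \<open>b\<close> the integral of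
  \<open>c - m(c)\<close> is an increment of \<open>\<phi>\<close>, so on a time interval of length one the two differ by at most
  a multiple of the noise \<open>\<surd>\<epsilon> \<integral>\<sigma> dW\<close> on that interval, whose conditional exponential moments are
  Gaussian. Multiplying these over \<open>T\<close> intervals and applying Markov's inequality with parameter
  \<open>1 / \<surd>\<epsilon>\<close> bounds the probability of a deviation \<open>\<delta>\<close> by \<open>exp ((A - \<rho> / \<surd>\<epsilon>) T)\<close>. Only \<open>\<phi>\<close> of class
  \<open>C\<^sup>1\<close> is needed, and no Ito formula.
\<close>

section \<open>Periodic functions and functions on the circle\<close>

text \<open>Since m(c) is linear in c, its Legendre transform takes only the values 0 and infinity.
  So no precise rate has to be computed; any rate that tends to infinity as eps tends to 0 suffices.
  With r = 1 / sqrt(eps), the quadratic part of the exponential moment is of order r^2 eps and stays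
  bounded, while the gain r delta is unbounded. Two obstacles shape the estimates. First, c is
  merely continuous, so phi' is Lipschitz only up to an additive error. This error enters the
  exponent with the factor r as well, hence it may be a fixed fraction of delta. Second, the Ito
  integral is a relation at one fixed time, with unrelated approximations at different times.
  Exponential moments are therefore computed for simple integrands, compared by convexity, and
  passed to the limit by Fatou's lemma; conditioning is expressed by nonnegative weights that are
  measurable at the earlier time. For the eigenvalue, the key is a bound on the logarithmic
  derivative of the eigenfunction that does not deteriorate as eps tends to 0.\<close>

lemma to_circle_eq_iff: "to_circle s = to_circle t \<longleftrightarrow> s - t \<in> \<int>"
  by (simp add: circle.abs_eq_iff)

lemma to_circle_rep [simp]: "to_circle (rep_circle z) = z"
  by (rule Quotient3_abs_rep[OF Quotient3_circle])

lemma to_circle_add_1 [simp]: "to_circle (t + 1) = to_circle t"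
  by (simp add: to_circle_eq_iff)

lemma continuous_on_to_circle: "continuous_on A to_circle"
proof -
  have "continuous_on UNIV to_circle"
    by (simp add: continuous_on_open_vimage open_circle_def)
  then show ?thesis by (rule continuous_on_subset) simp
qed

lemma measurable_to_circle [measurable]: "to_circle \<in> borel \<rightarrow>\<^sub>M borel"
  by (intro borel_measurable_continuous_onI continuous_on_to_circle)

definition periodic :: "(real \<Rightarrow> 'a) \<Rightarrow> bool"
  where "periodic f \<longleftrightarrow> (\<forall>t. f (t + 1) = f t)"

lemma periodicI: "(\<And>t. f (t + 1) = f t) \<Longrightarrow> periodic f"
  by (simp add: periodic_def)

lemma periodicD: "periodic f \<Longrightarrow> f (t + 1) = f t"
  by (simp add: periodic_def)

lemma periodic_lift: "periodic (\<lambda>t. f (to_circle t))"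
  by (simp add: periodic_def)

lemma periodic_add_int:
  assumes "periodic f"
  shows "f (t + of_int n) = f t"
proof -
  have *: "f (s + real m) = f s" for m :: nat and s
  proof (induction m)
    case (Suc m)
    have "f (s + real (Suc m)) = f ((s + real m) + 1)" by (simp add: ac_simps)
    with Suc show ?case by (simp only: periodicD[OF assms])
  qed simp
  show ?thesis
  proof (cases "n \<ge> 0")
    case True
    then show ?thesis using *[of t "nat n"] by simp
  next
    case False
    then show ?thesis using *[of "t + of_int n" "nat (- n)"] by simp
  qed
qed

text \<open>\<open>rep_circle\<close> picks an unspecified representative, which is off from
  \<open>t\<close> by an integer. This is how periodic functions on the line descend to the
  circle.\<close>

lemma periodic_rep_circle:
  assumes "periodic f"
  shows "f (rep_circle (to_circle t)) = f t"
proof -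
  have "rep_circle (to_circle t) - t \<in> \<int>"
    by (simp flip: to_circle_eq_iff)
  then obtain n where "rep_circle (to_circle t) = t + of_int n"
    by (metis Ints_cases add.commute diff_add_cancel)
  with periodic_add_int[OF assms] show ?thesis by simp
qed

lemma periodic_mod_1:
  assumes "periodic f"
  shows "f (frac t) = f t"
  using periodic_add_int[OF assms, of "frac t" "\<lfloor>t\<rfloor>"] by (simp add: frac_def)

lemma periodic_attains_sup:
  fixes f :: "real \<Rightarrow> real"
  assumes "periodic f" "continuous_on UNIV f"
  obtains t0 where "\<And>t. f t \<le> f t0"
proof -
  obtain t0 where "t0 \<in> {0..1}" "\<And>t. t \<in> {0..1} \<Longrightarrow> f t \<le> f t0"
    using continuous_attains_sup[of "{0..1::real}" f] continuous_on_subset[OF assms(2)] by auto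
  then have "f t \<le> f t0" for t
    using periodic_mod_1[OF assms(1), of t] frac_ge_0[of t] frac_lt_1[of t]
    by (metis atLeastAtMost_iff less_eq_real_def)
  then show ?thesis by (rule that)
qed

lemma periodic_attains_inf:
  fixes f :: "real \<Rightarrow> real"
  assumes "periodic f" "continuous_on UNIV f"
  obtains t0 where "\<And>t. f t0 \<le> f t"
proof -
  have "periodic (\<lambda>t. - f t)" "continuous_on UNIV (\<lambda>t. - f t)"
    using assms by (auto simp: periodic_def intro: continuous_intros)
  then show ?thesis
    using that by (metis periodic_attains_sup neg_le_iff_le)
qed

lemma periodic_bounded:
  fixes f :: "real \<Rightarrow> real"
  assumes "periodic f" "continuous_on UNIV f"
  obtains B where "B > 0" "\<And>t. \<bar>f t\<bar> \<le> B"
proof -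
  have "periodic (\<lambda>t. \<bar>f t\<bar>)" "continuous_on UNIV (\<lambda>t. \<bar>f t\<bar>)"
    using assms by (auto simp: periodic_def intro: continuous_intros)
  then obtain t0 where "\<And>t. \<bar>f t\<bar> \<le> \<bar>f t0\<bar>"
    by (metis periodic_attains_sup)
  then show ?thesis
    by (intro that[of "\<bar>f t0\<bar> + 1"]) (auto simp: add_increasing2 intro: order_trans)
qed

lemma periodic_nonzero_lower:
  fixes f :: "real \<Rightarrow> real"
  assumes "periodic f" "continuous_on UNIV f" "\<And>t. f t \<noteq> 0"
  obtains m where "m > 0" "\<And>t. m \<le> \<bar>f t\<bar>"
proof -
  have "periodic (\<lambda>t. \<bar>f t\<bar>)" "continuous_on UNIV (\<lambda>t. \<bar>f t\<bar>)"
    using assms by (auto simp: periodic_def intro: continuous_intros)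
  then obtain t0 where "\<And>t. \<bar>f t0\<bar> \<le> \<bar>f t\<bar>"
    by (metis periodic_attains_inf)
  then show ?thesis
    using assms(3)[of t0] by (intro that[of "\<bar>f t0\<bar>"]) auto
qed

lemma periodic_uniformly_continuous:
  fixes f :: "real \<Rightarrow> real"
  assumes "periodic f" "continuous_on UNIV f" "e > 0"
  obtains d where "d > 0" "\<And>s t. \<bar>s - t\<bar> < d \<Longrightarrow> \<bar>f s - f t\<bar> < e"
proof -
  have "uniformly_continuous_on {-1..2} f"
    by (intro compact_uniformly_continuous continuous_on_subset[OF assms(2)]) auto
  then obtain d where d: "d > 0"
    "\<And>s t. s \<in> {-1..2} \<Longrightarrow> t \<in> {-1..2} \<Longrightarrow> dist s t < d \<Longrightarrow> dist (f s) (f t) < e"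
    unfolding uniformly_continuous_on_def using assms(3) by metis
  have "\<bar>f s - f t\<bar> < e" if "\<bar>s - t\<bar> < min d 1" for s t
  proof -
    \<comment> \<open>An integer shift brings \<open>t\<close> into [0, 1]; as \<open>s\<close> is
      less than 1 away, the compact interval [-1, 2] contains both.\<close>
    let ?n = "of_int (- \<lfloor>t\<rfloor>) :: real"
    have "t + ?n \<in> {0..1}" using floor_correct[of t] by auto linarith
    then have "t + ?n \<in> {-1..2}" "s + ?n \<in> {-1..2}"
      using that unfolding atLeastAtMost_iff by linarith+
    then have "dist (f (s + ?n)) (f (t + ?n)) < e"
      using that by (intro d) (auto simp: dist_real_def)
    then show ?thesis
      by (simp only: periodic_add_int[OF assms(1)] dist_real_def)
  qed
  with d(1) show ?thesis by (intro that[of "min d 1"]) auto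
qed

text \<open>Close points are handled by uniform continuity; at distance at least \<open>d\<close>
  the oscillation \<open>2 * B\<close> is at most \<open>2 * B / d * \<bar>s - t\<bar>\<close>. For
  a merely continuous function this takes the place of a Lipschitz bound.\<close>

lemma periodic_Lipschitz_up_to:
  fixes f :: "real \<Rightarrow> real"
  assumes "periodic f" "continuous_on UNIV f" "e > 0"
  obtains C where "C > 0" "\<And>s t. \<bar>f s - f t\<bar> \<le> e + C * \<bar>s - t\<bar>"
proof -
  obtain d where d: "d > 0" "\<And>s t. \<bar>s - t\<bar> < d \<Longrightarrow> \<bar>f s - f t\<bar> < e"
    using periodic_uniformly_continuous[OF assms] by metis
  obtain B where B: "B > 0" "\<And>t. \<bar>f t\<bar> \<le> B"
    using periodic_bounded[OF assms(1,2)] by metis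
  show ?thesis
  proof (rule that[of "2 * B / d"])
    show "2 * B / d > 0" using B d by simp
    fix s t
    show "\<bar>f s - f t\<bar> \<le> e + 2 * B / d * \<bar>s - t\<bar>"
    proof (cases "\<bar>s - t\<bar> < d")
      case True
      then have "\<bar>f s - f t\<bar> \<le> e" using d(2) by fastforce
      moreover have "0 \<le> 2 * B / d * \<bar>s - t\<bar>" using B d by simp
      ultimately show ?thesis by linarith
    next
      case False
      then have "2 * B * 1 \<le> 2 * B * (\<bar>s - t\<bar> / d)"
        using d B by (intro mult_left_mono) auto
      moreover have "\<bar>f s - f t\<bar> \<le> 2 * B" using B(2)[of s] B(2)[of t] by linarith
      ultimately show ?thesis using assms(3) by simp
    qed
  qed
qed

section \<open>Antiderivatives of periodic functions\<close>

lemma continuous_imp_antiderivative: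
  fixes f :: "real \<Rightarrow> real"
  assumes "continuous_on UNIV f"
  obtains g where "\<And>t. (g has_real_derivative f t) (at t)"
  using einterval_antiderivative[of "-\<infinity>" "\<infinity>" f] assms
  by (auto simp: continuous_on_eq_continuous_at has_real_derivative_iff_has_vector_derivative)

text \<open>The increment over a period has derivative \<open>f (t + 1) - f t = 0\<close>, so it is
  constant and equals its value at 0.\<close>

lemma antiderivative_periodic:
  fixes f g :: "real \<Rightarrow> real"
  assumes "periodic f" "\<And>t. (g has_real_derivative f t) (at t)" "g 1 = g 0"
  shows "periodic g"
proof (rule periodicI)
  fix t
  have "((\<lambda>t. g (t + 1) - g t) has_real_derivative f (t + 1) - f t) (at t)" for t
    by (intro DERIV_diff assms(2)) (use assms(2)[of "t + 1"] in \<open>simp add: DERIV_shift\<close>)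
  then have "((\<lambda>t. g (t + 1) - g t) has_real_derivative 0) (at t)" for t
    using assms(1) by (simp add: periodic_def)
  then have "g (t + 1) - g t = g (0 + 1) - g 0"
    by (intro DERIV_isconst_all) auto
  then show "g (t + 1) = g t" using assms(3) by simp
qed

lemma has_integral_of_derivative:
  fixes f g :: "real \<Rightarrow> real"
  assumes "s \<le> t" "\<And>t. (g has_real_derivative f t) (at t)"
  shows "(f has_integral g t - g s) {s..t}"
  using assms
  by (intro fundamental_theorem_of_calculus)
     (auto simp: has_real_derivative_iff_has_vector_derivative[symmetric]
           intro: has_field_derivative_at_within)

section \<open>The principal eigenvalue for small diffusion\<close>

lemma DERIV_zero_at_max:
  fixes f :: "real \<Rightarrow> real"
  assumes "(f has_real_derivative d) (at t0)" "\<And>t. f t \<le> f t0"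
  shows "d = 0"
  using DERIV_local_max[OF assms(1), of 1] assms(2) by simp

lemma DERIV_zero_at_min:
  fixes f :: "real \<Rightarrow> real"
  assumes "(f has_real_derivative d) (at t0)" "\<And>t. f t0 \<le> f t"
  shows "d = 0"
  using DERIV_local_min[OF assms(1), of 1] assms(2) by simp

lemma DERIV_imp_continuous_UNIV:
  fixes f :: "real \<Rightarrow> real"
  assumes "\<And>t. (f has_real_derivative f' t) (at t)"
  shows "continuous_on UNIV f"
  using assms DERIV_isCont by (auto simp: continuous_on_eq_continuous_at)

lemma nonvanishing_sign:
  fixes f :: "real \<Rightarrow> real"
  assumes "continuous_on UNIV f" "\<And>t. f t \<noteq> 0"
  shows "(\<forall>t. f t > 0) \<or> (\<forall>t. f t < 0)"
proof (rule ccontr)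
  assume "\<not> ?thesis"
  then obtain s t where st: "f s < 0" "f t > 0"
    using assms(2) by (metis linorder_neqE_linordered_idom)
  have "connected (range f)"
    using assms(1) by (intro connected_continuous_image) auto
  then have "0 \<in> range f"
    using st connectedD_interval[of "range f" "f s" "f t" 0] by auto
  with assms(2) show False by (metis rangeE)
qed

section \<open>Periodic solutions of linear first order equations\<close>

text \<open>Variation of constants, with the free constant \<open>K\<close> fixed by
  \<open>p 1 = p 0\<close>. This linear condition is solvable because \<open>\<beta>\<close> has no
  zero, so that the homogeneous solution \<open>exp (- B t)\<close> is not periodic.\<close>

lemma linear_periodic_ode_solution:
  fixes \<beta> f :: "real \<Rightarrow> real"
  assumes "periodic \<beta>" "continuous_on UNIV \<beta>" "\<And>t. \<beta> t \<noteq> 0"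
    and "periodic f" "continuous_on UNIV f"
  obtains p where "periodic p" "\<And>t. (p has_real_derivative f t - \<beta> t * p t) (at t)"
proof -
  obtain B where B: "\<And>t. (B has_real_derivative \<beta> t) (at t)"
    using continuous_imp_antiderivative[OF assms(2)] by metis
  have "continuous_on UNIV (\<lambda>t. exp (B t) * f t)"
    by (intro continuous_on_mult continuous_on_exp DERIV_imp_continuous_UNIV[OF B] assms(5))
  from continuous_imp_antiderivative[OF this]
  obtain E where E: "\<And>t. (E has_real_derivative exp (B t) * f t) (at t)" by metis
  have "B 1 \<noteq> B 0"
  proof
    assume "B 1 = B 0"
    moreover obtain z where "B 1 - B 0 = (1 - 0) * \<beta> z"
      using MVT2[of 0 1 B \<beta>] B by auto
    ultimately show False using assms(3)[of z] by simp
  qed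
  define K where "K = (exp (- B 0) * E 0 - exp (- B 1) * E 1) / (exp (- B 1) - exp (- B 0))"
  define p where "p t = exp (- B t) * (K + E t)" for t
  have "K * (exp (- B 1) - exp (- B 0)) = exp (- B 0) * E 0 - exp (- B 1) * E 1"
    using \<open>B 1 \<noteq> B 0\<close> by (simp add: K_def)
  then have p01: "p 1 = p 0"
    by (simp add: p_def algebra_simps)
  have p': "(p has_real_derivative f t - \<beta> t * p t) (at t)" for t
  proof -
    have "(p has_real_derivative exp (- B t) * (- \<beta> t) * (K + E t) + exp (- B t) * (exp (B t) * f t)) (at t)"
      unfolding p_def by (auto intro!: derivative_eq_intros B E)
    moreover have "exp (- B t) * (exp (B t) * f t) = f t"
      by (simp flip: mult.assoc exp_add)
    then have "exp (- B t) * (- \<beta> t) * (K + E t) + exp (- B t) * (exp (B t) * f t) = f t - \<beta> t * p t"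
      by (simp only: p_def) (simp add: algebra_simps)
    ultimately show ?thesis by simp
  qed
  have "p (t + 1) = p t" for t
  proof -
    \<comment> \<open>The shift of \<open>p\<close> solves the same equation, so the difference is a
      multiple of \<open>exp (- B t)\<close>; it vanishes at 0, hence everywhere.\<close>
    define q where "q t = (p (t + 1) - p t) * exp (B t)" for t
    have "(q has_real_derivative 0) (at t)" for t
    proof -
      have "((\<lambda>t. p (t + 1)) has_real_derivative f t - \<beta> t * p (t + 1)) (at t)"
        using p'[of "t + 1"] assms(1,4) by (simp add: DERIV_shift periodic_def)
      then have "(q has_real_derivative
          ((f t - \<beta> t * p (t + 1)) - (f t - \<beta> t * p t)) * exp (B t)
          + exp (B t) * \<beta> t * (p (t + 1) - p t)) (at t)"
        unfolding q_def by (auto intro!: derivative_eq_intros B p')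
      then show ?thesis by (simp add: algebra_simps)
    qed
    then have "q t = q 0" by (intro DERIV_isconst_all) auto
    then show ?thesis using p01 by (simp add: q_def)
  qed
  then have "periodic p" by (rule periodicI)
  with p' show ?thesis by (rule that[rotated])
qed

lemma integral_mono_const:
  fixes p :: "real \<Rightarrow> real"
  assumes "continuous_on UNIV p"
  shows "(\<And>t. p t \<le> M) \<Longrightarrow> integral {0..1} p \<le> M" "(\<And>t. m \<le> p t) \<Longrightarrow> m \<le> integral {0..1} p"
proof -
  have p: "p integrable_on {0..1}"
    using assms by (intro integrable_continuous_interval) (auto intro: continuous_on_subset)
  show "integral {0..1} p \<le> M" if "\<And>t. p t \<le> M"
    using integral_le[OF p integrable_const_ivl[of M 0 1]] that by simp
  show "m \<le> integral {0..1} p" if "\<And>t. m \<le> p t"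
    using integral_le[OF integrable_const_ivl[of m 0 1] p] that by simp
qed

lemma integral_pos:
  fixes p :: "real \<Rightarrow> real"
  assumes "periodic p" "continuous_on UNIV p" "\<And>t. p t > 0"
  shows "integral {0..1} p > 0"
proof -
  obtain t0 where "\<And>t. p t0 \<le> p t" using periodic_attains_inf[OF assms(1,2)] by metis
  then have "p t0 \<le> integral {0..1} p" by (intro integral_mono_const assms)
  with assms(3)[of t0] show ?thesis by simp
qed

lemma integral_nonvanishing:
  fixes p :: "real \<Rightarrow> real"
  assumes "periodic p" "continuous_on UNIV p" "\<And>t. p t \<noteq> 0"
  shows "integral {0..1} p \<noteq> 0"
  using nonvanishing_sign[OF assms(2,3)]
proof
  assume "\<forall>t. p t > 0"
  then show ?thesis using integral_pos[OF assms(1,2)] by force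
next
  assume "\<forall>t. p t < 0"
  then have "integral {0..1} (\<lambda>t. - p t) > 0"
    using assms by (intro integral_pos) (auto simp: periodic_def intro: continuous_intros)
  then show ?thesis by simp
qed

text \<open>
  With \<open>u = exp \<psi>\<close> and \<open>p = \<psi>'\<close>, the eigenvalue equation \<open>\<epsilon> a u'' + b u' + c u = \<kappa> u\<close>
  becomes the Riccati equation \<open>\<epsilon> a (p' + p\<^sup>2) + b p + c = \<kappa>\<close>, where \<open>\<psi>\<close> is periodic iff \<open>p\<close> has
  mean zero. It is solved by iterating the linear equation \<open>\<epsilon> a p' + b p = \<kappa> - f\<close> with
  \<open>f = c + \<epsilon> a p\<^sup>2\<close>; here \<open>\<kappa>\<close> is an unknown too.
\<close>

definition mean_zero_solution ::
    "(real \<Rightarrow> real) \<Rightarrow> (real \<Rightarrow> real) \<Rightarrow> (real \<Rightarrow> real) \<Rightarrow> (real \<Rightarrow> real) \<Rightarrow> real \<Rightarrow> bool"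
  where "mean_zero_solution a b f p \<kappa> \<longleftrightarrow>
    periodic p \<and> integral {0..1} p = 0 \<and>
    (\<forall>t. (p has_real_derivative (\<kappa> - f t - b t * p t) / a t) (at t))"

text \<open>For fixed \<open>\<kappa>\<close> the periodic solution is
  \<open>\<kappa> * g - q\<close>, where \<open>g\<close> and \<open>q\<close> belong to the
  right-hand sides \<open>1 / a\<close> and \<open>f / a\<close>. Its mean is affine in
  \<open>\<kappa>\<close> with slope the mean of \<open>g\<close>, so everything depends on this
  slope being nonzero.\<close>

lemma mean_zero_solution_exists:
  assumes "periodic a" "continuous_on UNIV a" "\<And>t. a t > 0"
    and "periodic b" "continuous_on UNIV b" "\<And>t. b t \<noteq> 0"
    and "periodic f" "continuous_on UNIV f"
  obtains p \<kappa> where "mean_zero_solution a b f p \<kappa>"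
proof -
  have a0: "a t \<noteq> 0" for t using assms(3)[of t] by simp
  have \<beta>: "periodic (\<lambda>t. b t / a t)" "continuous_on UNIV (\<lambda>t. b t / a t)" "\<And>t. b t / a t \<noteq> 0"
    using assms a0 by (auto simp: periodic_def intro!: continuous_intros)
  have "periodic (\<lambda>t. 1 / a t)" "continuous_on UNIV (\<lambda>t. 1 / a t)"
    using assms a0 by (auto simp: periodic_def intro!: continuous_intros)
  from linear_periodic_ode_solution[OF \<beta> this] obtain g where
    g: "periodic g" "\<And>t. (g has_real_derivative 1 / a t - b t / a t * g t) (at t)" by metis
  have "periodic (\<lambda>t. f t / a t)" "continuous_on UNIV (\<lambda>t. f t / a t)"
    using assms a0 by (auto simp: periodic_def intro!: continuous_intros)
  from linear_periodic_ode_solution[OF \<beta> this] obtain q where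
    q: "periodic q" "\<And>t. (q has_real_derivative f t / a t - b t / a t * q t) (at t)" by metis
  note gcont = DERIV_imp_continuous_UNIV[OF g(2)] and qcont = DERIV_imp_continuous_UNIV[OF q(2)]
  obtain tM where tM: "\<And>t. g t \<le> g tM" using periodic_attains_sup[OF g(1) gcont] by metis
  obtain tm where tm: "\<And>t. g tm \<le> g t" using periodic_attains_inf[OF g(1) gcont] by metis
  \<comment> \<open>At its extrema \<open>g\<close> equals \<open>1 / b\<close>. Hence the extremal
    value nearest to 0 already has the sign of \<open>b\<close>, and so has all of
    \<open>g\<close>.\<close>
  have "b tM * g tM = 1" "b tm * g tm = 1"
    using DERIV_zero_at_max[OF g(2) tM] DERIV_zero_at_min[OF g(2) tm] a0
    by (auto simp: field_simps)
  moreover have "g t > 0" if "\<forall>t. b t > 0" for t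
  proof -
    have "g tm > 0"
      using \<open>b tm * g tm = 1\<close> that zero_less_mult_pos[of "b tm" "g tm"] by simp
    with tm[of t] show ?thesis by simp
  qed
  moreover have "g t < 0" if "\<forall>t. b t < 0" for t
  proof -
    have "\<not> g tM \<ge> 0"
      using \<open>b tM * g tM = 1\<close> that mult_nonpos_nonneg[of "b tM" "g tM"] by (metis less_eq_real_def not_one_le_zero)
    with tM[of t] show ?thesis by simp
  qed
  ultimately have "g t \<noteq> 0" for t
    using nonvanishing_sign[OF assms(5,6)] by (metis less_irrefl)
  then have g0: "integral {0..1} g \<noteq> 0" by (rule integral_nonvanishing[OF g(1) gcont])
  define \<kappa> where "\<kappa> = integral {0..1} q / integral {0..1} g"
  define p where "p t = \<kappa> * g t - q t" for t
  have int: "g integrable_on {0..1}" "q integrable_on {0..1}"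
    using gcont qcont by (auto intro!: integrable_continuous_interval intro: continuous_on_subset)
  have "(p has_integral \<kappa> * integral {0..1} g - integral {0..1} q) {0..1}"
    unfolding p_def using int by (intro has_integral_diff has_integral_mult_right integrable_integral)
  then have "integral {0..1} p = 0" using g0 by (auto simp: \<kappa>_def dest!: integral_unique)
  moreover have "periodic p" using g(1) q(1) by (simp add: p_def periodic_def)
  moreover have "(p has_real_derivative (\<kappa> - f t - b t * p t) / a t) (at t)" for t
  proof -
    have "(p has_real_derivative \<kappa> * (1 / a t - b t / a t * g t) - (f t / a t - b t / a t * q t)) (at t)"
      unfolding p_def by (auto intro!: derivative_eq_intros g q)
    moreover have "\<kappa> * (1 / a t - b t / a t * g t) - (f t / a t - b t / a t * q t) = (\<kappa> - f t - b t * p t) / a t"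
      using a0[of t] by (simp add: p_def field_simps)
    ultimately show ?thesis by simp
  qed
  ultimately show ?thesis
    by (intro that[of p \<kappa>]) (simp add: mean_zero_solution_def)
qed

lemma mean_zero_solution_continuous:
  "mean_zero_solution a b f p \<kappa> \<Longrightarrow> continuous_on UNIV p"
  using DERIV_imp_continuous_UNIV[of p "\<lambda>t. (\<kappa> - f t - b t * p t) / a t"]
  by (simp add: mean_zero_solution_def)

text \<open>The problem is linear in right-hand side, solution and constant together. Applied to
  differences, the sup bound for single solutions becomes a Lipschitz estimate for the solution
  map.\<close>

lemma mean_zero_solution_diff:
  assumes "mean_zero_solution a b f p \<kappa>" "mean_zero_solution a b g q \<nu>"
  shows "mean_zero_solution a b (\<lambda>t. f t - g t) (\<lambda>t. p t - q t) (\<kappa> - \<nu>)"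
proof -
  have "p integrable_on {0..1}" "q integrable_on {0..1}"
    using assms[THEN mean_zero_solution_continuous]
    by (auto intro!: integrable_continuous_interval intro: continuous_on_subset)
  then have "integral {0..1} (\<lambda>t. p t - q t) = 0"
    using assms by (simp add: Henstock_Kurzweil_Integration.integral_diff mean_zero_solution_def)
  moreover have "((\<lambda>t. p t - q t) has_real_derivative
      (\<kappa> - \<nu> - (f t - g t) - b t * (p t - q t)) / a t) (at t)" for t
  proof -
    have "((\<lambda>t. p t - q t) has_real_derivative
        (\<kappa> - f t - b t * p t) / a t - (\<nu> - g t - b t * q t) / a t) (at t)"
      using assms by (intro DERIV_diff) (auto simp: mean_zero_solution_def)
    then show ?thesis by (simp add: algebra_simps diff_divide_distrib add_divide_distrib)
  qed
  ultimately show ?thesis using assms by (simp add: mean_zero_solution_def periodic_def)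
qed

text \<open>
  At its extrema \<open>p\<close> satisfies \<open>b p = \<kappa> - f\<close>; as \<open>p\<close> has mean zero, its extrema have opposite
  signs, which bounds \<open>\<kappa>\<close>.
\<close>

lemma mean_zero_solution_bound:
  assumes p: "mean_zero_solution a b f p \<kappa>" and a: "\<And>t. a t > 0"
    and b: "continuous_on UNIV b" "m > 0" "\<And>t. m \<le> \<bar>b t\<bar>" and f: "\<And>t. \<bar>f t\<bar> \<le> F"
  shows "\<bar>p t\<bar> \<le> 2 / m * F"
proof -
  note pcont = mean_zero_solution_continuous[OF p]
  have p': "\<And>t. (p has_real_derivative (\<kappa> - f t - b t * p t) / a t) (at t)"
    and "periodic p" and mean: "integral {0..1} p = 0"
    using p by (auto simp: mean_zero_solution_def)
  obtain tM where tM: "\<And>t. p t \<le> p tM" using periodic_attains_sup[OF \<open>periodic p\<close> pcont] by metis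
  obtain tm where tm: "\<And>t. p tm \<le> p t" using periodic_attains_inf[OF \<open>periodic p\<close> pcont] by metis
  have a0: "a t \<noteq> 0" for t using a[of t] by simp
  have eqs: "b tM * p tM = \<kappa> - f tM" "b tm * p tm = \<kappa> - f tm"
    using DERIV_zero_at_max[OF p' tM] DERIV_zero_at_min[OF p' tm] a0 by auto
  have signs: "p tm \<le> 0" "0 \<le> p tM"
    using integral_mono_const(1)[OF pcont tM] integral_mono_const(2)[OF pcont tm] mean by auto
  have fF: "- F \<le> f s" "f s \<le> F" for s using f[of s] by auto
  have "b t \<noteq> 0" for t using b(2) b(3)[of t] by auto
  then consider "\<forall>t. b t > 0" | "\<forall>t. b t < 0"
    using nonvanishing_sign[OF b(1)] by blast
  \<comment> \<open>\<open>b * p\<close> is nonnegative at one extremum and nonpositive at the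
    other, so \<open>\<kappa>\<close> lies between the values of \<open>f\<close> there. The size of
    \<open>a\<close> does not enter.\<close>
  then have "\<bar>\<kappa>\<bar> \<le> F"
  proof cases
    case 1
    then have "0 \<le> b tM * p tM" "b tm * p tm \<le> 0"
      using signs by (simp_all add: mult_nonneg_nonpos less_imp_le)
    then show ?thesis using eqs fF[of tM] fF[of tm] by auto
  next
    case 2
    then have "b tM * p tM \<le> 0" "0 \<le> b tm * p tm"
      using signs by (simp_all add: mult_nonpos_nonneg mult_nonpos_nonpos less_imp_le)
    then show ?thesis using eqs fF[of tM] fF[of tm] by auto
  qed
  then have "\<bar>b tM * p tM\<bar> \<le> 2 * F" "\<bar>b tm * p tm\<bar> \<le> 2 * F"
    using eqs f[of tM] f[of tm] by auto
  moreover have "m * \<bar>p s\<bar> \<le> \<bar>b s * p s\<bar>" for s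
    unfolding abs_mult using b(3)[of s] by (intro mult_right_mono) auto
  ultimately have "m * \<bar>p tM\<bar> \<le> 2 * F" "m * \<bar>p tm\<bar> \<le> 2 * F" by (meson order_trans)+
  then have "\<bar>p tM\<bar> \<le> 2 * F / m" "\<bar>p tm\<bar> \<le> 2 * F / m"
    using b(2) by (auto simp: field_simps)
  then show ?thesis using tM[of t] tm[of t] by simp
qed

section \<open>The Riccati equation for small diffusion\<close>

text \<open>A contraction argument in the sup norm. The bound of
  \<open>mean_zero_solution_bound\<close> involves \<open>b\<close> and the right-hand side but not
  the coefficient \<open>e * a\<close>, so it is uniform in \<open>e\<close>, and the quadratic term
  with its factor \<open>e\<close> is a small perturbation. It matters that \<open>R\<close> is
  independent of \<open>e\<close>.\<close>

lemma Riccati_periodic_solution: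
  fixes a b c :: "real \<Rightarrow> real"
  assumes a: "periodic a" "continuous_on UNIV a" "\<And>t. a t > 0"
    and b: "periodic b" "continuous_on UNIV b" "\<And>t. b t \<noteq> 0"
    and c: "periodic c" "continuous_on UNIV c"
  obtains e0 R where "e0 > 0" "R > 0"
    "\<And>e. 0 < e \<Longrightarrow> e < e0 \<Longrightarrow>
      \<exists>p \<kappa>. mean_zero_solution (\<lambda>t. e * a t) b (\<lambda>t. c t + e * a t * (p t)\<^sup>2) p \<kappa> \<and> (\<forall>t. \<bar>p t\<bar> \<le> R)"
proof -
  obtain m where m: "m > 0" "\<And>t. m \<le> \<bar>b t\<bar>" using periodic_nonzero_lower[OF b] by metis
  obtain A where A: "A > 0" "\<And>t. \<bar>a t\<bar> \<le> A" using periodic_bounded[OF a(1,2)] by metis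
  obtain C where C: "C > 0" "\<And>t. \<bar>c t\<bar> \<le> C" using periodic_bounded[OF c] by metis
  \<comment> \<open>The a priori bound for right-hand sides of size at most \<open>C + 1\<close>,
    where the 1 leaves room for the quadratic term.\<close>
  define R where "R = 2 / m * (C + 1)"
  have "R > 0" using m C by (simp add: R_def)
  \<comment> \<open>The first bound gives \<open>e * A * R\<^sup>2 \<le> 1\<close>, so that the ball
    is mapped into itself; the second makes the Lipschitz constant at most 1/2.\<close>
  define e0 where "e0 = min (1 / (A * R\<^sup>2)) (1 / (2 * (2 / m * (A * (2 * R)))))"
  have "e0 > 0" using A m \<open>R > 0\<close> by (simp add: e0_def)
  show ?thesis
  proof (rule that[OF \<open>e0 > 0\<close> \<open>R > 0\<close>])
    fix e :: real
    assume e: "0 < e" "e < e0"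
    have eA: "e * A * R\<^sup>2 \<le> 1"
      using e A \<open>R > 0\<close> by (simp add: e0_def field_simps)
    have eL: "2 / m * (e * A * (2 * R)) \<le> 1 / 2"
      using e A m \<open>R > 0\<close> by (simp add: e0_def field_simps)
    have ea: "periodic (\<lambda>t. e * a t)" "continuous_on UNIV (\<lambda>t. e * a t)" "\<And>t. e * a t > 0"
      using a e by (auto simp: periodic_def intro!: continuous_intros)
    define rhs :: "(real \<Rightarrow> real) \<Rightarrow> real \<Rightarrow> real" where "rhs p t = c t + e * a t * (p t)\<^sup>2" for p t
    \<comment> \<open>Periodicity is preserved under uniform limits, so this set is complete, as
      Banach's theorem requires.\<close>
    define S :: "(real \<Rightarrow>\<^sub>C real) set" where "S = {p. periodic (apply_bcontfun p)} \<inter> cball 0 R"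
    have SR: "\<bar>apply_bcontfun p t\<bar> \<le> R" if "p \<in> S" for p t
      using that norm_bounded[of p t] by (simp add: S_def)
    have "\<exists>q \<kappa>. mean_zero_solution (\<lambda>t. e * a t) b (rhs (apply_bcontfun p)) (apply_bcontfun q) \<kappa>"
      if "p \<in> S" for p
    proof -
      have "periodic (rhs p)" "continuous_on UNIV (rhs p)"
        using that a c by (auto simp: S_def rhs_def periodic_def intro!: continuous_intros)
      from mean_zero_solution_exists[OF ea b this] obtain q \<kappa>
        where q: "mean_zero_solution (\<lambda>t. e * a t) b (rhs p) q \<kappa>" by metis
      then have "periodic q" "continuous_on UNIV q"
        using mean_zero_solution_continuous[OF q] by (auto simp: mean_zero_solution_def)
      moreover from periodic_bounded[OF this] obtain B where "\<And>t. \<bar>q t\<bar> \<le> B" by metis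
      ultimately have "q \<in> bcontfun"
        by (intro bcontfun_normI[of _ B]) auto
      then have "apply_bcontfun (Bcontfun q) = q" by (rule Bcontfun_inverse)
      with q show ?thesis by metis
    qed
    then obtain \<Phi> K where \<Phi>: "\<And>p. p \<in> S \<Longrightarrow>
        mean_zero_solution (\<lambda>t. e * a t) b (rhs (apply_bcontfun p)) (apply_bcontfun (\<Phi> p)) (K p)"
      by metis
    have "uniform_space_class.complete S"
    proof -
      have "S = (\<Inter>t. {p. apply_bcontfun p (t + 1) = apply_bcontfun p t}) \<inter> cball 0 R"
        by (auto simp: S_def periodic_def)
      moreover have "closed {p :: real \<Rightarrow>\<^sub>C real. apply_bcontfun p (t + 1) = apply_bcontfun p t}" for t
      proof -
        have "continuous_on UNIV (\<lambda>p :: real \<Rightarrow>\<^sub>C real. apply_bcontfun p s)" for s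
          unfolding continuous_on_iff using dist_fun_lt_imp_dist_val_lt by blast
        then show ?thesis by (intro closed_Collect_eq)
      qed
      ultimately have "closed S" by auto
      then show ?thesis by (simp add: complete_eq_closed)
    qed
    moreover have "0 \<in> S"
      using \<open>R > 0\<close> by (simp add: S_def periodic_def)
    then have "S \<noteq> {}" by blast
    moreover have "\<Phi> ` S \<subseteq> S"
    proof (rule image_subsetI)
      fix p assume p: "p \<in> S"
      have "\<bar>rhs p t\<bar> \<le> C + 1" for t
      proof -
        have "e * a t * (p t)\<^sup>2 \<le> e * A * R\<^sup>2"
          using e A(2)[of t] a(3)[of t] SR[OF p, of t] A(1)
          by (intro mult_mono) (auto simp: abs_le_square_iff[symmetric])
        moreover have "0 \<le> e * a t * (p t)\<^sup>2" using e a(3)[of t] by simp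
        ultimately show ?thesis using eA C(2)[of t] unfolding rhs_def by linarith
      qed
      then have "\<bar>\<Phi> p t\<bar> \<le> R" for t
        using mean_zero_solution_bound[OF \<Phi>[OF p] ea(3) b(2) m, of "C + 1" t] by (simp add: R_def)
      then have "norm (\<Phi> p) \<le> R" by (intro norm_bound) auto
      with \<Phi>[OF p] show "\<Phi> p \<in> S" by (simp add: S_def mean_zero_solution_def)
    qed
    moreover have "\<forall>p\<in>S. \<forall>q\<in>S. dist (\<Phi> p) (\<Phi> q) \<le> 1 / 2 * dist p q"
    proof (intro ballI)
      fix p q assume p: "p \<in> S" and q: "q \<in> S"
      have "\<bar>rhs p t - rhs q t\<bar> \<le> e * A * (2 * R) * dist p q" for t
      proof -
        have "rhs p t - rhs q t = (e * a t) * ((p t + q t) * (p t - q t))"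
          by (simp add: rhs_def power2_eq_square algebra_simps)
        then have "\<bar>rhs p t - rhs q t\<bar> = (e * \<bar>a t\<bar>) * (\<bar>p t + q t\<bar> * \<bar>p t - q t\<bar>)"
          using e by (simp add: abs_mult)
        also have "\<dots> \<le> (e * A) * ((2 * R) * dist p q)"
          using e A SR[OF p, of t] SR[OF q, of t] dist_bounded[of p t q] \<open>R > 0\<close>
          by (intro mult_mono) (auto simp: dist_real_def)
        finally show ?thesis by (simp add: mult.assoc)
      qed
      then have "\<bar>\<Phi> p t - \<Phi> q t\<bar> \<le> 2 / m * (e * A * (2 * R) * dist p q)" for t
        using mean_zero_solution_bound[OF mean_zero_solution_diff[OF \<Phi>[OF p] \<Phi>[OF q]] ea(3) b(2) m]
        by blast
      moreover have "2 / m * (e * A * (2 * R) * dist p q) \<le> 1 / 2 * dist p q"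
        using mult_right_mono[OF eL, of "dist p q"] by (simp add: mult_ac)
      ultimately have "dist (\<Phi> p t) (\<Phi> q t) \<le> 1 / 2 * dist p q" for t
        unfolding dist_real_def by (meson order_trans)
      then show "dist (\<Phi> p) (\<Phi> q) \<le> 1 / 2 * dist p q" by (rule dist_bound)
    qed
    ultimately obtain p where p: "p \<in> S" "\<Phi> p = p"
      using Banach_fix[of S "1/2" \<Phi>] by auto
    then show "\<exists>p \<kappa>. mean_zero_solution (\<lambda>t. e * a t) b (\<lambda>t. c t + e * a t * (p t)\<^sup>2) p \<kappa> \<and>
        (\<forall>t. \<bar>p t\<bar> \<le> R)"
      using \<Phi>[OF p(1)] SR[OF p(1)] unfolding rhs_def by metis
  qed
qed

text \<open>Divide the Riccati equation by \<open>b\<close> and integrate over a period. The linear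
  term becomes the mean of \<open>p\<close> and drops out, the term with the derivative of
  \<open>p\<close> is integrated by parts, and what remains is of order \<open>e\<close> because
  \<open>p\<close> is bounded.\<close>

lemma Riccati_eigenvalue_estimate:
  fixes a b c :: "real \<Rightarrow> real"
  assumes p: "mean_zero_solution (\<lambda>t. e * a t) b (\<lambda>t. c t + e * a t * (p t)\<^sup>2) p \<kappa>"
    and R: "\<And>t. \<bar>p t\<bar> \<le> R" and "e > 0"
    and a: "\<And>t. a t > 0" "periodic a" "continuous_on UNIV a"
    and b: "\<And>t. b t \<noteq> 0" "periodic b" "continuous_on UNIV b"
    and c: "continuous_on UNIV c"
    and \<alpha>: "\<And>t. ((\<lambda>t. a t / b t) has_real_derivative \<alpha> t) (at t)" "continuous_on UNIV \<alpha>"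
    and A: "\<And>t. \<bar>a t / b t\<bar> \<le> A" "\<And>t. \<bar>\<alpha> t\<bar> \<le> A"
  shows "\<bar>\<kappa> * integral {0..1} (\<lambda>t. 1 / b t) - integral {0..1} (\<lambda>t. c t / b t)\<bar> \<le> e * (A * R + A * R\<^sup>2)"
proof -
  note pcont = mean_zero_solution_continuous[OF p]
  have p': "\<And>t. (p has_real_derivative (\<kappa> - (c t + e * a t * (p t)\<^sup>2) - b t * p t) / (e * a t)) (at t)"
    and pp: "periodic p" and mean: "integral {0..1} p = 0"
    using p by (auto simp: mean_zero_solution_def)
  have int: "f integrable_on {0..1}" if "continuous_on UNIV f" for f :: "real \<Rightarrow> real"
    using that by (auto intro!: integrable_continuous_interval intro: continuous_on_subset)
  define r where "r t = e * (\<alpha> t * p t - a t / b t * (p t)\<^sup>2)" for t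
  \<comment> \<open>The boundary term of the integration by parts; it is periodic, so its derivative
    integrates to 0 over a period.\<close>
  define q where "q t = e * (a t / b t * p t)" for t
  have "(q has_real_derivative r t + (\<kappa> * (1 / b t) - c t / b t - p t)) (at t)" for t
  proof -
    have "(q has_real_derivative e * (\<alpha> t * p t
        + (\<kappa> - (c t + e * a t * (p t)\<^sup>2) - b t * p t) / (e * a t) * (a t / b t))) (at t)"
      unfolding q_def by (intro DERIV_cmult DERIV_mult \<alpha> p')
    moreover have "e * (\<alpha> t * p t
        + (\<kappa> - (c t + e * a t * (p t)\<^sup>2) - b t * p t) / (e * a t) * (a t / b t))
        = r t + (\<kappa> * (1 / b t) - c t / b t - p t)"
      using a(1)[of t] b(1)[of t] \<open>e > 0\<close> by (simp add: r_def field_simps)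
    ultimately show ?thesis by simp
  qed
  from has_integral_of_derivative[OF _ this, of 0 1]
  have "((\<lambda>t. r t + (\<kappa> * (1 / b t) - c t / b t - p t)) has_integral q 1 - q 0) {0..1}" by simp
  moreover have "q 1 = q 0"
    using periodicD[OF pp, of 0] periodicD[OF a(2), of 0] periodicD[OF b(2), of 0] by (simp add: q_def)
  ultimately have sum0: "integral {0..1} (\<lambda>t. r t + (\<kappa> * (1 / b t) - c t / b t - p t)) = 0"
    by (simp add: integral_unique)
  have rcont: "continuous_on UNIV r"
    unfolding r_def using a b \<alpha>(2) pcont by (auto intro!: continuous_intros)
  have conts: "continuous_on UNIV (\<lambda>t. 1 / b t)" "continuous_on UNIV (\<lambda>t. c t / b t)"
    using b c by (auto intro!: continuous_intros)
  have "((\<lambda>t. r t + (\<kappa> * (1 / b t) - c t / b t - p t)) has_integral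
      integral {0..1} r + (\<kappa> * integral {0..1} (\<lambda>t. 1 / b t) - integral {0..1} (\<lambda>t. c t / b t) - integral {0..1} p)) {0..1}"
    by (intro has_integral_add has_integral_diff has_integral_mult_right integrable_integral int rcont conts pcont)
  then have "\<kappa> * integral {0..1} (\<lambda>t. 1 / b t) - integral {0..1} (\<lambda>t. c t / b t) = - integral {0..1} r"
    using sum0 mean by (simp add: integral_unique)
  moreover have "\<bar>r t\<bar> \<le> e * (A * R + A * R\<^sup>2)" for t
  proof -
    have "R \<ge> 0" using R[of 0] by linarith
    have "A \<ge> 0" using A(2)[of 0] by linarith
    have "\<bar>\<alpha> t * p t\<bar> \<le> A * R"
      unfolding abs_mult using A R \<open>R \<ge> 0\<close> \<open>A \<ge> 0\<close> by (intro mult_mono) auto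
    moreover have "\<bar>a t / b t * (p t)\<^sup>2\<bar> \<le> A * R\<^sup>2"
      unfolding abs_mult using A(1)[of t] R[of t] \<open>R \<ge> 0\<close> \<open>A \<ge> 0\<close>
      by (intro mult_mono) (auto simp: abs_le_square_iff[symmetric])
    ultimately have "\<bar>\<alpha> t * p t - a t / b t * (p t)\<^sup>2\<bar> \<le> A * R + A * R\<^sup>2" by linarith
    then show ?thesis using \<open>e > 0\<close> by (simp add: r_def abs_mult)
  qed
  then have "- (e * (A * R + A * R\<^sup>2)) \<le> r t" "r t \<le> e * (A * R + A * R\<^sup>2)" for t
    by (auto simp: abs_le_iff dest: spec[of _ t]) (metis abs_le_iff minus_le_iff)+
  from integral_mono_const(2)[OF rcont this(1)] integral_mono_const(1)[OF rcont this(2)]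
  have "\<bar>integral {0..1} r\<bar> \<le> e * (A * R + A * R\<^sup>2)" by linarith
  ultimately show ?thesis by simp
qed

section \<open>Maximum principle and positive eigenfunction\<close>

text \<open>\<open>w1\<close> and \<open>w2\<close> stand for the real and imaginary parts of an
  eigenfunction with eigenvalue r + i s of an operator without zero order term. The squared modulus
  \<open>h\<close> is a subsolution; a periodic subsolution is constant, and the explicit right-hand
  side \<open>k\<close> then forces the eigenfunction to be constant as well.\<close>

lemma periodic_maximum_principle:
  fixes A B w1 w2 :: "real \<Rightarrow> real"
  assumes A: "\<And>t. A t > 0" "continuous_on UNIV A" and B: "continuous_on UNIV B"
    and per: "periodic w1" "periodic w2"
    and w1: "\<And>t. (w1 has_real_derivative w1' t) (at t)" "\<And>t. (w1' has_real_derivative w1'' t) (at t)"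
    and w2: "\<And>t. (w2 has_real_derivative w2' t) (at t)" "\<And>t. (w2' has_real_derivative w2'' t) (at t)"
    and eq1: "\<And>t. A t * w1'' t + B t * w1' t = r * w1 t - s * w2 t"
    and eq2: "\<And>t. A t * w2'' t + B t * w2' t = r * w2 t + s * w1 t"
    and nz: "w1 z \<noteq> 0 \<or> w2 z \<noteq> 0" and "r \<ge> 0"
  shows "r = 0 \<and> s = 0"
proof -
  have A0: "A t \<noteq> 0" for t using A(1)[of t] by simp
  have "continuous_on UNIV (\<lambda>t. B t / A t)" using A B A0 by (auto intro!: continuous_intros)
  from continuous_imp_antiderivative[OF this]
  obtain E where E: "\<And>t. (E has_real_derivative B t / A t) (at t)" by metis
  define h where "h t = (w1 t)\<^sup>2 + (w2 t)\<^sup>2" for t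
  define h' where "h' t = 2 * (w1 t * w1' t + w2 t * w2' t)" for t
  define k where "k t = 2 * A t * ((w1' t)\<^sup>2 + (w2' t)\<^sup>2) + 2 * r * h t" for t
  \<comment> \<open>\<open>exp (E t)\<close> is the integrating factor that turns the operator
    acting on \<open>h\<close>, divided by \<open>A\<close>, into a single derivative.\<close>
  define Z where "Z t = h' t * exp (E t)" for t
  have h': "(h has_real_derivative h' t) (at t)" for t
    unfolding h_def h'_def by (auto intro!: derivative_eq_intros w1 w2)
  have Z': "(Z has_real_derivative k t / A t * exp (E t)) (at t)" for t
  proof -
    define h'' where "h'' = 2 * ((w1' t)\<^sup>2 + w1 t * w1'' t + ((w2' t)\<^sup>2 + w2 t * w2'' t))"
    have "(Z has_real_derivative h'' * exp (E t) + exp (E t) * (B t / A t) * h' t) (at t)"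
      unfolding Z_def h'_def h''_def
      by (auto intro!: derivative_eq_intros E w1 w2 simp: power2_eq_square algebra_simps)
    moreover have "A t * h'' + B t * h' t = k t"
    proof -
      have "A t * h'' + B t * h' t = 2 * A t * ((w1' t)\<^sup>2 + (w2' t)\<^sup>2)
          + 2 * (w1 t * (A t * w1'' t + B t * w1' t) + w2 t * (A t * w2'' t + B t * w2' t))"
        by (simp add: h''_def h'_def algebra_simps)
      also have "\<dots> = k t"
        unfolding eq1 eq2 by (simp add: k_def h_def power2_eq_square algebra_simps)
      finally show ?thesis .
    qed
    then have "h'' + B t / A t * h' t = k t / A t"
      using A0[of t] by (simp add: field_simps)
    then have "h'' * exp (E t) + exp (E t) * (B t / A t) * h' t = k t / A t * exp (E t)"
      by (metis (no_types, opaque_lifting) distrib_right mult.assoc mult.commute)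
    ultimately show ?thesis by simp
  qed
  have "periodic h" using per by (simp add: h_def periodic_def)
  obtain t0 where t0: "\<And>t. h t \<le> h t0"
    using periodic_attains_sup[OF \<open>periodic h\<close> DERIV_imp_continuous_UNIV[OF h']] by metis
  have k0: "k t \<ge> 0" for t using A(1)[of t] \<open>r \<ge> 0\<close> by (simp add: k_def h_def)
  have mono: "Z x \<le> Z y" if "x \<le> y" for x y
    by (rule DERIV_nonneg_imp_nondecreasing[OF that])
       (use Z' k0 A in \<open>metis divide_nonneg_pos exp_ge_zero mult_nonneg_nonneg\<close>)
  \<comment> \<open>Maximum points recur with period 1, so the nondecreasing \<open>Z\<close>
    vanishes at points that tend to both infinities, and therefore everywhere.\<close>
  have zeros: "Z (t0 + of_int n) = 0" for n
  proof -
    have "h t \<le> h (t0 + of_int n)" for t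
      using t0 periodic_add_int[OF \<open>periodic h\<close>] by simp
    from DERIV_zero_at_max[OF h' this] show ?thesis by (simp add: Z_def)
  qed
  have "Z t = 0" for t
  proof (rule antisym)
    have "t \<le> t0 + of_int \<lceil>t - t0\<rceil>" "t0 + of_int \<lfloor>t - t0\<rfloor> \<le> t"
      by linarith+
    from this[THEN mono] show "Z t \<le> 0" "0 \<le> Z t" by (simp_all add: zeros)
  qed
  then have "Z = (\<lambda>t. 0)" by blast
  then have "k t / A t * exp (E t) = 0" for t
    using DERIV_unique[OF Z'[of t], of 0] by simp
  then have k: "k t = 0" for t using A0 by simp
  have w': "w1' t = 0" "w2' t = 0" and rh: "r * h t = 0" for t
  proof -
    have "0 \<le> 2 * A t * ((w1' t)\<^sup>2 + (w2' t)\<^sup>2)" "0 \<le> 2 * r * h t"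
      using A(1)[of t] \<open>r \<ge> 0\<close> by (simp_all add: h_def)
    with k[of t] have *: "2 * A t * ((w1' t)\<^sup>2 + (w2' t)\<^sup>2) = 0" "2 * r * h t = 0"
      unfolding k_def by linarith+
    then show "w1' t = 0" "w2' t = 0" "r * h t = 0"
      using A0[of t] by (auto simp: sum_power2_eq_zero_iff)
  qed
  then have "w1' = (\<lambda>t. 0)" "w2' = (\<lambda>t. 0)" by auto
  then have "w1'' t = 0" "w2'' t = 0" for t
    using w1(2)[of t] w2(2)[of t] DERIV_unique DERIV_const by blast+
  moreover have "h z > 0" using nz by (auto simp: h_def sum_power2_gt_zero_iff)
  then have "r = 0" using rh[of z] by simp
  ultimately show ?thesis using eq1[of z] eq2[of z] w' nz by auto
qed

text \<open>The exponential of an antiderivative \<open>\<psi>\<close> of \<open>p\<close> is a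
  positive eigenfunction. Dividing any eigenfunction by it removes the zero order term, and the
  maximum principle excludes every other eigenvalue with real part at least \<open>\<kappa>\<close>.
  This gives both the maximality and the uniqueness that the definite description requires.\<close>

lemma circle_eigenvalue_Riccati:
  fixes a b c :: "circle \<Rightarrow> real"
  assumes a: "continuous_on UNIV a" "\<And>z. a z > 0" and b: "continuous_on UNIV b"
    and c: "continuous_on UNIV c" and "e > 0"
    and sol: "mean_zero_solution (\<lambda>t. e * a (to_circle t)) (\<lambda>t. b (to_circle t))
      (\<lambda>t. c (to_circle t) + e * a (to_circle t) * (p t)\<^sup>2) p \<kappa>"
  shows "principal_eigenvalue a b c e = of_real \<kappa>"
proof -
  note lifts = a(1)[unfolded continuous_on_circle_iff] b[unfolded continuous_on_circle_iff]
    c[unfolded continuous_on_circle_iff]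
  note pcont = mean_zero_solution_continuous[OF sol]
  have pp: "periodic p" and mean: "integral {0..1} p = 0"
    using sol by (auto simp: mean_zero_solution_def)
  define p' where "p' t = (\<kappa> - (c (to_circle t) + e * a (to_circle t) * (p t)\<^sup>2) - b (to_circle t) * p t)
      / (e * a (to_circle t))" for t
  have p': "(p has_real_derivative p' t) (at t)" for t
    using sol by (simp add: mean_zero_solution_def p'_def)
  have ea0: "e * a z \<noteq> 0" for z using a(2)[of z] \<open>e > 0\<close> by simp
  have p'cont: "continuous_on UNIV p'"
    unfolding p'_def using ea0 lifts pcont by (auto intro!: continuous_intros)
  have p'per: "periodic p'" using pp by (simp add: periodic_def p'_def)
  have Riccati: "e * a (to_circle t) * (p' t + (p t)\<^sup>2) + b (to_circle t) * p t + c (to_circle t) = \<kappa>" for t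
    using ea0[of "to_circle t"] by (simp add: p'_def field_simps)
  obtain \<psi> where \<psi>: "\<And>t. (\<psi> has_real_derivative p t) (at t)"
    using continuous_imp_antiderivative[OF pcont] by metis
  have "\<psi> 1 = \<psi> 0"
    using has_integral_of_derivative[OF _ \<psi>, of 0 1] mean by (auto dest: integral_unique)
  from antiderivative_periodic[OF pp \<psi> this] have \<psi>p: "periodic \<psi>" .
  note \<psi>cont = DERIV_imp_continuous_UNIV[OF \<psi>]
  have ev: "is_eigenvalue a b c e (of_real \<kappa>)"
    unfolding is_eigenvalue_def
  proof (intro exI conjI allI)
    define u where "u z = complex_of_real (exp (\<psi> (rep_circle z)))" for z
    define u' where "u' z = complex_of_real (p (rep_circle z) * exp (\<psi> (rep_circle z)))" for z
    define u'' where "u'' z = complex_of_real ((p' (rep_circle z) + (p (rep_circle z))\<^sup>2)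
        * exp (\<psi> (rep_circle z)))" for z
    have u: "u (to_circle t) = complex_of_real (exp (\<psi> t))"
      "u' (to_circle t) = complex_of_real (p t * exp (\<psi> t))"
      "u'' (to_circle t) = complex_of_real ((p' t + (p t)\<^sup>2) * exp (\<psi> t))" for t
      using pp \<psi>p p'per by (simp_all add: u_def u'_def u''_def periodic_rep_circle)
    show "u z \<noteq> 0" for z by (simp add: u_def)
    have lift_deriv: "((\<lambda>t. complex_of_real (f t)) has_vector_derivative complex_of_real d) (at t)"
      if "(f has_real_derivative d) (at t)" for f d t
      using that by (simp add: has_real_derivative_iff_has_vector_derivative has_vector_derivative_of_real)
    show "has_circle_derivative u u'"
      unfolding has_circle_derivative_def u
      by (intro allI lift_deriv) (auto intro!: derivative_eq_intros \<psi>)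
    show "has_circle_derivative u' u''"
      unfolding has_circle_derivative_def u
      by (intro allI lift_deriv)
         (auto intro!: derivative_eq_intros \<psi> p' simp: power2_eq_square algebra_simps)
    show "continuous_on UNIV u''"
      unfolding continuous_on_circle_iff u using p'cont pcont \<psi>cont
      by (intro continuous_intros)
    show "of_real (e * a z) * u'' z + of_real (b z) * u' z + of_real (c z) * u z = of_real \<kappa> * u z" for z
    proof -
      obtain t where z: "z = to_circle t" by (metis to_circle_rep)
      have "e * a z * ((p' t + (p t)\<^sup>2) * exp (\<psi> t)) + b z * (p t * exp (\<psi> t)) + c z * exp (\<psi> t)
          = \<kappa> * exp (\<psi> t)"
        unfolding Riccati[of t, folded z, symmetric] by (simp add: algebra_simps)
      then have "complex_of_real (e * a z * ((p' t + (p t)\<^sup>2) * exp (\<psi> t)) + b z * (p t * exp (\<psi> t)) + c z * exp (\<psi> t))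
          = complex_of_real (\<kappa> * exp (\<psi> t))"
        by (rule arg_cong)
      then show ?thesis
        unfolding z u by (simp only: of_real_add of_real_mult)
    qed
  qed
  have unique: "\<nu> = of_real \<kappa>" if \<nu>: "is_eigenvalue a b c e \<nu>" and "Re \<nu> \<ge> \<kappa>" for \<nu>
  proof -
    obtain v v' v'' where v0: "\<exists>z. v z \<noteq> 0"
      and v: "has_circle_derivative v v'" "has_circle_derivative v' v''"
      and eq: "\<And>z. of_real (e * a z) * v'' z + of_real (b z) * v' z + of_real (c z) * v z = \<nu> * v z"
      using \<nu> unfolding is_eigenvalue_def by metis
    have dRe: "((\<lambda>t. Re (f (to_circle t))) has_real_derivative Re (f' (to_circle t))) (at t)"
      and dIm: "((\<lambda>t. Im (f (to_circle t))) has_real_derivative Im (f' (to_circle t))) (at t)"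
      if "has_circle_derivative f f'" for f f' t
      using that bounded_linear.has_vector_derivative[OF bounded_linear_Re]
        bounded_linear.has_vector_derivative[OF bounded_linear_Im]
      by (auto simp: has_circle_derivative_def has_real_derivative_iff_has_vector_derivative)
    \<comment> \<open>\<open>w f\<close> is the quotient of \<open>f\<close> by the positive
      eigenfunction; \<open>w'\<close> and \<open>w''\<close> are its derivatives, expressed through
      those of \<open>f\<close>.\<close>
    define w :: "(real \<Rightarrow> real) \<Rightarrow> real \<Rightarrow> real" where "w f t = f t * exp (- \<psi> t)" for f t
    define w' :: "(real \<Rightarrow> real) \<Rightarrow> (real \<Rightarrow> real) \<Rightarrow> real \<Rightarrow> real"
      where "w' f f' t = (f' t - p t * f t) * exp (- \<psi> t)" for f f' t
    define w'' :: "(real \<Rightarrow> real) \<Rightarrow> (real \<Rightarrow> real) \<Rightarrow> (real \<Rightarrow> real) \<Rightarrow> real \<Rightarrow> real"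
      where "w'' f f' f'' t = (f'' t - 2 * p t * f' t + ((p t)\<^sup>2 - p' t) * f t) * exp (- \<psi> t)" for f f' f'' t
    have w: "(w f has_real_derivative w' f f' t) (at t)"
      if "\<And>t. (f has_real_derivative f' t) (at t)" for f f' t
      unfolding w_def w'_def by (auto intro!: derivative_eq_intros that \<psi> simp: algebra_simps)
    have w': "(w' f f' has_real_derivative w'' f f' f'' t) (at t)"
      if "\<And>t. (f has_real_derivative f' t) (at t)" "\<And>t. (f' has_real_derivative f'' t) (at t)" for f f' f'' t
      unfolding w'_def w''_def
      by (auto intro!: derivative_eq_intros that \<psi> p' simp: power2_eq_square algebra_simps)
    define Aw where "Aw t = e * a (to_circle t)" for t
    \<comment> \<open>The drift of the transformed operator: differentiating a product with
      \<open>exp \<psi>\<close> twice adds a first order term with coefficient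
      \<open>2 * Aw t * p t\<close>.\<close>
    define Bw where "Bw t = b (to_circle t) + 2 * Aw t * p t" for t
    have conj: "Aw t * w'' f f' f'' t + Bw t * w' f f' t =
        (Aw t * f'' t + b (to_circle t) * f' t + (c (to_circle t) - \<kappa>) * f t) * exp (- \<psi> t)" for f f' f'' t
      unfolding Riccati[of t, symmetric] Bw_def
      by (simp add: w''_def w'_def Aw_def power2_eq_square algebra_simps)
    let ?f1 = "\<lambda>t. Re (v (to_circle t))" and ?f2 = "\<lambda>t. Im (v (to_circle t))"
    have eqRe: "Aw t * Re (v'' (to_circle t)) + b (to_circle t) * Re (v' (to_circle t)) + (c (to_circle t) - \<kappa>) * ?f1 t
        = (Re \<nu> - \<kappa>) * ?f1 t - Im \<nu> * ?f2 t"
      and eqIm: "Aw t * Im (v'' (to_circle t)) + b (to_circle t) * Im (v' (to_circle t)) + (c (to_circle t) - \<kappa>) * ?f2 t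
        = (Re \<nu> - \<kappa>) * ?f2 t + Im \<nu> * ?f1 t" for t
      using arg_cong[OF eq[of "to_circle t"], of Re] arg_cong[OF eq[of "to_circle t"], of Im]
      by (simp_all add: Aw_def algebra_simps)
    obtain z where "v (to_circle z) \<noteq> 0" using v0 by (metis to_circle_rep)
    then have nz: "w ?f1 z \<noteq> 0 \<or> w ?f2 z \<noteq> 0"
      by (auto simp: w_def complex_eq_iff)
    have "Re \<nu> - \<kappa> = 0 \<and> Im \<nu> = 0"
    proof (rule periodic_maximum_principle[of Aw Bw "w ?f1" "w ?f2"])
      show "Aw t > 0" for t using a(2) \<open>e > 0\<close> by (simp add: Aw_def)
      show "continuous_on UNIV Aw" "continuous_on UNIV Bw"
        unfolding Bw_def Aw_def using lifts pcont by (auto intro!: continuous_intros)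
      show "periodic (w ?f1)" "periodic (w ?f2)"
        using \<psi>p by (simp_all add: w_def periodic_def)
      show "\<And>t. (w ?f1 has_real_derivative w' ?f1 (\<lambda>t. Re (v' (to_circle t))) t) (at t)"
        "\<And>t. (w ?f2 has_real_derivative w' ?f2 (\<lambda>t. Im (v' (to_circle t))) t) (at t)"
        by (intro w dRe dIm v)+
      show "\<And>t. (w' ?f1 (\<lambda>t. Re (v' (to_circle t))) has_real_derivative
          w'' ?f1 (\<lambda>t. Re (v' (to_circle t))) (\<lambda>t. Re (v'' (to_circle t))) t) (at t)"
        "\<And>t. (w' ?f2 (\<lambda>t. Im (v' (to_circle t))) has_real_derivative
          w'' ?f2 (\<lambda>t. Im (v' (to_circle t))) (\<lambda>t. Im (v'' (to_circle t))) t) (at t)"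
        by (intro w' dRe dIm v)+
      show "Re \<nu> - \<kappa> \<ge> 0" using that by simp
      show "w ?f1 z \<noteq> 0 \<or> w ?f2 z \<noteq> 0" by (rule nz)
      show "Aw t * w'' ?f1 (\<lambda>t. Re (v' (to_circle t))) (\<lambda>t. Re (v'' (to_circle t))) t
          + Bw t * w' ?f1 (\<lambda>t. Re (v' (to_circle t))) t = (Re \<nu> - \<kappa>) * w ?f1 t - Im \<nu> * w ?f2 t" for t
        unfolding conj eqRe by (simp add: w_def algebra_simps)
      show "Aw t * w'' ?f2 (\<lambda>t. Im (v' (to_circle t))) (\<lambda>t. Im (v'' (to_circle t))) t
          + Bw t * w' ?f2 (\<lambda>t. Im (v' (to_circle t))) t = (Re \<nu> - \<kappa>) * w ?f2 t + Im \<nu> * w ?f1 t" for t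
        unfolding conj eqIm by (simp add: w_def algebra_simps)
    qed
    then show ?thesis by (simp add: complex_eq_iff)
  qed
  show ?thesis
    unfolding principal_eigenvalue_def
  proof (rule the_equality)
    show "is_eigenvalue a b c e (of_real \<kappa>) \<and>
        (\<forall>\<nu>. is_eigenvalue a b c e \<nu> \<longrightarrow> Re \<nu> \<le> Re (of_real \<kappa>))"
      using ev unique by (metis Re_complex_of_real linorder_le_cases order_refl)
    fix \<nu>
    assume \<nu>: "is_eigenvalue a b c e \<nu> \<and> (\<forall>\<nu>'. is_eigenvalue a b c e \<nu>' \<longrightarrow> Re \<nu>' \<le> Re \<nu>)"
    then have "\<kappa> \<le> Re \<nu>" using ev by fastforce
    with \<nu> show "\<nu> = of_real \<kappa>" by (intro unique) auto
  qed
qed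

section \<open>The limit of the principal eigenvalue\<close>

lemma has_circle_derivative_real:
  fixes u u' :: "circle \<Rightarrow> real"
  assumes "has_circle_derivative u u'"
  shows "((\<lambda>s. u (to_circle s)) has_real_derivative u' (to_circle t)) (at t)"
  using assms by (simp add: has_circle_derivative_def has_real_derivative_iff_has_vector_derivative)

lemma has_circle_derivative_continuous:
  fixes u u' :: "circle \<Rightarrow> real"
  assumes "has_circle_derivative u u'"
  shows "continuous_on UNIV u"
  unfolding continuous_on_circle_iff
  by (rule DERIV_imp_continuous_UNIV[OF has_circle_derivative_real[OF assms]])

text \<open>The denominator normalises the density \<open>1 / b\<close> and carries the sign of
  \<open>b\<close>, which makes the formula valid for both directions of the flow.\<close>

definition circle_mean :: "(circle \<Rightarrow> real) \<Rightarrow> (circle \<Rightarrow> real) \<Rightarrow> real"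
  where "circle_mean b c = integral {0..1} (\<lambda>t. c (to_circle t) / b (to_circle t))
    / integral {0..1} (\<lambda>t. 1 / b (to_circle t))"

theorem limit_eigenvalue_eq:
  fixes \<sigma> a b c :: "circle \<Rightarrow> real"
  assumes \<sigma>: "C2_circle \<sigma>" and bC: "C2_circle b"
    and a: "\<And>z. a z = (\<sigma> z)\<^sup>2 / 2" "\<And>z. a z > 0" and b0: "\<And>z. b z \<noteq> 0"
    and c: "continuous_on UNIV c"
  shows "limit_eigenvalue a b c = circle_mean b c"
proof -
  obtain \<sigma>' \<sigma>'' where \<sigma>': "has_circle_derivative \<sigma> \<sigma>'" "has_circle_derivative \<sigma>' \<sigma>''"
    using \<sigma> by (auto simp: C2_circle_def)
  obtain b' b'' where b': "has_circle_derivative b b'" "has_circle_derivative b' b''"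
    using bC by (auto simp: C2_circle_def)
  note conts = \<sigma>'[THEN has_circle_derivative_continuous] b'[THEN has_circle_derivative_continuous]
  have "a = (\<lambda>z. (\<sigma> z)\<^sup>2 / 2)" using a(1) by blast
  then have acont: "continuous_on UNIV a" using conts by (auto intro!: continuous_intros)
  note lifts = acont[unfolded continuous_on_circle_iff] conts(3)[unfolded continuous_on_circle_iff]
    c[unfolded continuous_on_circle_iff] conts[unfolded continuous_on_circle_iff]
  obtain e0 R where "e0 > 0" "R > 0" and Riccati: "\<And>e. 0 < e \<Longrightarrow> e < e0 \<Longrightarrow>
      \<exists>p \<kappa>. mean_zero_solution (\<lambda>t. e * a (to_circle t)) (\<lambda>t. b (to_circle t))
        (\<lambda>t. c (to_circle t) + e * a (to_circle t) * (p t)\<^sup>2) p \<kappa> \<and> (\<forall>t. \<bar>p t\<bar> \<le> R)"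
    by (rule Riccati_periodic_solution[OF periodic_lift[of a] lifts(1) a(2) periodic_lift[of b] lifts(2) b0
          periodic_lift[of c] lifts(3)]) (rule that; assumption)
  \<comment> \<open>The derivative of \<open>a / b\<close> by the quotient rule; the regularity of
    \<open>\<sigma>\<close> and \<open>b\<close> makes it continuous and hence bounded.\<close>
  define \<alpha> where "\<alpha> z = (\<sigma> z * \<sigma>' z * b z - (\<sigma> z)\<^sup>2 / 2 * b' z) / (b z)\<^sup>2" for z
  have \<alpha>: "((\<lambda>t. a (to_circle t) / b (to_circle t)) has_real_derivative \<alpha> (to_circle t)) (at t)" for t
    unfolding a(1) \<alpha>_def
    by (auto intro!: derivative_eq_intros has_circle_derivative_real[OF \<sigma>'(1)] has_circle_derivative_real[OF b'(1)]
        simp: b0 power2_eq_square field_simps)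
  have \<alpha>cont: "continuous_on UNIV (\<lambda>t. \<alpha> (to_circle t))"
    unfolding \<alpha>_def using lifts b0 by (auto intro!: continuous_intros)
  obtain A1 where A1: "\<And>t. \<bar>\<alpha> (to_circle t)\<bar> \<le> A1"
    using periodic_bounded[OF periodic_lift \<alpha>cont] by metis
  obtain A2 where A2: "\<And>t. \<bar>a (to_circle t) / b (to_circle t)\<bar> \<le> A2"
    using periodic_bounded[OF periodic_lift[of "\<lambda>z. a z / b z"]  DERIV_imp_continuous_UNIV[OF \<alpha>]] by metis
  define A where "A = max A1 A2"
  have A: "\<bar>a (to_circle t) / b (to_circle t)\<bar> \<le> A" "\<bar>\<alpha> (to_circle t)\<bar> \<le> A" for t
    using A1[of t] A2[of t] by (auto simp: A_def)
  define I where "I = integral {0..1} (\<lambda>t. 1 / b (to_circle t))"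
  define D where "D = (A * R + A * R\<^sup>2) / \<bar>I\<bar>"
  have "I \<noteq> 0"
    unfolding I_def using b0 lifts
    by (intro integral_nonvanishing periodic_lift[of "\<lambda>z. 1 / b z"]) (auto intro!: continuous_intros)
  have est: "\<bar>Re (principal_eigenvalue a b c e) - circle_mean b c\<bar> \<le> e * D" if e: "0 < e" "e < e0" for e
  proof -
    obtain p \<kappa> where p: "mean_zero_solution (\<lambda>t. e * a (to_circle t)) (\<lambda>t. b (to_circle t))
        (\<lambda>t. c (to_circle t) + e * a (to_circle t) * (p t)\<^sup>2) p \<kappa>" "\<And>t. \<bar>p t\<bar> \<le> R"
      using Riccati[OF e] by blast
    have "principal_eigenvalue a b c e = of_real \<kappa>"
      by (rule circle_eigenvalue_Riccati[OF acont a(2) conts(3) c e(1) p(1)])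
    moreover have "\<bar>\<kappa> * I - circle_mean b c * I\<bar> \<le> e * (A * R + A * R\<^sup>2)"
      using Riccati_eigenvalue_estimate[OF p e(1) a(2) periodic_lift lifts(1) b0 periodic_lift lifts(2,3) \<alpha> \<alpha>cont A]
        \<open>I \<noteq> 0\<close>
      by (simp add: circle_mean_def I_def)
    then have "\<bar>\<kappa> - circle_mean b c\<bar> * \<bar>I\<bar> \<le> e * (A * R + A * R\<^sup>2)"
      by (simp flip: abs_mult add: left_diff_distrib)
    then have "\<bar>\<kappa> - circle_mean b c\<bar> \<le> e * D"
      using \<open>I \<noteq> 0\<close> by (simp add: D_def field_simps)
    ultimately show ?thesis by simp
  qed
  have "((\<lambda>e. Re (principal_eigenvalue a b c e) - circle_mean b c) \<longlongrightarrow> 0) (at_right 0)"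
  proof (rule Lim_null_comparison)
    show "\<forall>\<^sub>F e in at_right 0. norm (Re (principal_eigenvalue a b c e) - circle_mean b c) \<le> e * D"
      using eventually_at_right_real[OF \<open>e0 > 0\<close>] by eventually_elim (use est in auto)
    show "((\<lambda>e. e * D) \<longlongrightarrow> 0) (at_right 0)"
      by (rule tendsto_eq_intros refl tendsto_ident_at)+ simp
  qed
  then have "((\<lambda>e. Re (principal_eigenvalue a b c e)) \<longlongrightarrow> circle_mean b c) (at_right 0)"
    by (simp add: LIM_zero_iff)
  then show ?thesis
    unfolding limit_eigenvalue_def by (intro tendsto_Lim) auto
qed

section \<open>Exponential moments of simple Ito integrals\<close>

lemma step_mono:
  fixes p :: "nat \<Rightarrow> real"
  assumes "\<And>i. i < m \<Longrightarrow> p i \<le> p (Suc i)" "i \<le> j" "j \<le> m"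
  shows "p i \<le> p j"
  using assms(2,3)
proof (induction j rule: dec_induct)
  case (step n)
  then show ?case using assms(1)[of n] by simp
qed simp

locale filtered_brownian_motion = prob_space M
  for M :: "'w measure" and F :: "real \<Rightarrow> 'w measure" and W :: "real \<Rightarrow> 'w \<Rightarrow> real" +
  assumes filtration_F: "filtration (space M) F"
    and subalgebra_F: "\<And>t. subalgebra M (F t)"
    and brownian_W: "standard_brownian_motion M F W"
begin

lemma space_F [simp]: "space (F t) = space M"
  using subalgebra_F[of t] by (simp add: subalgebra_def)

lemma measurable_F_mono:
  assumes "f \<in> measurable (F s) N" "s \<le> t"
  shows "f \<in> measurable (F t) N"
proof -
  have "sets (F s) \<subseteq> sets (F t)"
    using filtration_F assms(2) by (auto simp: filtration_def)
  then show ?thesis using assms(1) by (auto simp: measurable_def)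
qed

lemma measurable_F_M: "f \<in> measurable (F s) N \<Longrightarrow> f \<in> measurable M N"
  by (rule measurable_from_subalg[OF subalgebra_F])

lemma measurable_W_F: "0 \<le> s \<Longrightarrow> W s \<in> borel_measurable (F s)"
  using brownian_W by (simp add: standard_brownian_motion_def adapted_def)

lemma measurable_W: "0 \<le> s \<Longrightarrow> W s \<in> borel_measurable M"
  by (rule measurable_F_M[OF measurable_W_F])

text \<open>By independence, the joint law of \<open>\<omega>\<close>, seen through
  \<open>F s\<close>, and the increment is a product measure. Tonelli's theorem then integrates out
  the increment with \<open>\<omega>\<close> frozen; this replaces conditional expectations.\<close>

lemma nn_integral_increment:
  assumes "0 \<le> s" "s < t" and f: "f \<in> borel_measurable (F s \<Otimes>\<^sub>M lborel)"
  shows "(\<integral>\<^sup>+\<omega>. f (\<omega>, W t \<omega> - W s \<omega>) \<partial>M)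
    = (\<integral>\<^sup>+\<omega>. (\<integral>\<^sup>+x. ennreal (normal_density 0 (sqrt (t - s)) x) * f (\<omega>, x) \<partial>lborel) \<partial>M)"
proof -
  define \<Delta> where "\<Delta> = (\<lambda>\<omega>. W t \<omega> - W s \<omega>)"
  have dist: "distributed M lborel \<Delta> (normal_density 0 (sqrt (t - s)))"
    and ind: "indep_set (sets (F s)) {\<Delta> -` A \<inter> space M | A. A \<in> sets borel}"
    using brownian_W assms(1,2) by (auto simp: standard_brownian_motion_def \<Delta>_def)
  \<comment> \<open>The identity, as a random element of the coarser space \<open>F s\<close>,
    carries exactly the information available at time \<open>s\<close>.\<close>
  have id: "(\<lambda>\<omega>. \<omega>) \<in> measurable M (F s)"
    by (rule measurable_F_M[of _ s]) simp
  have \<Delta>m: "\<Delta> \<in> measurable M lborel" using distributed_measurable[OF dist] .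
  have pair: "(\<lambda>\<omega>. (\<omega>, \<Delta> \<omega>)) \<in> measurable M (F s \<Otimes>\<^sub>M lborel)"
    using id \<Delta>m by (rule measurable_Pair)
  have eq: "distr M (F s) (\<lambda>\<omega>. \<omega>) \<Otimes>\<^sub>M distr M lborel \<Delta> = distr M (F s \<Otimes>\<^sub>M lborel) (\<lambda>\<omega>. (\<omega>, \<Delta> \<omega>))"
  proof (rule pair_measure_eqI)
    show "sigma_finite_measure (distr M (F s) (\<lambda>\<omega>. \<omega>))" "sigma_finite_measure (distr M lborel \<Delta>)"
      using prob_space_distr[OF id] prob_space_distr[OF \<Delta>m] by (simp_all add: prob_space_imp_sigma_finite)
    fix A B assume A: "A \<in> sets (distr M (F s) (\<lambda>\<omega>. \<omega>))" and B: "B \<in> sets (distr M lborel \<Delta>)"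
    have AM: "A \<in> sets M" using A subalgebra_F[of s] by (auto simp: subalgebra_def)
    have "prob (A \<inter> (\<Delta> -` B \<inter> space M)) = prob A * prob (\<Delta> -` B \<inter> space M)"
      using A B by (intro indep_setD[OF ind]) auto
    moreover have "(\<lambda>\<omega>. (\<omega>, \<Delta> \<omega>)) -` (A \<times> B) \<inter> space M = A \<inter> (\<Delta> -` B \<inter> space M)"
      by auto
    moreover have "A \<inter> space M = A" using AM sets.sets_into_space by blast
    moreover have "A \<times> B \<in> sets (F s \<Otimes>\<^sub>M lborel)" using A B by (intro pair_measureI) auto
    ultimately show "emeasure (distr M (F s) (\<lambda>\<omega>. \<omega>)) A * emeasure (distr M lborel \<Delta>) B
        = emeasure (distr M (F s \<Otimes>\<^sub>M lborel) (\<lambda>\<omega>. (\<omega>, \<Delta> \<omega>))) (A \<times> B)"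
      using A B id \<Delta>m pair by (simp add: emeasure_distr emeasure_eq_measure ennreal_mult')
  qed simp
  interpret D: prob_space "distr M lborel \<Delta>" by (rule prob_space_distr[OF \<Delta>m])
  have "(\<integral>\<^sup>+\<omega>. f (\<omega>, \<Delta> \<omega>) \<partial>M) = (\<integral>\<^sup>+x. f x \<partial>distr M (F s \<Otimes>\<^sub>M lborel) (\<lambda>\<omega>. (\<omega>, \<Delta> \<omega>)))"
    by (rule nn_integral_distr[symmetric]) (use id \<Delta>m f in measurable)
  also have "\<dots> = (\<integral>\<^sup>+\<omega>. (\<integral>\<^sup>+x. f (\<omega>, x) \<partial>distr M lborel \<Delta>) \<partial>distr M (F s) (\<lambda>\<omega>. \<omega>))"
    unfolding eq[symmetric] using f by (intro D.nn_integral_fst[symmetric]) simp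
  also have "\<dots> = (\<integral>\<^sup>+\<omega>. (\<integral>\<^sup>+x. f (\<omega>, x) \<partial>distr M lborel \<Delta>) \<partial>M)"
    using f id by (intro nn_integral_distr D.borel_measurable_nn_integral_fst) simp_all
  also have "\<dots> = (\<integral>\<^sup>+\<omega>. (\<integral>\<^sup>+x. ennreal (normal_density 0 (sqrt (t - s)) x) * f (\<omega>, x) \<partial>lborel) \<partial>M)"
  proof (rule nn_integral_cong)
    fix \<omega> assume "\<omega> \<in> space M"
    then have "(\<lambda>x. f (\<omega>, x)) \<in> borel_measurable lborel"
      by (intro measurable_Pair2[OF f]) simp
    then show "(\<integral>\<^sup>+x. f (\<omega>, x) \<partial>distr M lborel \<Delta>) = (\<integral>\<^sup>+x. ennreal (normal_density 0 (sqrt (t - s)) x) * f (\<omega>, x) \<partial>lborel)"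
      unfolding distributed_distr_eq_density[OF dist] by (simp add: nn_integral_density)
  qed
  finally show ?thesis by (simp add: \<Delta>_def)
qed

text \<open>Completing the square: the exponential tilt by \<open>r\<close> shifts the mean of the
  Gaussian to \<open>r * v\<close> and leaves its mass 1.\<close>

lemma nn_integral_normal_density_exp:
  assumes "v > 0"
  shows "(\<integral>\<^sup>+x. ennreal (normal_density 0 (sqrt v) x) * ennreal (exp (r * x - r\<^sup>2 * v / 2)) \<partial>lborel) = 1"
proof -
  have "normal_density 0 (sqrt v) x * exp (r * x - r\<^sup>2 * v / 2) = normal_density (r * v) (sqrt v) x" for x
  proof -
    have "- (x - 0)\<^sup>2 / (2 * v) + (r * x - r\<^sup>2 * v / 2) = - (x - r * v)\<^sup>2 / (2 * v)"
      using assms by (simp add: field_simps power2_eq_square)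
    then have "exp (- (x - 0)\<^sup>2 / (2 * v)) * exp (r * x - r\<^sup>2 * v / 2) = exp (- (x - r * v)\<^sup>2 / (2 * v))"
      by (simp flip: exp_add)
    then show ?thesis using assms by (simp add: normal_density_def mult.assoc)
  qed
  then have "(\<integral>\<^sup>+x. ennreal (normal_density 0 (sqrt v) x) * ennreal (exp (r * x - r\<^sup>2 * v / 2)) \<partial>lborel)
      = (\<integral>\<^sup>+x. ennreal (normal_density (r * v) (sqrt v) x) \<partial>lborel)"
    by (simp flip: ennreal_mult)
  also have "\<dots> = 1"
    using prob_space.emeasure_space_1[OF prob_space_normal_density[of "sqrt v" "r * v"]] assms
    by (simp add: emeasure_density)
  finally show ?thesis .
qed

text \<open>Given \<open>F s\<close>, the exponential has conditional mean 1. Testing against an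
  arbitrary nonnegative weight \<open>K\<close> known at time \<open>s\<close> says this without
  conditional expectations; \<open>K\<close> later holds the factors accumulated so far.\<close>

lemma nn_integral_exp_increment:
  assumes "0 \<le> s" "s \<le> t" and K: "K \<in> borel_measurable (F s)" and r: "r \<in> borel_measurable (F s)"
  shows "(\<integral>\<^sup>+\<omega>. K \<omega> * ennreal (exp (r \<omega> * (W t \<omega> - W s \<omega>) - (r \<omega>)\<^sup>2 * (t - s) / 2)) \<partial>M) = (\<integral>\<^sup>+\<omega>. K \<omega> \<partial>M)"
proof (cases "s = t")
  case True
  then show ?thesis by simp
next
  case False
  then have "s < t" using assms by simp
  define f where "f = (\<lambda>(\<omega>, x). K \<omega> * ennreal (exp (r \<omega> * x - (r \<omega>)\<^sup>2 * (t - s) / 2)))"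
  have "f \<in> borel_measurable (F s \<Otimes>\<^sub>M lborel)"
    unfolding f_def using K r by measurable
  from nn_integral_increment[OF assms(1) \<open>s < t\<close> this]
  have "(\<integral>\<^sup>+\<omega>. K \<omega> * ennreal (exp (r \<omega> * (W t \<omega> - W s \<omega>) - (r \<omega>)\<^sup>2 * (t - s) / 2)) \<partial>M)
      = (\<integral>\<^sup>+\<omega>. (\<integral>\<^sup>+x. K \<omega> * (ennreal (normal_density 0 (sqrt (t - s)) x) * ennreal (exp (r \<omega> * x - (r \<omega>)\<^sup>2 * (t - s) / 2))) \<partial>lborel) \<partial>M)"
    by (simp add: f_def mult_ac)
  also have "\<dots> = (\<integral>\<^sup>+\<omega>. K \<omega> \<partial>M)"
    using \<open>s < t\<close> by (subst nn_integral_cmult) (simp_all add: nn_integral_normal_density_exp)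
  finally show ?thesis .
qed

text \<open>Peel off the last factor: \<open>G\<close> and all earlier factors are measurable at
  time \<open>p m\<close> and form the weight \<open>K\<close> of
  \<open>nn_integral_exp_increment\<close>.\<close>

lemma nn_integral_exp_martingale:
  fixes p :: "nat \<Rightarrow> real"
  assumes "0 \<le> p 0" "\<And>i. i < m \<Longrightarrow> p i \<le> p (Suc i)"
    and a: "\<And>i. i < m \<Longrightarrow> a i \<in> borel_measurable (F (p i))" and G: "G \<in> borel_measurable (F (p 0))"
  shows "(\<integral>\<^sup>+\<omega>. G \<omega> * ennreal (exp (\<Sum>i<m. a i \<omega> * (W (p (Suc i)) \<omega> - W (p i) \<omega>)
      - (a i \<omega>)\<^sup>2 * (p (Suc i) - p i) / 2)) \<partial>M) = (\<integral>\<^sup>+\<omega>. G \<omega> \<partial>M)"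
  using assms(2) a
proof (induction m)
  case (Suc m)
  define E where "E \<omega> = (\<Sum>i<m. a i \<omega> * (W (p (Suc i)) \<omega> - W (p i) \<omega>) - (a i \<omega>)\<^sup>2 * (p (Suc i) - p i) / 2)" for \<omega>
  have mono: "p i \<le> p j" if "i \<le> j" "j \<le> m" for i j
    using step_mono[of m p i j] Suc.prems(1) that by simp
  have p0: "0 \<le> p i" if "i \<le> m" for i using mono[of 0 i] that assms(1) by simp
  have meas [measurable]: "a i \<in> borel_measurable (F (p m))" "W (p i) \<in> borel_measurable (F (p m))"
      "W (p (Suc i)) \<in> borel_measurable (F (p m))" if "i < m" for i
    using that by (auto intro!: measurable_F_mono[OF Suc.prems(2)] measurable_F_mono[OF measurable_W_F] mono p0)
  have [measurable]: "G \<in> borel_measurable (F (p m))"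
    using measurable_F_mono[OF G] mono[of 0 m] by simp
  have "E \<in> borel_measurable (F (p m))"
    unfolding E_def by (intro borel_measurable_sum) auto
  then have K: "(\<lambda>\<omega>. G \<omega> * ennreal (exp (E \<omega>))) \<in> borel_measurable (F (p m))"
    by measurable
  have "(\<integral>\<^sup>+\<omega>. G \<omega> * ennreal (exp (\<Sum>i<Suc m. a i \<omega> * (W (p (Suc i)) \<omega> - W (p i) \<omega>)
      - (a i \<omega>)\<^sup>2 * (p (Suc i) - p i) / 2)) \<partial>M)
    = (\<integral>\<^sup>+\<omega>. (G \<omega> * ennreal (exp (E \<omega>))) * ennreal (exp (a m \<omega> * (W (p (Suc m)) \<omega> - W (p m) \<omega>)
      - (a m \<omega>)\<^sup>2 * (p (Suc m) - p m) / 2)) \<partial>M)"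
    unfolding sum.lessThan_Suc E_def[symmetric] by (simp only: exp_add ennreal_mult exp_ge_zero mult.assoc)
  also have "\<dots> = (\<integral>\<^sup>+\<omega>. G \<omega> * ennreal (exp (E \<omega>)) \<partial>M)"
    using Suc.prems p0[of m] by (intro nn_integral_exp_increment K) auto
  also have "\<dots> = (\<integral>\<^sup>+\<omega>. G \<omega> \<partial>M)"
    using Suc unfolding E_def by simp
  finally show ?case .
qed simp

end

lemma sum_increments_between:
  fixes g :: "nat \<Rightarrow> real"
  assumes "i \<le> j" "j \<le> m"
  shows "(\<Sum>k<m. if i \<le> k \<and> k < j then g (Suc k) - g k else 0) = g j - g i"
proof -
  have "(\<Sum>k<m. if i \<le> k \<and> k < j then g (Suc k) - g k else 0) = (\<Sum>k=i..<j. g (Suc k) - g k)"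
    using assms by (intro sum.mono_neutral_cong_right) auto
  also have "\<dots> = g j - g i" using assms(1) by (rule sum_Suc_diff')
  finally show ?thesis .
qed

text \<open>At most one of the half-open intervals contains \<open>s\<close>, so the cross terms
  vanish.\<close>

lemma step_function_square:
  fixes p x :: "nat \<Rightarrow> real"
  assumes "\<And>i. i < m \<Longrightarrow> p i \<le> p (Suc i)"
  shows "(\<Sum>i<m. x i * indicator {p i<..p (Suc i)} s)\<^sup>2 = (\<Sum>i<m. (x i)\<^sup>2 * indicator {p i<..p (Suc i)} s)"
  using assms
proof (induction m)
  case (Suc m)
  define S where "S = (\<Sum>i<m. x i * indicator {p i<..p (Suc i)} s)"
  define T :: real where "T = indicator {p m<..p (Suc m)} s"
  have "S * T = 0"
  proof (cases "s > p m")
    case True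
    then have "s \<notin> {p i<..p (Suc i)}" if "i < m" for i
      using step_mono[of m p "Suc i" m] Suc.prems that by force
    then have "S = 0" unfolding S_def by (intro sum.neutral) simp
    then show ?thesis by simp
  qed (simp add: T_def)
  moreover have "T * T = T" by (simp add: T_def indicator_def)
  moreover have "(S + x m * T)\<^sup>2 = S\<^sup>2 + 2 * x m * (S * T) + (x m)\<^sup>2 * (T * T)"
    by (simp add: power2_eq_square algebra_simps)
  moreover have "S\<^sup>2 = (\<Sum>i<m. (x i)\<^sup>2 * indicator {p i<..p (Suc i)} s)"
    using Suc by (simp add: S_def)
  ultimately show ?case unfolding sum.lessThan_Suc S_def[symmetric] T_def[symmetric]
    by (simp only: mult_zero_right add_0_right)
qed simp

lemma finite_set_enumeration:
  fixes P :: "real set"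
  assumes "finite P" "P \<noteq> {}"
  obtains m and p :: "nat \<Rightarrow> real" where "\<And>i. i < m \<Longrightarrow> p i \<le> p (Suc i)" "P = p ` {..m}"
proof -
  let ?l = "sorted_list_of_set P"
  have len: "length ?l = Suc (length ?l - 1)"
    using assms by (cases ?l) auto
  show ?thesis
  proof (rule that[of "length ?l - 1" "\<lambda>i. ?l ! i"])
    show "?l ! i \<le> ?l ! Suc i" if "i < length ?l - 1" for i
      using that by (intro sorted_nth_mono) auto
    have "P = set ?l" using assms by simp
    also have "\<dots> = (!) ?l ` {..<length ?l}" by (auto simp: in_set_conv_nth)
    also have "{..<length ?l} = {..length ?l - 1}" using len by auto
    finally show "P = (!) ?l ` {..length ?l - 1}" .
  qed
qed

section \<open>Exponential moments for sums over overlapping intervals\<close>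

context filtered_brownian_motion
begin

text \<open>The intervals of the pieces may overlap; the proof passes to the common refinement.\<close>

lemma nn_integral_exp_pieces:
  fixes l r :: "'j \<Rightarrow> real"
  assumes "finite J" "0 \<le> u" and lr: "\<And>j. j \<in> J \<Longrightarrow> u \<le> l j \<and> l j \<le> r j"
    and \<xi>: "\<And>j. j \<in> J \<Longrightarrow> \<xi> j \<in> borel_measurable (F (l j))" and G: "G \<in> borel_measurable (F u)"
  shows "(\<integral>\<^sup>+\<omega>. G \<omega> * ennreal (exp ((\<Sum>j\<in>J. \<xi> j \<omega> * (W (r j) \<omega> - W (l j) \<omega>))
      - (LINT s|lborel. (\<Sum>j\<in>J. \<xi> j \<omega> * indicator {l j<..r j} s)\<^sup>2) / 2)) \<partial>M) = (\<integral>\<^sup>+\<omega>. G \<omega> \<partial>M)"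
proof -
  obtain m p where pmono: "\<And>i. i < m \<Longrightarrow> p i \<le> p (Suc i)" and P: "insert u (l ` J \<union> r ` J) = p ` {..m}"
    using finite_set_enumeration[of "insert u (l ` J \<union> r ` J)"] \<open>finite J\<close> by blast
  have mono: "p i \<le> p j" if "i \<le> j" "j \<le> m" for i j
    using step_mono[of m p i j] pmono that by simp
  have "\<exists>\<alpha> \<beta>. l j = p \<alpha> \<and> r j = p \<beta> \<and> \<alpha> \<le> \<beta> \<and> \<beta> \<le> m" if j: "j \<in> J" for j
  proof -
    have "l j \<in> p ` {..m}" "r j \<in> p ` {..m}" using j by (simp_all flip: P)
    then obtain \<alpha> \<beta> where *: "l j = p \<alpha>" "\<alpha> \<le> m" "r j = p \<beta>" "\<beta> \<le> m" by auto
    show ?thesis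
    proof (cases "\<alpha> \<le> \<beta>")
      \<comment> \<open>Indices in the wrong order can only come from an empty piece, both ends of
        which may use the same index.\<close>
      case False
      then have "r j = l j" using mono[of \<beta> \<alpha>] * lr[OF j] by simp
      with * show ?thesis by auto
    qed (use * in auto)
  qed
  then obtain \<alpha> \<beta> where \<alpha>\<beta>: "\<And>j. j \<in> J \<Longrightarrow> l j = p (\<alpha> j) \<and> r j = p (\<beta> j) \<and> \<alpha> j \<le> \<beta> j \<and> \<beta> j \<le> m"
    by metis
  \<comment> \<open>On an interval of the refinement the coefficients of all pieces that cover it
    add up.\<close>
  define a where "a i \<omega> = (\<Sum>j\<in>J. if \<alpha> j \<le> i \<and> i < \<beta> j then \<xi> j \<omega> else 0)" for i \<omega>
  \<comment> \<open>Kept general in \<open>g\<close>: a Brownian path gives the stochastic sum, and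
    the function \<open>of_bool (s \<le> x)\<close> of \<open>x\<close> gives the step function
    itself.\<close>
  have refine: "(\<Sum>j\<in>J. \<xi> j \<omega> * (g (r j) - g (l j))) = (\<Sum>i<m. a i \<omega> * (g (p (Suc i)) - g (p i)))"
    for g :: "real \<Rightarrow> real" and \<omega>
  proof -
    have "(\<Sum>j\<in>J. \<xi> j \<omega> * (g (r j) - g (l j)))
        = (\<Sum>j\<in>J. \<xi> j \<omega> * (\<Sum>i<m. if \<alpha> j \<le> i \<and> i < \<beta> j then g (p (Suc i)) - g (p i) else 0))"
      using \<alpha>\<beta> sum_increments_between[of _ _ m "\<lambda>i. g (p i)"] by (intro sum.cong) simp_all
    also have "\<dots> = (\<Sum>j\<in>J. \<Sum>i<m. (if \<alpha> j \<le> i \<and> i < \<beta> j then \<xi> j \<omega> else 0) * (g (p (Suc i)) - g (p i)))"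
      by (auto simp: sum_distrib_left intro!: sum.cong)
    also have "\<dots> = (\<Sum>i<m. a i \<omega> * (g (p (Suc i)) - g (p i)))"
      by (subst sum.swap) (simp add: a_def sum_distrib_right)
    finally show ?thesis .
  qed
  have ind: "indicator {x<..y} s = of_bool (s \<le> y) - (of_bool (s \<le> x) :: real)" if "x \<le> y" for x y s :: real
    using that by (auto simp: indicator_def)
  have p0: "u \<le> p i" if "i \<le> m" for i
  proof -
    have "p i \<in> insert u (l ` J \<union> r ` J)" using P that by auto
    then show ?thesis using lr by force
  qed
  have "(\<Sum>j\<in>J. \<xi> j \<omega> * indicator {l j<..r j} s)\<^sup>2 = (\<Sum>i<m. (a i \<omega>)\<^sup>2 * indicator {p i<..p (Suc i)} s)" for s \<omega>
  proof -
    have "(\<Sum>j\<in>J. \<xi> j \<omega> * indicator {l j<..r j} s) = (\<Sum>j\<in>J. \<xi> j \<omega> * (of_bool (s \<le> r j) - of_bool (s \<le> l j)))"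
      using lr by (intro sum.cong) (auto simp: ind)
    also have "\<dots> = (\<Sum>i<m. a i \<omega> * (of_bool (s \<le> p (Suc i)) - of_bool (s \<le> p i)))"
      by (rule refine[of \<omega> "\<lambda>x. of_bool (s \<le> x)"])
    also have "\<dots> = (\<Sum>i<m. a i \<omega> * indicator {p i<..p (Suc i)} s)"
      using pmono by (intro sum.cong) (auto simp: ind)
    finally show ?thesis using step_function_square[of m p] pmono by simp
  qed
  moreover have "has_bochner_integral lborel (\<lambda>s. \<Sum>i<m. (a i \<omega>)\<^sup>2 * indicator {p i<..p (Suc i)} s)
      (\<Sum>i<m. (a i \<omega>)\<^sup>2 * (p (Suc i) - p i))" for \<omega>
    using pmono
    by (intro has_bochner_integral_sum has_bochner_integral_mult_right)
       (auto simp: has_bochner_integral_iff)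
  ultimately have Q: "(LINT s|lborel. (\<Sum>j\<in>J. \<xi> j \<omega> * indicator {l j<..r j} s)\<^sup>2) = (\<Sum>i<m. (a i \<omega>)\<^sup>2 * (p (Suc i) - p i))" for \<omega>
    by (simp add: has_bochner_integral_integral_eq)
  have "a i \<in> borel_measurable (F (p i))" if "i < m" for i
  proof -
    have "(\<lambda>\<omega>. if \<alpha> j \<le> i \<and> i < \<beta> j then \<xi> j \<omega> else 0) \<in> borel_measurable (F (p i))" if "j \<in> J" for j
      using \<alpha>\<beta>[OF that] measurable_F_mono[OF \<xi>[OF that], of "p i"] mono[of "\<alpha> j" i] \<open>i < m\<close>
      by (cases "\<alpha> j \<le> i \<and> i < \<beta> j") auto
    then show ?thesis unfolding a_def by (intro borel_measurable_sum)
  qed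
  moreover have "G \<in> borel_measurable (F (p 0))" using measurable_F_mono[OF G p0[of 0]] by simp
  moreover have "0 \<le> p 0" using p0[of 0] \<open>0 \<le> u\<close> by simp
  ultimately have "(\<integral>\<^sup>+\<omega>. G \<omega> * ennreal (exp (\<Sum>i<m. a i \<omega> * (W (p (Suc i)) \<omega> - W (p i) \<omega>)
      - (a i \<omega>)\<^sup>2 * (p (Suc i) - p i) / 2)) \<partial>M) = (\<integral>\<^sup>+\<omega>. G \<omega> \<partial>M)"
    by (intro nn_integral_exp_martingale pmono)
  then show ?thesis
    unfolding Q refine[of \<omega> "\<lambda>t. W t \<omega>" for \<omega>] by (simp add: sum_subtractf sum_divide_distrib)
qed


lemma simple_integrand_mono:
  assumes "simple_integrand M F n \<tau> \<xi>" "i \<le> j" "j \<le> n"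
  shows "\<tau> i \<le> \<tau> j"
  using step_mono[of n \<tau> i j] assms by (simp add: simple_integrand_def)

lemma simple_value_bounded:
  assumes "simple_integrand M F n \<tau> \<xi>"
  obtains B where "\<And>s \<omega>. \<omega> \<in> space M \<Longrightarrow> \<bar>simple_value n \<tau> \<xi> s \<omega>\<bar> \<le> B"
proof -
  have "\<exists>b. \<forall>\<omega>\<in>space M. \<bar>\<xi> i \<omega>\<bar> \<le> b" if "i < n" for i
    using assms that by (auto simp: simple_integrand_def bounded_iff)
  then obtain b where b: "\<And>i \<omega>. i < n \<Longrightarrow> \<omega> \<in> space M \<Longrightarrow> \<bar>\<xi> i \<omega>\<bar> \<le> b i" by metis
  show ?thesis
  proof (rule that)
    fix s \<omega> assume "\<omega> \<in> space M"
    show "\<bar>simple_value n \<tau> \<xi> s \<omega>\<bar> \<le> (\<Sum>i<n. \<bar>b i\<bar>)"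
      unfolding simple_value_def
    proof (rule order_trans[OF sum_abs], rule sum_mono)
      fix i assume "i \<in> {..<n}"
      then have "\<bar>\<xi> i \<omega>\<bar> \<le> b i" using b \<open>\<omega> \<in> space M\<close> by simp
      moreover from this have "0 \<le> b i" by linarith
      ultimately show "\<bar>\<xi> i \<omega> * indicator {\<tau> i<..\<tau> (Suc i)} s\<bar> \<le> \<bar>b i\<bar>"
        by (simp add: indicator_def)
    qed
  qed
qed

text \<open>Projects a partition to [u, v]. Pieces outside become empty and the others are cut, so
  an increment of a simple integral over [u, v] is again a sum over pieces.\<close>

definition clip :: "real \<Rightarrow> real \<Rightarrow> (nat \<Rightarrow> real) \<Rightarrow> nat \<Rightarrow> real"
  where "clip u v \<tau> i = max u (min (\<tau> i) v)"

text \<open>The coefficients of intervals that start after time \<open>v\<close> need not be measurable at time \<open>v\<close>.\<close>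

definition clip_coeff :: "real \<Rightarrow> (nat \<Rightarrow> real) \<Rightarrow> (nat \<Rightarrow> 'w \<Rightarrow> real) \<Rightarrow> nat \<Rightarrow> 'w \<Rightarrow> real"
  where "clip_coeff v \<tau> \<xi> i \<omega> = (if \<tau> i \<le> v then \<xi> i \<omega> else 0)"

lemma clip_mono:
  assumes "simple_integrand M F n \<tau> \<xi>" "i < n"
  shows "clip u v \<tau> i \<le> clip u v \<tau> (Suc i)"
  using simple_integrand_mono[OF assms(1), of i "Suc i"] assms(2) by (auto simp: clip_def)

lemma clip_coeff_measurable:
  assumes "simple_integrand M F n \<tau> \<xi>" "i < n"
  shows "clip_coeff v \<tau> \<xi> i \<in> borel_measurable (F (clip u v \<tau> i))"
proof (cases "\<tau> i \<le> v")
  case True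
  have "\<xi> i \<in> borel_measurable (F (\<tau> i))" using assms by (simp add: simple_integrand_def)
  then have "\<xi> i \<in> borel_measurable (F (clip u v \<tau> i))"
    by (rule measurable_F_mono) (use True in \<open>simp add: clip_def\<close>)
  with True show ?thesis by (simp add: clip_coeff_def[abs_def])
qed (simp add: clip_coeff_def[abs_def])

lemma simple_integral_clip:
  assumes "simple_integrand M F n \<tau> \<xi>" "u \<le> v"
  shows "simple_integral W n \<tau> \<xi> v \<omega> - simple_integral W n \<tau> \<xi> u \<omega>
    = (\<Sum>i<n. clip_coeff v \<tau> \<xi> i \<omega> * (W (clip u v \<tau> (Suc i)) \<omega> - W (clip u v \<tau> i) \<omega>))"
proof -
  \<comment> \<open>The term \<open>W u\<close> is the same for both ends of a piece and cancels in
    the difference.\<close>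
  have clip: "W (min t v) \<omega> - W (min t u) \<omega> = W (max u (min t v)) \<omega> - W u \<omega>" for t
    using assms(2) by (auto simp: min_def max_def)
  show ?thesis
    unfolding simple_integral_def sum_subtractf[symmetric] right_diff_distrib[symmetric]
  proof (rule sum.cong)
    fix i assume "i \<in> {..<n}"
    then have "\<tau> i \<le> \<tau> (Suc i)" using simple_integrand_mono[OF assms(1), of i "Suc i"] by simp
    then show "\<xi> i \<omega> * ((W (min (\<tau> (Suc i)) v) \<omega> - W (min (\<tau> i) v) \<omega>) - (W (min (\<tau> (Suc i)) u) \<omega> - W (min (\<tau> i) u) \<omega>))
        = clip_coeff v \<tau> \<xi> i \<omega> * (W (clip u v \<tau> (Suc i)) \<omega> - W (clip u v \<tau> i) \<omega>)"
      using clip[of "\<tau> i"] clip[of "\<tau> (Suc i)"] assms(2)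
      by (auto simp: clip_def clip_coeff_def min_def)
  qed simp
qed

lemma simple_value_clip:
  assumes "simple_integrand M F n \<tau> \<xi>" "u \<le> v"
  shows "(\<Sum>i<n. clip_coeff v \<tau> \<xi> i \<omega> * indicator {clip u v \<tau> i<..clip u v \<tau> (Suc i)} s)
    = simple_value n \<tau> \<xi> s \<omega> * indicator {u<..v} s"
  unfolding simple_value_def sum_distrib_right
  using assms(2) by (intro sum.cong) (auto simp: indicator_def clip_def clip_coeff_def)

lemma simple_integral_0:
  assumes "simple_integrand M F n \<tau> \<xi>"
  shows "simple_integral W n \<tau> \<xi> 0 \<omega> = 0"
proof -
  have "0 \<le> \<tau> i" if "i \<le> n" for i
    using simple_integrand_mono[OF assms, of 0 i] that assms by (simp add: simple_integrand_def)
  then show ?thesis by (simp add: simple_integral_def)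
qed

text \<open>The quadratic variation is random and therefore stays inside the exponential; it is
  replaced by a deterministic bound only after comparison with the limiting integrand.\<close>

lemma nn_integral_exp_simple:
  assumes S: "simple_integrand M F n \<tau> \<xi>" and "0 \<le> u" "u \<le> v" and G: "G \<in> borel_measurable (F u)"
  shows "(\<integral>\<^sup>+\<omega>. G \<omega> * ennreal (exp (\<theta> * (simple_integral W n \<tau> \<xi> v \<omega> - simple_integral W n \<tau> \<xi> u \<omega>)
      - \<theta>\<^sup>2 * (LINT s|lborel. (simple_value n \<tau> \<xi> s \<omega> * indicator {u<..v} s)\<^sup>2) / 2)) \<partial>M) = (\<integral>\<^sup>+\<omega>. G \<omega> \<partial>M)"
proof -
  have "(\<integral>\<^sup>+\<omega>. G \<omega> * ennreal (exp ((\<Sum>i<n. (\<theta> * clip_coeff v \<tau> \<xi> i \<omega>) * (W (clip u v \<tau> (Suc i)) \<omega> - W (clip u v \<tau> i) \<omega>))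
      - (LINT s|lborel. (\<Sum>i<n. (\<theta> * clip_coeff v \<tau> \<xi> i \<omega>) * indicator {clip u v \<tau> i<..clip u v \<tau> (Suc i)} s)\<^sup>2) / 2)) \<partial>M)
    = (\<integral>\<^sup>+\<omega>. G \<omega> \<partial>M)"
  proof (rule nn_integral_exp_pieces[OF _ \<open>0 \<le> u\<close> _ _ G])
    show "u \<le> clip u v \<tau> i \<and> clip u v \<tau> i \<le> clip u v \<tau> (Suc i)" if "i \<in> {..<n}" for i
      using clip_mono[OF S, of i u v] that by (simp add: clip_def)
    show "(\<lambda>\<omega>. \<theta> * clip_coeff v \<tau> \<xi> i \<omega>) \<in> borel_measurable (F (clip u v \<tau> i))" if "i \<in> {..<n}" for i
      using clip_coeff_measurable[OF S, of i v u] that by auto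
  qed simp
  then show ?thesis
    unfolding mult.assoc sum_distrib_left[symmetric] simple_value_clip[OF S \<open>u \<le> v\<close>]
      simple_integral_clip[OF S \<open>u \<le> v\<close>, symmetric] power_mult_distrib[of \<theta>] by simp
qed

text \<open>The two partitions are unrelated, so the pieces are indexed by the disjoint sum and may
  overlap; the second family enters with a minus sign. The identity controls how far apart two
  approximations of the same integral can be.\<close>

lemma nn_integral_exp_simple_diff:
  assumes S: "simple_integrand M F n \<tau> \<xi>" and S': "simple_integrand M F n' \<tau>' \<xi>'" and "0 \<le> v"
  shows "(\<integral>\<^sup>+\<omega>. ennreal (exp (\<theta> * (simple_integral W n \<tau> \<xi> v \<omega> - simple_integral W n' \<tau>' \<xi>' v \<omega>)
      - \<theta>\<^sup>2 * (LINT s|lborel. ((simple_value n \<tau> \<xi> s \<omega> - simple_value n' \<tau>' \<xi>' s \<omega>) * indicator {0<..v} s)\<^sup>2) / 2)) \<partial>M) = 1"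
proof -
  define l where "l = case_sum (clip 0 v \<tau>) (clip 0 v \<tau>')"
  define r where "r = case_sum (\<lambda>i. clip 0 v \<tau> (Suc i)) (\<lambda>i. clip 0 v \<tau>' (Suc i))"
  define x where "x = case_sum (\<lambda>i \<omega>. \<theta> * clip_coeff v \<tau> \<xi> i \<omega>) (\<lambda>i \<omega>. - \<theta> * clip_coeff v \<tau>' \<xi>' i \<omega>)"
  have "(\<integral>\<^sup>+\<omega>. 1 * ennreal (exp ((\<Sum>j\<in>{..<n} <+> {..<n'}. x j \<omega> * (W (r j) \<omega> - W (l j) \<omega>))
      - (LINT s|lborel. (\<Sum>j\<in>{..<n} <+> {..<n'}. x j \<omega> * indicator {l j<..r j} s)\<^sup>2) / 2)) \<partial>M)
    = (\<integral>\<^sup>+\<omega>. 1 \<partial>M)"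
  proof (rule nn_integral_exp_pieces[where u = 0])
    show "0 \<le> l j \<and> l j \<le> r j" if "j \<in> {..<n} <+> {..<n'}" for j
      using clip_mono[OF S, of _ 0 v] clip_mono[OF S', of _ 0 v] that by (auto simp: l_def r_def clip_def)
    show "x j \<in> borel_measurable (F (l j))" if "j \<in> {..<n} <+> {..<n'}" for j
      using clip_coeff_measurable[OF S, of _ v 0] clip_coeff_measurable[OF S', of _ v 0] that
      by (auto simp: l_def x_def)
  qed simp_all
  moreover have "(\<Sum>j\<in>{..<n} <+> {..<n'}. x j \<omega> * (W (r j) \<omega> - W (l j) \<omega>))
      = \<theta> * (simple_integral W n \<tau> \<xi> v \<omega> - simple_integral W n' \<tau>' \<xi>' v \<omega>)" for \<omega>
  proof -
    have "(\<Sum>j\<in>{..<n} <+> {..<n'}. x j \<omega> * (W (r j) \<omega> - W (l j) \<omega>))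
        = (\<Sum>i<n. \<theta> * (clip_coeff v \<tau> \<xi> i \<omega> * (W (clip 0 v \<tau> (Suc i)) \<omega> - W (clip 0 v \<tau> i) \<omega>)))
        + (\<Sum>i<n'. - \<theta> * (clip_coeff v \<tau>' \<xi>' i \<omega> * (W (clip 0 v \<tau>' (Suc i)) \<omega> - W (clip 0 v \<tau>' i) \<omega>)))"
      by (subst sum.Plus) (simp_all add: x_def l_def r_def mult.assoc)
    then show ?thesis
      unfolding sum_distrib_left[symmetric] simple_integral_clip[OF S \<open>0 \<le> v\<close>, symmetric]
        simple_integral_clip[OF S' \<open>0 \<le> v\<close>, symmetric]
      by (simp add: simple_integral_0[OF S] simple_integral_0[OF S'] right_diff_distrib)
  qed
  moreover have "(\<Sum>j\<in>{..<n} <+> {..<n'}. x j \<omega> * indicator {l j<..r j} s)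
      = \<theta> * ((simple_value n \<tau> \<xi> s \<omega> - simple_value n' \<tau>' \<xi>' s \<omega>) * indicator {0<..v} s)" for \<omega> s
  proof -
    have "(\<Sum>j\<in>{..<n} <+> {..<n'}. x j \<omega> * indicator {l j<..r j} s)
        = (\<Sum>i<n. \<theta> * (clip_coeff v \<tau> \<xi> i \<omega> * indicator {clip 0 v \<tau> i<..clip 0 v \<tau> (Suc i)} s))
        + (\<Sum>i<n'. - \<theta> * (clip_coeff v \<tau>' \<xi>' i \<omega> * indicator {clip 0 v \<tau>' i<..clip 0 v \<tau>' (Suc i)} s))"
      by (subst sum.Plus) (simp_all only: finite_lessThan x_def l_def r_def mult.assoc sum.case comp_def)
    then show ?thesis
      unfolding sum_distrib_left[symmetric] simple_value_clip[OF S \<open>0 \<le> v\<close>] simple_value_clip[OF S' \<open>0 \<le> v\<close>]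
      by (simp add: left_diff_distrib right_diff_distrib)
  qed
  ultimately show ?thesis
    by (simp add: power_mult_distrib[of \<theta>] emeasure_space_1)
qed

end

section \<open>Comparison of simple integrals by convexity\<close>

text \<open>An additive substitute for Hoelder's inequality: the two exponential moments on the
  right can be evaluated separately.\<close>

lemma exp_convex_split:
  fixes x y :: real
  assumes "0 < k" "k < 1"
  shows "exp ((1 - k) * x + k * y) \<le> (1 - k) * exp x + k * exp y"
  using convex_onD[OF exp_convex, of k x y] assms by simp

text \<open>Young's inequality for \<open>y = x - (x - y)\<close>; for small \<open>k\<close> the
  coefficient of \<open>x\<^sup>2\<close> stays near 1.\<close>

lemma square_sum_le:
  fixes x y k :: real
  assumes "k > 0"
  shows "y\<^sup>2 \<le> (1 + k) * x\<^sup>2 + (1 + 1 / k) * (x - y)\<^sup>2"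
proof -
  have "0 \<le> (k * x + (x - y))\<^sup>2 / k" using assms by simp
  also have "\<dots> = (1 + k) * x\<^sup>2 + (1 + 1 / k) * (x - y)\<^sup>2 - y\<^sup>2"
    using assms by (simp add: field_simps power2_eq_square)
  finally show ?thesis by simp
qed

lemma nn_integral_tendsto_0_AE_subseq:
  fixes f :: "nat \<Rightarrow> 'a \<Rightarrow> real"
  assumes meas: "\<And>k. f k \<in> borel_measurable M" and nonneg: "\<And>k x. 0 \<le> f k x"
    and lim: "(\<lambda>k. \<integral>\<^sup>+x. ennreal (f k x) \<partial>M) \<longlonglongrightarrow> 0"
  obtains N :: "nat \<Rightarrow> nat" where "AE x in M. (\<lambda>k. f (N k) x) \<longlonglongrightarrow> 0"
proof -
  have "\<forall>\<^sub>F k in sequentially. (\<integral>\<^sup>+x. ennreal (f k x) \<partial>M) < top"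
    using lim by (rule order_tendstoD) simp
  \<comment> \<open>Finitely many of the integrals may be infinite; integrability is available only
    from some index on.\<close>
  then obtain k0 where k0: "\<And>k. k \<ge> k0 \<Longrightarrow> (\<integral>\<^sup>+x. ennreal (f k x) \<partial>M) < top"
    by (auto simp: eventually_sequentially)
  have int: "integrable M (f (k + k0))" for k
    using meas nonneg k0[of "k + k0"] by (intro integrableI_nonneg) auto
  have "(\<lambda>k. \<integral>x. norm (f (k + k0) x) \<partial>M) \<longlonglongrightarrow> 0"
  proof -
    have "(\<lambda>k. \<integral>\<^sup>+x. ennreal (f (k + k0) x) \<partial>M) \<longlonglongrightarrow> 0" using lim by (rule LIMSEQ_ignore_initial_segment)
    then have "(\<lambda>k. enn2real (\<integral>\<^sup>+x. ennreal (f (k + k0) x) \<partial>M)) \<longlonglongrightarrow> enn2real 0"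
      by (intro tendsto_enn2real) simp_all
    then show ?thesis using meas nonneg by (simp add: integral_eq_nn_integral)
  qed
  from tendsto_L1_AE_subseq[OF int this] obtain r where "AE x in M. (\<lambda>k. f (r k + k0) x) \<longlonglongrightarrow> 0" by auto
  then show ?thesis by (rule that)
qed

lemma integrable_square_indicator:
  fixes f :: "real \<Rightarrow> real"
  assumes "f \<in> borel_measurable borel" "\<And>s. \<bar>f s\<bar> \<le> B" "A \<in> sets borel" "A \<subseteq> {a..b}"
  shows "integrable lborel (\<lambda>s. (f s * indicator A s)\<^sup>2)"
proof (rule Bochner_Integration.integrable_bound)
  show "integrable lborel (\<lambda>s. B\<^sup>2 * indicator {a..b} s)"
    by (intro integrable_mult_right integrable_real_indicator) (auto simp: emeasure_lborel_Icc_eq)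
  show "(\<lambda>s. (f s * indicator A s)\<^sup>2) \<in> borel_measurable lborel"
    using assms(1,3) by measurable
  show "AE s in lborel. norm ((f s * indicator A s)\<^sup>2) \<le> norm (B\<^sup>2 * indicator {a..b} s)"
    using order_trans[OF assms(2) abs_ge_self] assms(4)
    by (intro AE_I2) (auto simp: indicator_def abs_le_square_iff[symmetric])
qed

lemma measurable_integral_square_indicator:
  fixes f :: "real \<Rightarrow> 'a \<Rightarrow> real"
  assumes "(\<lambda>(s, \<omega>). f s \<omega>) \<in> borel_measurable (borel \<Otimes>\<^sub>M M)" "A \<in> sets borel"
  shows "(\<lambda>\<omega>. LINT s|lborel. (f s \<omega> * indicator A s)\<^sup>2) \<in> borel_measurable M"
proof (rule lborel.borel_measurable_lebesgue_integral)
  have "(\<lambda>(s, \<omega>). (f s \<omega> * indicator A s)\<^sup>2) \<in> borel_measurable (borel \<Otimes>\<^sub>M M)"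
    using assms by (simp add: split_beta') measurable
  from measurable_pair_swap[OF this]
  show "(\<lambda>(\<omega>, s). (f s \<omega> * indicator A s)\<^sup>2) \<in> borel_measurable (M \<Otimes>\<^sub>M lborel)"
    by (simp cong: measurable_cong_sets add: measurable_cong_sets[OF sets_pair_measure_cong[OF refl sets_lborel] refl])
qed

text \<open>Dividing the parameter by the convex weight \<open>c\<close> in advance restores the
  linear term after multiplication by \<open>c\<close>; the quadratic term is merely inflated by the
  factor \<open>1 / c\<close>.\<close>

lemma scaled_exponent:
  fixes c :: real
  assumes "c \<noteq> 0"
  shows "c * (\<theta> / c * J - (\<theta> / c)\<^sup>2 * Q / 2) = \<theta> * J - \<theta>\<^sup>2 / (2 * c) * Q"
  using assms by (simp add: power2_eq_square field_simps)

context filtered_brownian_motion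
begin

lemma simple_value_measurable:
  assumes "simple_integrand M F n \<tau> \<xi>"
  shows "(\<lambda>(s, \<omega>). simple_value n \<tau> \<xi> s \<omega>) \<in> borel_measurable (borel \<Otimes>\<^sub>M M)"
proof -
  have "\<xi> i \<in> borel_measurable M" if "i < n" for i
    using assms that measurable_F_M[of "\<xi> i" "\<tau> i"] by (simp add: simple_integrand_def)
  then show ?thesis
    unfolding simple_value_def split_beta' by (intro borel_measurable_sum) (measurable, auto)
qed

lemma simple_integral_measurable:
  assumes "simple_integrand M F n \<tau> \<xi>" "0 \<le> t"
  shows "simple_integral W n \<tau> \<xi> t \<in> borel_measurable M"
proof -
  have "\<xi> i \<in> borel_measurable M" if "i < n" for i
    using assms that measurable_F_M[of "\<xi> i" "\<tau> i"] by (simp add: simple_integrand_def)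
  moreover have "W (min (\<tau> i) t) \<in> borel_measurable M" if "i \<le> n" for i
    using simple_integrand_mono[OF assms(1), of 0 i] that assms
    by (intro measurable_W) (simp add: simple_integrand_def)
  ultimately show ?thesis
    unfolding simple_integral_def[abs_def]
    by (intro borel_measurable_sum borel_measurable_times borel_measurable_diff) auto
qed

text \<open>Split the difference into the increment of the first simple integral over [u, v] and the
  discrepancy of the two integrals at time \<open>u\<close>, with convex weights
  \<open>1 - k\<close> and \<open>k\<close>. An exact identity applies to each part, with weight
  \<open>G\<close> for the first and only its bound \<open>g\<close> for the second. The terms with
  \<open>q\<close> and \<open>q'\<close> pay for the replacement of the random quadratic variations;
  they are squared distances to \<open>H\<close> and vanish in the limit.\<close>

lemma exp_simple_split:
  assumes S: "simple_integrand M F n \<tau> \<xi>" and S': "simple_integrand M F n' \<tau>' \<xi>'"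
    and uv: "0 \<le> u" "u \<le> v" and k: "0 < k" "k < 1"
    and H: "(\<lambda>(s, \<omega>). H s \<omega>) \<in> borel_measurable (borel \<Otimes>\<^sub>M M)" "\<And>s \<omega>. \<omega> \<in> space M \<Longrightarrow> \<bar>H s \<omega>\<bar> \<le> L"
    and G: "G \<in> borel_measurable (F u)" "\<And>\<omega>. \<omega> \<in> space M \<Longrightarrow> 0 \<le> G \<omega>" "\<And>\<omega>. \<omega> \<in> space M \<Longrightarrow> G \<omega> \<le> g"
  defines "q \<equiv> \<lambda>\<omega>. LINT s|lborel. ((H s \<omega> - simple_value n \<tau> \<xi> s \<omega>) * indicator {0..v} s)\<^sup>2"
    and "q' \<equiv> \<lambda>\<omega>. LINT s|lborel. ((H s \<omega> - simple_value n' \<tau>' \<xi>' s \<omega>) * indicator {0..u} s)\<^sup>2"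
  shows "(\<integral>\<^sup>+\<omega>. ennreal (G \<omega> * exp (\<theta> * (simple_integral W n \<tau> \<xi> v \<omega> - simple_integral W n' \<tau>' \<xi>' u \<omega>)
        - \<theta>\<^sup>2 / (2 * (1 - k)) * ((1 + k) * (L\<^sup>2 * (v - u)) + (1 + 1 / k) * q \<omega>)
        - \<theta>\<^sup>2 / (2 * k) * (2 * q \<omega> + 2 * q' \<omega>))) \<partial>M)
    \<le> ennreal ((1 - k) * (\<integral>\<omega>. G \<omega> \<partial>M) + k * g)"
proof -
  let ?S = "simple_value n \<tau> \<xi>" and ?S' = "simple_value n' \<tau>' \<xi>'"
  let ?I = "simple_integral W n \<tau> \<xi>" and ?I' = "simple_integral W n' \<tau>' \<xi>'"
  define Q where "Q \<omega> = (LINT s|lborel. (?S s \<omega> * indicator {u<..v} s)\<^sup>2)" for \<omega>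
  define R where "R \<omega> = (LINT s|lborel. ((?S s \<omega> - ?S' s \<omega>) * indicator {0<..u} s)\<^sup>2)" for \<omega>
  define x where "x \<omega> = \<theta> / (1 - k) * (?I v \<omega> - ?I u \<omega>) - (\<theta> / (1 - k))\<^sup>2 * Q \<omega> / 2" for \<omega>
  define y where "y \<omega> = \<theta> / k * (?I u \<omega> - ?I' u \<omega>) - (\<theta> / k)\<^sup>2 * R \<omega> / 2" for \<omega>
  have GM: "G \<in> borel_measurable M" using G(1) by (rule measurable_F_M)
  obtain B where B: "\<And>s \<omega>. \<omega> \<in> space M \<Longrightarrow> \<bar>?S s \<omega>\<bar> \<le> B" using simple_value_bounded[OF S] by metis
  obtain B' where B': "\<And>s \<omega>. \<omega> \<in> space M \<Longrightarrow> \<bar>?S' s \<omega>\<bar> \<le> B'" using simple_value_bounded[OF S'] by metis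
  note Sm = simple_value_measurable[OF S] and S'm = simple_value_measurable[OF S']
  have bound: "G \<omega> * exp (\<theta> * (?I v \<omega> - ?I' u \<omega>)
        - \<theta>\<^sup>2 / (2 * (1 - k)) * ((1 + k) * (L\<^sup>2 * (v - u)) + (1 + 1 / k) * q \<omega>)
        - \<theta>\<^sup>2 / (2 * k) * (2 * q \<omega> + 2 * q' \<omega>))
      \<le> (1 - k) * (G \<omega> * exp (x \<omega>)) + k * (g * exp (y \<omega>))" if \<omega>: "\<omega> \<in> space M" for \<omega>
  proof -
    have sec: "(\<lambda>s. H s \<omega>) \<in> borel_measurable borel" "(\<lambda>s. ?S s \<omega>) \<in> borel_measurable borel"
        "(\<lambda>s. ?S' s \<omega>) \<in> borel_measurable borel"
      using measurable_Pair1[OF H(1) \<omega>] measurable_Pair1[OF Sm \<omega>] measurable_Pair1[OF S'm \<omega>] by simp_all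
    have bounds: "\<bar>H s \<omega> - ?S s \<omega>\<bar> \<le> L + B" "\<bar>H s \<omega> - ?S' s \<omega>\<bar> \<le> L + B'"
        "\<bar>?S s \<omega> - ?S' s \<omega>\<bar> \<le> B + B'" for s
      using H(2)[OF \<omega>, of s] B[OF \<omega>, of s] B'[OF \<omega>, of s] by linarith+
    have int: "integrable lborel (\<lambda>s. ((H s \<omega> - ?S s \<omega>) * indicator {0..v} s)\<^sup>2)"
        "integrable lborel (\<lambda>s. ((H s \<omega> - ?S' s \<omega>) * indicator {0..u} s)\<^sup>2)"
        "integrable lborel (\<lambda>s. (?S s \<omega> * indicator {u<..v} s)\<^sup>2)"
        "integrable lborel (\<lambda>s. ((?S s \<omega> - ?S' s \<omega>) * indicator {0<..u} s)\<^sup>2)"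
      by (rule integrable_square_indicator[OF borel_measurable_diff[OF sec(1,2)] bounds(1), of _ 0 v], simp, simp,
          rule integrable_square_indicator[OF borel_measurable_diff[OF sec(1,3)] bounds(2), of _ 0 u], simp, simp,
          rule integrable_square_indicator[OF sec(2) B[OF \<omega>], of _ u v], simp, force,
          rule integrable_square_indicator[OF borel_measurable_diff[OF sec(2,3)] bounds(3), of _ 0 u], simp, force)
    \<comment> \<open>Young's inequality with the same \<open>k\<close>: the simple integrand is
      close to \<open>H\<close>, which is bounded by \<open>L\<close>.\<close>
    have Q: "Q \<omega> \<le> (1 + k) * (L\<^sup>2 * (v - u)) + (1 + 1 / k) * q \<omega>"
    proof -
      have "Q \<omega> \<le> (LINT s|lborel. (1 + k) * (L\<^sup>2 * indicator {u<..v} s)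
          + (1 + 1 / k) * ((H s \<omega> - ?S s \<omega>) * indicator {0..v} s)\<^sup>2)"
        unfolding Q_def
      proof (rule integral_mono[OF int(3)])
        show "integrable lborel (\<lambda>s. (1 + k) * (L\<^sup>2 * indicator {u<..v} s)
            + (1 + 1 / k) * ((H s \<omega> - ?S s \<omega>) * indicator {0..v} s)\<^sup>2)"
          using uv by (intro Bochner_Integration.integrable_add integrable_mult_right int integrable_real_indicator) auto
        fix s
        have "(?S s \<omega>)\<^sup>2 \<le> (1 + k) * (H s \<omega>)\<^sup>2 + (1 + 1 / k) * (H s \<omega> - ?S s \<omega>)\<^sup>2"
          using k by (intro square_sum_le)
        moreover have "(1 + k) * (H s \<omega>)\<^sup>2 \<le> (1 + k) * L\<^sup>2"
          using k H(2)[OF \<omega>, of s] by (intro mult_left_mono) (auto simp: abs_le_square_iff[symmetric])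
        ultimately have "(?S s \<omega>)\<^sup>2 \<le> (1 + k) * L\<^sup>2 + (1 + 1 / k) * (H s \<omega> - ?S s \<omega>)\<^sup>2" by linarith
        moreover have "0 \<le> (1 + 1 / k) * (H s \<omega> - ?S s \<omega>)\<^sup>2" using k by simp
        ultimately show "(?S s \<omega> * indicator {u<..v} s)\<^sup>2 \<le> (1 + k) * (L\<^sup>2 * indicator {u<..v} s)
            + (1 + 1 / k) * ((H s \<omega> - ?S s \<omega>) * indicator {0..v} s)\<^sup>2"
          using uv by (auto simp: indicator_def)
      qed
      also have "\<dots> = (1 + k) * (L\<^sup>2 * (v - u)) + (1 + 1 / k) * q \<omega>"
        unfolding q_def using int(1) uv
        by (subst Bochner_Integration.integral_add) (auto intro!: integrable_mult_right)
      finally show ?thesis .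
    qed
    have R: "R \<omega> \<le> 2 * q \<omega> + 2 * q' \<omega>"
    proof -
      have "R \<omega> \<le> (LINT s|lborel. 2 * ((H s \<omega> - ?S s \<omega>) * indicator {0..v} s)\<^sup>2
          + 2 * ((H s \<omega> - ?S' s \<omega>) * indicator {0..u} s)\<^sup>2)"
        unfolding R_def
      proof (rule integral_mono[OF int(4)])
        show "integrable lborel (\<lambda>s. 2 * ((H s \<omega> - ?S s \<omega>) * indicator {0..v} s)\<^sup>2
            + 2 * ((H s \<omega> - ?S' s \<omega>) * indicator {0..u} s)\<^sup>2)"
          by (intro Bochner_Integration.integrable_add integrable_mult_right int)
        fix s
        have "(?S s \<omega> - ?S' s \<omega>)\<^sup>2 \<le> 2 * (H s \<omega> - ?S s \<omega>)\<^sup>2 + 2 * (H s \<omega> - ?S' s \<omega>)\<^sup>2"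
          using square_sum_le[of 1 "?S s \<omega> - ?S' s \<omega>" "H s \<omega> - ?S' s \<omega>"]
            square_sum_le[of 1 "- (H s \<omega> - ?S s \<omega>)" "?S s \<omega> - ?S' s \<omega>"]
          by (simp add: power2_commute algebra_simps)
        then show "((?S s \<omega> - ?S' s \<omega>) * indicator {0<..u} s)\<^sup>2
            \<le> 2 * ((H s \<omega> - ?S s \<omega>) * indicator {0..v} s)\<^sup>2 + 2 * ((H s \<omega> - ?S' s \<omega>) * indicator {0..u} s)\<^sup>2"
          using uv by (auto simp: indicator_def)
      qed
      also have "\<dots> = 2 * q \<omega> + 2 * q' \<omega>"
        unfolding q_def q'_def using int(1,2) by simp
      finally show ?thesis .
    qed
    let ?e = "\<theta> * (?I v \<omega> - ?I' u \<omega>)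
        - \<theta>\<^sup>2 / (2 * (1 - k)) * ((1 + k) * (L\<^sup>2 * (v - u)) + (1 + 1 / k) * q \<omega>)
        - \<theta>\<^sup>2 / (2 * k) * (2 * q \<omega> + 2 * q' \<omega>)"
    have "?e \<le> \<theta> * (?I v \<omega> - ?I' u \<omega>) - \<theta>\<^sup>2 / (2 * (1 - k)) * Q \<omega> - \<theta>\<^sup>2 / (2 * k) * R \<omega>"
      using k by (intro diff_mono mult_left_mono Q R order_refl) auto
    also have "\<dots> = (1 - k) * x \<omega> + k * y \<omega>"
    proof -
      have "(1 - k) * x \<omega> = \<theta> * (?I v \<omega> - ?I u \<omega>) - \<theta>\<^sup>2 / (2 * (1 - k)) * Q \<omega>"
        using k unfolding x_def by (intro scaled_exponent) simp
      moreover have "k * y \<omega> = \<theta> * (?I u \<omega> - ?I' u \<omega>) - \<theta>\<^sup>2 / (2 * k) * R \<omega>"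
        using k unfolding y_def by (intro scaled_exponent) simp
      ultimately show ?thesis by (simp add: algebra_simps)
    qed
    finally have "exp ?e \<le> (1 - k) * exp (x \<omega>) + k * exp (y \<omega>)"
      using exp_convex_split[OF k] by (meson exp_le_cancel_iff order_trans)
    then have "G \<omega> * exp ?e \<le> G \<omega> * ((1 - k) * exp (x \<omega>) + k * exp (y \<omega>))"
      using G(2)[OF \<omega>] by (rule mult_left_mono)
    also have "\<dots> \<le> (1 - k) * (G \<omega> * exp (x \<omega>)) + k * (g * exp (y \<omega>))"
      using G(3)[OF \<omega>] k by (simp add: algebra_simps mult_right_mono)
    finally show ?thesis .
  qed
  have Qm: "Q \<in> borel_measurable M"
    unfolding Q_def[abs_def] using Sm by (intro measurable_integral_square_indicator) auto
  have Rm: "R \<in> borel_measurable M"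
    unfolding R_def[abs_def] using borel_measurable_diff[OF Sm S'm]
    by (intro measurable_integral_square_indicator) (auto simp: split_beta')
  have Im: "?I v \<in> borel_measurable M" "?I u \<in> borel_measurable M" "?I' u \<in> borel_measurable M"
    using uv by (auto intro!: simple_integral_measurable S S')
  have xm: "x \<in> borel_measurable M" unfolding x_def[abs_def] using Im Qm by measurable
  have ym: "y \<in> borel_measurable M" unfolding y_def[abs_def] using Im Rm by measurable
  have "g \<ge> 0" using G(2,3) not_empty by (metis all_not_in_conv order_trans)
  have Gint: "integrable M G"
    using GM G by (intro integrable_const_bound[of _ g]) (auto intro!: AE_I2)
  have Geq: "(\<integral>\<^sup>+\<omega>. ennreal (G \<omega>) \<partial>M) = ennreal (\<integral>\<omega>. G \<omega> \<partial>M)"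
    using Gint G(2) by (intro nn_integral_eq_integral) (auto intro!: AE_I2)
  have "(\<integral>\<^sup>+\<omega>. ennreal (G \<omega> * exp (\<theta> * (?I v \<omega> - ?I' u \<omega>)
        - \<theta>\<^sup>2 / (2 * (1 - k)) * ((1 + k) * (L\<^sup>2 * (v - u)) + (1 + 1 / k) * q \<omega>)
        - \<theta>\<^sup>2 / (2 * k) * (2 * q \<omega> + 2 * q' \<omega>))) \<partial>M)
      \<le> (\<integral>\<^sup>+\<omega>. ennreal (1 - k) * (ennreal (G \<omega>) * ennreal (exp (x \<omega>))) + ennreal (k * g) * ennreal (exp (y \<omega>)) \<partial>M)"
  proof (rule nn_integral_mono)
    fix \<omega> assume "\<omega> \<in> space M"
    from ennreal_leI[OF bound[OF this]]
    show "ennreal (G \<omega> * exp (\<theta> * (?I v \<omega> - ?I' u \<omega>)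
        - \<theta>\<^sup>2 / (2 * (1 - k)) * ((1 + k) * (L\<^sup>2 * (v - u)) + (1 + 1 / k) * q \<omega>)
        - \<theta>\<^sup>2 / (2 * k) * (2 * q \<omega> + 2 * q' \<omega>)))
      \<le> ennreal (1 - k) * (ennreal (G \<omega>) * ennreal (exp (x \<omega>))) + ennreal (k * g) * ennreal (exp (y \<omega>))"
      using k G(2)[OF \<open>\<omega> \<in> space M\<close>] \<open>g \<ge> 0\<close>
      by (simp add: mult.assoc flip: ennreal_mult ennreal_plus)
  qed
  also have "\<dots> = ennreal (1 - k) * (\<integral>\<^sup>+\<omega>. ennreal (G \<omega>) * ennreal (exp (x \<omega>)) \<partial>M)
      + ennreal (k * g) * (\<integral>\<^sup>+\<omega>. ennreal (exp (y \<omega>)) \<partial>M)"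
    using GM xm ym by (simp add: nn_integral_add nn_integral_cmult)
  also have "(\<integral>\<^sup>+\<omega>. ennreal (exp (y \<omega>)) \<partial>M) = 1"
    unfolding y_def R_def by (rule nn_integral_exp_simple_diff[OF S S' uv(1)])
  also have "(\<integral>\<^sup>+\<omega>. ennreal (G \<omega>) * ennreal (exp (x \<omega>)) \<partial>M) = (\<integral>\<^sup>+\<omega>. ennreal (G \<omega>) \<partial>M)"
    unfolding x_def Q_def using G(1) by (intro nn_integral_exp_simple[OF S uv]) simp
  finally show ?thesis
    using k \<open>g \<ge> 0\<close> G(2) by (simp add: Geq integral_nonneg_AE flip: ennreal_mult ennreal_plus)
qed

end

section \<open>Exponential moments of Ito integrals\<close>

context filtered_brownian_motion
begin

text \<open>
  The integrals up to \<open>u\<close> and up to \<open>v\<close> may come from different approximating sequences. The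
  discrepancy between these on \<open>[0, u]\<close> enters with a weight \<open>k\<close> that tends to \<open>0\<close> at the end.
\<close>

lemma ito_increment_exp_bound:
  assumes I1: "has_ito_integral M F W H u I1" and I2: "has_ito_integral M F W H v I2"
    and uv: "0 \<le> u" "u \<le> v"
    and HL: "\<And>s \<omega>. \<omega> \<in> space M \<Longrightarrow> 0 \<le> s \<Longrightarrow> s \<le> v \<Longrightarrow> \<bar>H s \<omega>\<bar> \<le> L"
    and G: "G \<in> borel_measurable (F u)" "\<And>\<omega>. \<omega> \<in> space M \<Longrightarrow> 0 \<le> G \<omega>" "\<And>\<omega>. \<omega> \<in> space M \<Longrightarrow> G \<omega> \<le> g"
  shows "(\<integral>\<^sup>+\<omega>. ennreal (G \<omega> * exp (\<theta> * (I2 \<omega> - I1 \<omega>))) \<partial>M)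
    \<le> ennreal (exp (\<theta>\<^sup>2 * L\<^sup>2 * (v - u) / 2) * (\<integral>\<omega>. G \<omega> \<partial>M))"
proof -
  \<comment> \<open>Freezing \<open>H\<close> at the ends of [0, v] makes it bounded and jointly
    measurable on the whole line without changing it on [0, v].\<close>
  define H' where "H' s \<omega> = H (max 0 (min s v)) \<omega>" for s \<omega>
  have H'L: "\<bar>H' s \<omega>\<bar> \<le> L" if "\<omega> \<in> space M" for s \<omega>
    unfolding H'_def using uv by (intro HL that) auto
  have H'm: "(\<lambda>(s, \<omega>). H' s \<omega>) \<in> borel_measurable (borel \<Otimes>\<^sub>M M)"
  proof -
    have "(\<lambda>(r, \<omega>). H r \<omega>) \<in> borel_measurable (restrict_space borel {0..v} \<Otimes>\<^sub>M F v)"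
      using I2 uv by (simp add: has_ito_integral_def)
    moreover have "(\<lambda>(s, \<omega>). (max 0 (min s v), \<omega>)) \<in> borel \<Otimes>\<^sub>M M \<rightarrow>\<^sub>M restrict_space borel {0..v} \<Otimes>\<^sub>M F v"
    proof -
      have "(\<lambda>s. max 0 (min s v)) \<in> borel \<rightarrow>\<^sub>M restrict_space borel {0..v}"
        using uv by (intro measurable_restrict_space2) auto
      moreover have "(\<lambda>\<omega>. \<omega>) \<in> M \<rightarrow>\<^sub>M F v" by (rule measurable_F_M[of _ v]) simp
      ultimately show ?thesis
        by (simp add: split_beta')
    qed
    ultimately have "(\<lambda>x. (\<lambda>(r, \<omega>). H r \<omega>) ((\<lambda>(s, \<omega>). (max 0 (min s v), \<omega>)) x)) \<in> borel_measurable (borel \<Otimes>\<^sub>M M)"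
      by (rule measurable_compose[rotated])
    then show ?thesis by (simp add: H'_def split_beta')
  qed
  obtain n \<tau> \<xi> where S: "\<And>k :: nat. simple_integrand M F (n k) (\<tau> k) (\<xi> k)"
    and S1: "(\<lambda>k. \<integral>\<^sup>+\<omega>. (\<integral>\<^sup>+s\<in>{0..v}. ennreal ((H s \<omega> - simple_value (n k) (\<tau> k) (\<xi> k) s \<omega>)\<^sup>2) \<partial>lborel) \<partial>M) \<longlonglongrightarrow> 0"
    and S2: "(\<lambda>k. \<integral>\<^sup>+\<omega>. ennreal ((I2 \<omega> - simple_integral W (n k) (\<tau> k) (\<xi> k) v \<omega>)\<^sup>2) \<partial>M) \<longlonglongrightarrow> 0"
    and I2m: "I2 \<in> borel_measurable M"
    using I2 unfolding has_ito_integral_def by blast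
  obtain n' \<tau>' \<xi>' where S': "\<And>k :: nat. simple_integrand M F (n' k) (\<tau>' k) (\<xi>' k)"
    and S1': "(\<lambda>k. \<integral>\<^sup>+\<omega>. (\<integral>\<^sup>+s\<in>{0..u}. ennreal ((H s \<omega> - simple_value (n' k) (\<tau>' k) (\<xi>' k) s \<omega>)\<^sup>2) \<partial>lborel) \<partial>M) \<longlonglongrightarrow> 0"
    and S2': "(\<lambda>k. \<integral>\<^sup>+\<omega>. ennreal ((I1 \<omega> - simple_integral W (n' k) (\<tau>' k) (\<xi>' k) u \<omega>)\<^sup>2) \<partial>M) \<longlonglongrightarrow> 0"
    and I1m: "I1 \<in> borel_measurable M"
    using I1 unfolding has_ito_integral_def by blast
  define A where "A k = simple_integral W (n k) (\<tau> k) (\<xi> k) v" for k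
  define A' where "A' k = simple_integral W (n' k) (\<tau>' k) (\<xi>' k) u" for k
  define q where "q k \<omega> = (LINT s|lborel. ((H' s \<omega> - simple_value (n k) (\<tau> k) (\<xi> k) s \<omega>) * indicator {0..v} s)\<^sup>2)" for k \<omega>
  define q' where "q' k \<omega> = (LINT s|lborel. ((H' s \<omega> - simple_value (n' k) (\<tau>' k) (\<xi>' k) s \<omega>) * indicator {0..u} s)\<^sup>2)" for k \<omega>
  have L2_dist: "(\<integral>\<^sup>+s\<in>{0..t}. ennreal ((H s \<omega> - simple_value m \<rho> \<eta> s \<omega>)\<^sup>2) \<partial>lborel)
      = ennreal (LINT s|lborel. ((H' s \<omega> - simple_value m \<rho> \<eta> s \<omega>) * indicator {0..t} s)\<^sup>2)"
    if "\<omega> \<in> space M" "t \<le> v" and si: "simple_integrand M F m \<rho> \<eta>" for \<omega> t m \<rho> \<eta>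
  proof -
    obtain B where B: "\<And>s \<omega>. \<omega> \<in> space M \<Longrightarrow> \<bar>simple_value m \<rho> \<eta> s \<omega>\<bar> \<le> B"
      using simple_value_bounded[OF si] by metis
    have "(\<lambda>s. H' s \<omega> - simple_value m \<rho> \<eta> s \<omega>) \<in> borel_measurable borel"
      using measurable_Pair1[OF H'm \<open>\<omega> \<in> space M\<close>] measurable_Pair1[OF simple_value_measurable[OF si] \<open>\<omega> \<in> space M\<close>] by simp
    moreover have "\<bar>H' s \<omega> - simple_value m \<rho> \<eta> s \<omega>\<bar> \<le> L + B" for s
      using H'L[OF \<open>\<omega> \<in> space M\<close>, of s] B[OF \<open>\<omega> \<in> space M\<close>, of s] by linarith
    ultimately have "integrable lborel (\<lambda>s. ((H' s \<omega> - simple_value m \<rho> \<eta> s \<omega>) * indicator {0..t} s)\<^sup>2)"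
      by (rule integrable_square_indicator[of _ _ _ 0 t]) auto
    then have "(\<integral>\<^sup>+s. ennreal (((H' s \<omega> - simple_value m \<rho> \<eta> s \<omega>) * indicator {0..t} s)\<^sup>2) \<partial>lborel)
        = ennreal (LINT s|lborel. ((H' s \<omega> - simple_value m \<rho> \<eta> s \<omega>) * indicator {0..t} s)\<^sup>2)"
      by (intro nn_integral_eq_integral) auto
    moreover have "ennreal (((H' s \<omega> - simple_value m \<rho> \<eta> s \<omega>) * indicator {0..t} s)\<^sup>2)
        = ennreal ((H s \<omega> - simple_value m \<rho> \<eta> s \<omega>)\<^sup>2) * indicator {0..t} s" for s
      using \<open>t \<le> v\<close> by (auto simp: indicator_def H'_def)
    ultimately show ?thesis by simp
  qed
  have S1q: "(\<lambda>k. \<integral>\<^sup>+\<omega>. ennreal (q k \<omega>) \<partial>M) \<longlonglongrightarrow> 0"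
    using S1 by (simp add: q_def L2_dist[OF _ order_refl S] cong: nn_integral_cong)
  have S1q': "(\<lambda>k. \<integral>\<^sup>+\<omega>. ennreal (q' k \<omega>) \<partial>M) \<longlonglongrightarrow> 0"
    using S1' by (simp add: q'_def L2_dist[OF _ uv(2) S'] cong: nn_integral_cong)
  have qm: "q k \<in> borel_measurable M" "q' k \<in> borel_measurable M" for k
    unfolding q_def[abs_def] q'_def[abs_def]
    using borel_measurable_diff[OF H'm simple_value_measurable[OF S]]
      borel_measurable_diff[OF H'm simple_value_measurable[OF S']]
    by (auto intro!: measurable_integral_square_indicator simp: split_beta')
  have Am: "A k \<in> borel_measurable M" "A' k \<in> borel_measurable M" for k
    unfolding A_def A'_def using uv by (auto intro!: simple_integral_measurable S S')
  have q0: "0 \<le> q k \<omega>" "0 \<le> q' k \<omega>" for k \<omega> by (simp_all add: q_def q'_def)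
  \<comment> \<open>The sum of all four errors, so that one subsequence serves all of them almost
    everywhere.\<close>
  define f where "f k \<omega> = q k \<omega> + q' k \<omega> + (I2 \<omega> - A k \<omega>)\<^sup>2 + (I1 \<omega> - A' k \<omega>)\<^sup>2" for k \<omega>
  have "(\<integral>\<^sup>+\<omega>. ennreal (f k \<omega>) \<partial>M) = (\<integral>\<^sup>+\<omega>. ennreal (q k \<omega>) \<partial>M) + (\<integral>\<^sup>+\<omega>. ennreal (q' k \<omega>) \<partial>M)
      + (\<integral>\<^sup>+\<omega>. ennreal ((I2 \<omega> - A k \<omega>)\<^sup>2) \<partial>M) + (\<integral>\<^sup>+\<omega>. ennreal ((I1 \<omega> - A' k \<omega>)\<^sup>2) \<partial>M)" for k
    using qm Am I1m I2m q0 by (simp add: f_def nn_integral_add)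
  then have "(\<lambda>k. \<integral>\<^sup>+\<omega>. ennreal (f k \<omega>) \<partial>M) \<longlonglongrightarrow> 0"
    using tendsto_add[OF tendsto_add[OF tendsto_add[OF S1q S1q'] S2] S2'] by (simp add: A_def A'_def)
  moreover have "f k \<in> borel_measurable M" "0 \<le> f k \<omega>" for k \<omega>
    unfolding f_def using qm Am I1m I2m q0 by (measurable, simp)
  ultimately obtain N where N: "AE \<omega> in M. (\<lambda>k. f (N k) \<omega>) \<longlonglongrightarrow> 0"
    using nn_integral_tendsto_0_AE_subseq[of f M] by blast
  have GM: "G \<in> borel_measurable M" using G(1) by (rule measurable_F_M)
  \<comment> \<open>The deterministic part of the exponent; it tends to
    \<open>\<theta>\<^sup>2 * L\<^sup>2 * (v - u) / 2\<close> as \<open>k\<close> tends to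
    0.\<close>
  define C where "C k = \<theta>\<^sup>2 / (2 * (1 - k)) * ((1 + k) * (L\<^sup>2 * (v - u)))" for k :: real
  have step: "(\<integral>\<^sup>+\<omega>. ennreal (G \<omega> * exp (\<theta> * (I2 \<omega> - I1 \<omega>) - C k)) \<partial>M)
      \<le> ennreal ((1 - k) * (\<integral>\<omega>. G \<omega> \<partial>M) + k * g)" if k: "0 < k" "k < 1" for k
  proof -
    define h where "h j \<omega> = G \<omega> * exp (\<theta> * (A (N j) \<omega> - A' (N j) \<omega>)
        - \<theta>\<^sup>2 / (2 * (1 - k)) * ((1 + k) * (L\<^sup>2 * (v - u)) + (1 + 1 / k) * q (N j) \<omega>)
        - \<theta>\<^sup>2 / (2 * k) * (2 * q (N j) \<omega> + 2 * q' (N j) \<omega>))" for j \<omega>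
    have hm: "h j \<in> borel_measurable M" for j
      unfolding h_def[abs_def] using GM qm Am by measurable
    have hint: "(\<integral>\<^sup>+\<omega>. ennreal (h j \<omega>) \<partial>M) \<le> ennreal ((1 - k) * (\<integral>\<omega>. G \<omega> \<partial>M) + k * g)" for j
      unfolding h_def A_def A'_def q_def q'_def by (rule exp_simple_split[OF S S' uv k H'm H'L G])
    have lim: "AE \<omega> in M. (\<lambda>j. ennreal (h j \<omega>)) \<longlonglongrightarrow> ennreal (G \<omega> * exp (\<theta> * (I2 \<omega> - I1 \<omega>) - C k))"
      using N
    proof eventually_elim
      fix \<omega> assume f0: "(\<lambda>j. f (N j) \<omega>) \<longlonglongrightarrow> 0"
      have sq: "(\<lambda>j. q (N j) \<omega>) \<longlonglongrightarrow> 0" "(\<lambda>j. q' (N j) \<omega>) \<longlonglongrightarrow> 0"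
        "(\<lambda>j. (I2 \<omega> - A (N j) \<omega>)\<^sup>2) \<longlonglongrightarrow> 0" "(\<lambda>j. (I1 \<omega> - A' (N j) \<omega>)\<^sup>2) \<longlonglongrightarrow> 0"
        by (rule tendsto_sandwich[OF _ _ tendsto_const f0]; intro always_eventually allI;
            simp add: f_def q0)+
      have "(\<lambda>j. I2 \<omega> - A (N j) \<omega>) \<longlonglongrightarrow> 0" "(\<lambda>j. I1 \<omega> - A' (N j) \<omega>) \<longlonglongrightarrow> 0"
        using tendsto_real_sqrt[OF sq(3)] tendsto_real_sqrt[OF sq(4)]
        by (simp_all add: tendsto_rabs_zero_iff)
      from tendsto_diff[OF tendsto_const this(1), of "I2 \<omega>"] tendsto_diff[OF tendsto_const this(2), of "I1 \<omega>"]
      have AA: "(\<lambda>j. A (N j) \<omega>) \<longlonglongrightarrow> I2 \<omega>" "(\<lambda>j. A' (N j) \<omega>) \<longlonglongrightarrow> I1 \<omega>" by simp_all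
      have "(\<lambda>j. h j \<omega>) \<longlonglongrightarrow> G \<omega> * exp (\<theta> * (I2 \<omega> - I1 \<omega>)
          - \<theta>\<^sup>2 / (2 * (1 - k)) * ((1 + k) * (L\<^sup>2 * (v - u)) + (1 + 1 / k) * 0)
          - \<theta>\<^sup>2 / (2 * k) * (2 * 0 + 2 * 0))"
        unfolding h_def by (intro tendsto_intros AA sq)
      then show "(\<lambda>j. ennreal (h j \<omega>)) \<longlonglongrightarrow> ennreal (G \<omega> * exp (\<theta> * (I2 \<omega> - I1 \<omega>) - C k))"
        by (intro tendsto_ennrealI) (simp add: C_def)
    qed
    have "(\<integral>\<^sup>+\<omega>. ennreal (G \<omega> * exp (\<theta> * (I2 \<omega> - I1 \<omega>) - C k)) \<partial>M) = (\<integral>\<^sup>+\<omega>. liminf (\<lambda>j. ennreal (h j \<omega>)) \<partial>M)"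
      by (rule nn_integral_cong_AE) (use lim in \<open>eventually_elim, simp add: lim_imp_Liminf\<close>)
    \<comment> \<open>Fatou's lemma: almost everywhere convergence is enough to carry an upper bound
      to the limit.\<close>
    also have "\<dots> \<le> liminf (\<lambda>j. \<integral>\<^sup>+\<omega>. ennreal (h j \<omega>) \<partial>M)"
      by (rule nn_integral_liminf) (use hm in measurable)
    also have "\<dots> \<le> ennreal ((1 - k) * (\<integral>\<omega>. G \<omega> \<partial>M) + k * g)"
      by (intro Liminf_le always_eventually allI hint) simp
    finally show ?thesis .
  qed
  have hm: "(\<lambda>\<omega>. G \<omega> * exp (\<theta> * (I2 \<omega> - I1 \<omega>) - c)) \<in> borel_measurable M" for c
    using GM I1m I2m by measurable
  have "(\<integral>\<^sup>+\<omega>. ennreal (G \<omega> * exp (\<theta> * (I2 \<omega> - I1 \<omega>))) \<partial>M)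
      \<le> ennreal (exp (C k) * ((1 - k) * (\<integral>\<omega>. G \<omega> \<partial>M) + k * g))" if k: "0 < k" "k < 1" for k
  proof -
    have "(\<integral>\<^sup>+\<omega>. ennreal (G \<omega> * exp (\<theta> * (I2 \<omega> - I1 \<omega>))) \<partial>M)
        = (\<integral>\<^sup>+\<omega>. ennreal (exp (C k)) * ennreal (G \<omega> * exp (\<theta> * (I2 \<omega> - I1 \<omega>) - C k)) \<partial>M)"
      by (simp flip: ennreal_mult' exp_add add: mult.left_commute)
    also have "\<dots> = ennreal (exp (C k)) * (\<integral>\<^sup>+\<omega>. ennreal (G \<omega> * exp (\<theta> * (I2 \<omega> - I1 \<omega>) - C k)) \<partial>M)"
      by (intro nn_integral_cmult measurable_compose[OF hm measurable_ennreal])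
    also have "\<dots> \<le> ennreal (exp (C k)) * ennreal ((1 - k) * (\<integral>\<omega>. G \<omega> \<partial>M) + k * g)"
      by (intro mult_left_mono step k) simp
    finally show ?thesis by (simp flip: ennreal_mult')
  qed
  \<comment> \<open>The left side is free of \<open>k\<close>; letting \<open>k\<close> tend to 0
    removes the contribution of \<open>g\<close> and the inflation of the exponent.\<close>
  then have ev: "\<forall>\<^sub>F k in at_right 0. (\<integral>\<^sup>+\<omega>. ennreal (G \<omega> * exp (\<theta> * (I2 \<omega> - I1 \<omega>))) \<partial>M)
      \<le> ennreal (exp (C k) * ((1 - k) * (\<integral>\<omega>. G \<omega> \<partial>M) + k * g))"
    using eventually_at_right_real[of 0 1] by (auto elim!: eventually_mono)
  have "((\<lambda>k. ennreal (exp (C k) * ((1 - k) * (\<integral>\<omega>. G \<omega> \<partial>M) + k * g))) \<longlongrightarrow>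
      ennreal (exp (\<theta>\<^sup>2 / (2 * (1 - 0)) * ((1 + 0) * (L\<^sup>2 * (v - u)))) * ((1 - 0) * (\<integral>\<omega>. G \<omega> \<partial>M) + 0 * g))) (at_right 0)"
    unfolding C_def by (intro tendsto_ennrealI tendsto_intros) auto
  from tendsto_lowerbound[OF this ev] show ?thesis by (simp add: mult.assoc)
qed

end

section \<open>Flows with noise\<close>

text \<open>
  \<open>d\<close> is the noise accumulated since time \<open>u\<close>; without it the path would follow the flow of
  \<open>\<beta>\<close>, along which \<open>\<phi>\<close> has derivative \<open>g \<beta>\<close>.
\<close>

lemma noisy_flow_estimate:
  fixes y \<beta> \<phi> g :: "real \<Rightarrow> real"
  assumes y: "continuous_on {u..v} y" and uv: "u \<le> v" and \<beta>: "continuous_on UNIV \<beta>" "\<And>t. \<bar>\<beta> t\<bar> \<le> B"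
    and \<phi>: "\<And>t. (\<phi> has_real_derivative g t) (at t)" and g: "continuous_on UNIV g" "\<And>t. \<bar>g t\<bar> \<le> K"
    and modulus: "\<And>s t. \<bar>g s - g t\<bar> \<le> \<eta> + C * \<bar>s - t\<bar>"
  defines "d \<equiv> \<lambda>s. y s - y u - integral {u..s} (\<lambda>r. \<beta> (y r))"
  shows "\<bar>integral {u..v} (\<lambda>s. g (y s) * \<beta> (y s)) - (\<phi> (y v) - \<phi> (y u))\<bar>
    \<le> B * \<eta> * (v - u) + B * C * integral {u..v} (\<lambda>s. \<bar>d s\<bar>) + K * \<bar>d v\<bar>"
proof -
  \<comment> \<open>\<open>z\<close> is driven by the drift along the true path. Unlike
    \<open>y\<close> it is known to be differentiable, so the ordinary chain rule applies to
    \<open>\<phi>\<close> along \<open>z\<close>, and passing from \<open>y\<close> to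
    \<open>z\<close> costs only \<open>d\<close>.\<close>
  define z where "z s = y u + integral {u..s} (\<lambda>r. \<beta> (y r))" for s
  have \<beta>y: "continuous_on {u..v} (\<lambda>r. \<beta> (y r))"
    by (rule continuous_on_compose2[OF \<beta>(1) y]) auto
  have z': "(z has_real_derivative \<beta> (y s)) (at s within {u..v})" if "s \<in> {u..v}" for s
    unfolding z_def using integral_has_real_derivative[OF \<beta>y that]
    by (auto intro!: derivative_eq_intros)
  have zc: "continuous_on {u..v} z"
    using z'[THEN DERIV_continuous] by (simp add: continuous_on_eq_continuous_within)
  have dc: "continuous_on {u..v} d"
  proof -
    have "d = (\<lambda>s. y s - z s)" by (auto simp: d_def z_def)
    then show ?thesis using y zc by (auto intro!: continuous_intros)
  qed
  have gy: "continuous_on {u..v} (\<lambda>s. g (y s))" by (rule continuous_on_compose2[OF g(1) y]) auto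
  have gz: "continuous_on {u..v} (\<lambda>s. g (z s))" by (rule continuous_on_compose2[OF g(1) zc]) auto
  have "((\<lambda>s. \<phi> (z s)) has_real_derivative g (z s) * \<beta> (y s)) (at s within {u..v})" if "s \<in> {u..v}" for s
    by (rule DERIV_chain2[OF \<phi> z'[OF that]])
  then have "((\<lambda>s. g (z s) * \<beta> (y s)) has_integral \<phi> (z v) - \<phi> (z u)) {u..v}"
    using uv by (intro fundamental_theorem_of_calculus) (auto simp: has_real_derivative_iff_has_vector_derivative)
  moreover have "((\<lambda>s. g (y s) * \<beta> (y s)) has_integral integral {u..v} (\<lambda>s. g (y s) * \<beta> (y s))) {u..v}"
    using gy \<beta>y by (intro integrable_integral integrable_continuous_interval continuous_intros)
  ultimately have "((\<lambda>s. g (y s) * \<beta> (y s) - g (z s) * \<beta> (y s)) has_integral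
      integral {u..v} (\<lambda>s. g (y s) * \<beta> (y s)) - (\<phi> (z v) - \<phi> (z u))) {u..v}"
    by (rule has_integral_diff[rotated])
  moreover have "((\<lambda>s. B * \<eta> + B * C * \<bar>d s\<bar>) has_integral B * \<eta> * (v - u) + B * C * integral {u..v} (\<lambda>s. \<bar>d s\<bar>)) {u..v}"
  proof (intro has_integral_add has_integral_mult_right integrable_integral)
    show "((\<lambda>s. B * \<eta>) has_integral B * \<eta> * (v - u)) {u..v}"
      using has_integral_const_real[of "B * \<eta>" u v] uv by (simp add: mult.commute)
    show "(\<lambda>s. \<bar>d s\<bar>) integrable_on {u..v}"
      using dc by (intro integrable_continuous_interval continuous_intros)
  qed
  moreover have "\<bar>g (y s) * \<beta> (y s) - g (z s) * \<beta> (y s)\<bar> \<le> B * \<eta> + B * C * \<bar>d s\<bar>" for s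
  proof -
    have "0 \<le> B" using \<beta>(2)[of 0] by linarith
    have "\<bar>g (y s) * \<beta> (y s) - g (z s) * \<beta> (y s)\<bar> = \<bar>\<beta> (y s)\<bar> * \<bar>g (y s) - g (z s)\<bar>"
      by (simp flip: abs_mult add: algebra_simps)
    also have "\<dots> \<le> B * (\<eta> + C * \<bar>y s - z s\<bar>)"
      using \<beta>(2) modulus \<open>0 \<le> B\<close> by (intro mult_mono) auto
    also have "y s - z s = d s" by (simp add: d_def z_def)
    finally show ?thesis by (simp add: algebra_simps)
  qed
  ultimately have main: "\<bar>integral {u..v} (\<lambda>s. g (y s) * \<beta> (y s)) - (\<phi> (z v) - \<phi> (z u))\<bar>
      \<le> B * \<eta> * (v - u) + B * C * integral {u..v} (\<lambda>s. \<bar>d s\<bar>)"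
    using integral_norm_bound_integral[of "\<lambda>s. g (y s) * \<beta> (y s) - g (z s) * \<beta> (y s)" "{u..v}" "\<lambda>s. B * \<eta> + B * C * \<bar>d s\<bar>"]
    by (auto simp: has_integral_iff)
  have "z u = y u" by (simp add: z_def)
  have "\<bar>\<phi> (y v) - \<phi> (z v)\<bar> \<le> K * \<bar>y v - z v\<bar>"
    using field_differentiable_bound[of UNIV \<phi> g K "z v" "y v"] \<phi> g(2)
    by (simp add: abs_minus_commute)
  moreover have "y v - z v = d v" by (simp add: d_def z_def)
  ultimately show ?thesis using main \<open>z u = y u\<close> by simp
qed

text \<open>Jensen's inequality on an interval of length one, obtained by integrating the tangent
  line of \<open>exp\<close> at the mean value.\<close>

lemma exp_integral_le:
  fixes f :: "real \<Rightarrow> real"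
  assumes "continuous_on {u..u + 1} f"
  shows "exp (integral {u..u + 1} f) \<le> integral {u..u + 1} (\<lambda>s. exp (f s))"
proof -
  let ?m = "integral {u..u + 1} f"
  have "((\<lambda>s. exp ?m * (1 + (f s - ?m))) has_integral exp ?m * (1 + (?m - ?m))) {u..u + 1}"
    using has_integral_const_real[of 1 u "u + 1"] has_integral_const_real[of ?m u "u + 1"] assms
    by (intro has_integral_mult_right has_integral_add has_integral_diff integrable_integral
        integrable_continuous_interval) auto
  moreover have "((\<lambda>s. exp (f s)) has_integral integral {u..u + 1} (\<lambda>s. exp (f s))) {u..u + 1}"
    using assms by (intro integrable_integral integrable_continuous_interval continuous_intros)
  moreover have "exp ?m * (1 + (f s - ?m)) \<le> exp (f s)" for s
  proof -
    have "exp ?m * (1 + (f s - ?m)) \<le> exp ?m * exp (f s - ?m)"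
      by (intro mult_left_mono exp_ge_add_one_self) simp
    then show ?thesis by (simp flip: exp_add)
  qed
  ultimately have "exp ?m * (1 + (?m - ?m)) \<le> integral {u..u + 1} (\<lambda>s. exp (f s))"
    by (rule has_integral_le)
  then show ?thesis by simp
qed

text \<open>Rounding the time down to a grid leaves countably many times, so the rounded process is
  jointly measurable; continuity of the paths gives the pointwise limit.\<close>

lemma measurable_continuous_process:
  fixes f :: "real \<Rightarrow> 'a \<Rightarrow> real"
  assumes "\<And>s. f s \<in> borel_measurable N" "\<And>\<omega>. \<omega> \<in> space N \<Longrightarrow> continuous_on UNIV (\<lambda>s. f s \<omega>)"
  shows "(\<lambda>(s, \<omega>). f s \<omega>) \<in> borel_measurable (borel \<Otimes>\<^sub>M N)"
proof (rule borel_measurable_LIMSEQ_metric)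
  let ?t = "\<lambda>n s. real_of_int \<lfloor>s * real (Suc n)\<rfloor> / real (Suc n)"
  fix n :: nat
  show "(\<lambda>(s, \<omega>). f (?t n s) \<omega>) \<in> borel_measurable (borel \<Otimes>\<^sub>M N)"
  proof -
    have "(\<lambda>x. f (real_of_int i / real (Suc n)) (snd x)) \<in> borel_measurable (borel \<Otimes>\<^sub>M N)" for i :: int
      by (intro measurable_compose[OF measurable_snd] assms(1))
    moreover have "(\<lambda>x. \<lfloor>fst x * real (Suc n)\<rfloor>) \<in> measurable (borel \<Otimes>\<^sub>M N) (count_space UNIV)"
      by measurable
    ultimately have "(\<lambda>x. f (real_of_int \<lfloor>fst x * real (Suc n)\<rfloor> / real (Suc n)) (snd x)) \<in> borel_measurable (borel \<Otimes>\<^sub>M N)"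
      by (rule measurable_compose_countable)
    then show ?thesis by (simp add: split_beta')
  qed
next
  let ?t = "\<lambda>n s. real_of_int \<lfloor>s * real (Suc n)\<rfloor> / real (Suc n)"
  fix x assume "x \<in> space ((borel :: real measure) \<Otimes>\<^sub>M N)"
  then obtain s \<omega> where x: "x = (s, \<omega>)" "\<omega> \<in> space N" by (auto simp: space_pair_measure)
  have "(\<lambda>n. ?t n s) \<longlonglongrightarrow> s"
  proof (rule real_tendsto_sandwich)
    show "\<forall>\<^sub>F n in sequentially. s - 1 / real (Suc n) \<le> ?t n s" "\<forall>\<^sub>F n in sequentially. ?t n s \<le> s"
    proof -
      have bounds: "s - 1 / real (Suc n) \<le> ?t n s \<and> ?t n s \<le> s" for n
      proof
        have "s * real (Suc n) - 1 \<le> real_of_int \<lfloor>s * real (Suc n)\<rfloor>" by linarith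
        then have "(s * real (Suc n) - 1) / real (Suc n) \<le> ?t n s" by (intro divide_right_mono) auto
        then show "s - 1 / real (Suc n) \<le> ?t n s" by (simp add: diff_divide_distrib del: of_nat_Suc)
        have "?t n s \<le> s * real (Suc n) / real (Suc n)" by (intro divide_right_mono) auto
        then show "?t n s \<le> s" by (simp del: of_nat_Suc)
      qed
      then show "\<forall>\<^sub>F n in sequentially. s - 1 / real (Suc n) \<le> ?t n s" "\<forall>\<^sub>F n in sequentially. ?t n s \<le> s"
        by (auto intro: always_eventually)
    qed
    show "(\<lambda>n. s - 1 / real (Suc n)) \<longlonglongrightarrow> s"
      using tendsto_diff[OF tendsto_const LIMSEQ_inverse_real_of_nat, of s] by (simp add: inverse_eq_divide)
  qed simp
  then have "(\<lambda>n. f (?t n s) \<omega>) \<longlonglongrightarrow> f s \<omega>"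
    using assms(2)[OF x(2)] by (intro continuous_on_tendsto_compose[of UNIV "\<lambda>s. f s \<omega>"]) auto
  then show "(\<lambda>n. (\<lambda>(s, \<omega>). f (?t n s) \<omega>) x) \<longlonglongrightarrow> (case x of (s, \<omega>) \<Rightarrow> f s \<omega>)"
    by (simp add: x)
qed

lemma integral_eq_lborel:
  fixes f :: "real \<Rightarrow> real"
  assumes "continuous_on {u..v} f"
  shows "integral {u..v} f = (LINT s:{u..v}|lborel. f s)"
  using set_borel_integral_eq_integral(2)[OF borel_integrable_atLeastAtMost'[OF assms]] by simp

lemma measurable_integral_process:
  fixes f :: "real \<Rightarrow> 'a \<Rightarrow> real"
  assumes "\<And>s. u \<le> s \<Longrightarrow> s \<le> v \<Longrightarrow> f s \<in> borel_measurable N"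
    and cont: "\<And>\<omega>. \<omega> \<in> space N \<Longrightarrow> continuous_on {u..v} (\<lambda>s. f s \<omega>)"
  shows "(\<lambda>\<omega>. integral {u..v} (\<lambda>s. f s \<omega>)) \<in> borel_measurable N"
proof (cases "u \<le> v")
  case True
  \<comment> \<open>Constant in time outside [u, v], so that the paths become continuous on the
    whole line.\<close>
  define g where "g s = f (max u (min s v))" for s
  have "(\<lambda>(s, \<omega>). g s \<omega>) \<in> borel_measurable (borel \<Otimes>\<^sub>M N)"
  proof (rule measurable_continuous_process)
    show "g s \<in> borel_measurable N" for s
      unfolding g_def using True by (intro assms(1)) auto
    show "continuous_on UNIV (\<lambda>s. g s \<omega>)" if "\<omega> \<in> space N" for \<omega>
      unfolding g_def using True
      by (intro continuous_on_compose2[OF cont[OF that]] continuous_intros) auto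
  qed
  then have "(\<lambda>(s, \<omega>). indicator {u..v} s *\<^sub>R g s \<omega>) \<in> borel_measurable (borel \<Otimes>\<^sub>M N)"
    by (simp add: split_beta') measurable
  from measurable_pair_swap[OF this]
  have "(\<lambda>(\<omega>, s). indicator {u..v} s *\<^sub>R g s \<omega>) \<in> borel_measurable (N \<Otimes>\<^sub>M lborel)"
    by (simp add: measurable_cong_sets[OF sets_pair_measure_cong[OF refl sets_lborel] refl])
  then have "(\<lambda>\<omega>. LINT s:{u..v}|lborel. g s \<omega>) \<in> borel_measurable N"
    unfolding set_lebesgue_integral_def by (rule lborel.borel_measurable_lebesgue_integral)
  moreover have "integral {u..v} (\<lambda>s. f s \<omega>) = (LINT s:{u..v}|lborel. g s \<omega>)" if "\<omega> \<in> space N" for \<omega>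
    unfolding integral_eq_lborel[OF cont[OF that]] by (rule set_lebesgue_integral_cong) (auto simp: g_def)
  ultimately show ?thesis by (simp cong: measurable_cong)
qed simp

section \<open>Noise along a lifted path\<close>

text \<open>Isolates what the estimates use of a circle diffusion: a continuous adapted real lift, a
  bounded continuous drift, and an integrand \<open>H\<close> of which only a bound \<open>L\<close>
  is known.\<close>

locale sde_path = filtered_brownian_motion M F W
  for M :: "'w measure" and F :: "real \<Rightarrow> 'w measure" and W :: "real \<Rightarrow> 'w \<Rightarrow> real" +
  fixes Y H :: "real \<Rightarrow> 'w \<Rightarrow> real" and \<beta> :: "real \<Rightarrow> real" and y0 L B :: real
  assumes Y_adapted: "\<And>t. 0 \<le> t \<Longrightarrow> Y t \<in> borel_measurable (F t)"
    and Y_continuous: "\<And>\<omega>. \<omega> \<in> space M \<Longrightarrow> continuous_on {0..} (\<lambda>t. Y t \<omega>)"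
    and drift_continuous: "continuous_on UNIV \<beta>" and drift_bound: "\<And>t. \<bar>\<beta> t\<bar> \<le> B"
    and diffusion_bound: "\<And>t \<omega>. \<omega> \<in> space M \<Longrightarrow> 0 \<le> t \<Longrightarrow> \<bar>H t \<omega>\<bar> \<le> L"
    and Y_eq: "\<And>t. 0 \<le> t \<Longrightarrow> \<exists>I. has_ito_integral M F W H t I \<and>
      (AE \<omega> in M. Y t \<omega> = y0 + I \<omega> + integral {0..t} (\<lambda>r. \<beta> (Y r \<omega>)))"
begin

lemma path_continuous:
  assumes "\<omega> \<in> space M" "0 \<le> u" "continuous_on UNIV f"
  shows "continuous_on {u..v} (\<lambda>s. f (Y s \<omega>))"
proof (rule continuous_on_compose2[OF assms(3)])
  show "continuous_on {u..v} (\<lambda>s. Y s \<omega>)"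
    by (rule continuous_on_subset[OF Y_continuous[OF assms(1)]]) (use assms(2) in auto)
qed auto

lemma path_integral_measurable:
  fixes f :: "real \<Rightarrow> real"
  assumes "0 \<le> u" "continuous_on UNIV f"
  shows "(\<lambda>\<omega>. integral {u..v} (\<lambda>s. f (Y s \<omega>))) \<in> borel_measurable (F v)"
proof (rule measurable_integral_process)
  show "(\<lambda>\<omega>. f (Y s \<omega>)) \<in> borel_measurable (F v)" if "u \<le> s" "s \<le> v" for s
    using measurable_F_mono[OF Y_adapted[of s], of v] that assms
    by (intro measurable_compose[OF _ borel_measurable_continuous_onI[OF assms(2)]]) auto
qed (use assms path_continuous in simp)

text \<open>Almost surely this is the increment of the Ito integral over [u, s]. Defined through the
  path instead, it is continuous in \<open>s\<close> for every \<open>\<omega>\<close> and adapted,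
  with no choice of versions.\<close>

definition noise :: "real \<Rightarrow> real \<Rightarrow> 'w \<Rightarrow> real"
  where "noise u s \<omega> = Y s \<omega> - Y u \<omega> - integral {u..s} (\<lambda>r. \<beta> (Y r \<omega>))"

lemma noise_measurable:
  assumes "0 \<le> u" "u \<le> s"
  shows "noise u s \<in> borel_measurable (F s)"
  unfolding noise_def[abs_def]
  using path_integral_measurable[OF assms(1) drift_continuous, of s] Y_adapted[of s]
    measurable_F_mono[OF Y_adapted[OF assms(1)] assms(2)] assms
  by (intro borel_measurable_diff) auto

lemma noise_continuous:
  assumes "\<omega> \<in> space M" "0 \<le> u"
  shows "continuous_on {u..v} (\<lambda>s. noise u s \<omega>)"
  unfolding noise_def
  by (intro continuous_intros path_continuous[OF assms continuous_on_id] indefinite_integral_continuous_1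
      integrable_continuous_interval path_continuous[OF assms drift_continuous])

text \<open>The integrals up to \<open>u\<close> and up to \<open>v\<close> come from separate uses
  of \<open>Y_eq\<close>, which is why \<open>ito_increment_exp_bound\<close> must allow unrelated
  approximations.\<close>

lemma noise_exp_bound:
  assumes "0 \<le> u" "u \<le> v"
    and G: "G \<in> borel_measurable (F u)" "\<And>\<omega>. \<omega> \<in> space M \<Longrightarrow> 0 \<le> G \<omega>" "\<And>\<omega>. \<omega> \<in> space M \<Longrightarrow> G \<omega> \<le> g"
  shows "(\<integral>\<^sup>+\<omega>. ennreal (G \<omega> * exp (\<theta> * noise u v \<omega>)) \<partial>M)
    \<le> ennreal (exp (\<theta>\<^sup>2 * L\<^sup>2 * (v - u) / 2) * (\<integral>\<omega>. G \<omega> \<partial>M))"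
proof -
  obtain I1 where I1: "has_ito_integral M F W H u I1"
      "AE \<omega> in M. Y u \<omega> = y0 + I1 \<omega> + integral {0..u} (\<lambda>r. \<beta> (Y r \<omega>))"
    using Y_eq[OF assms(1)] by auto
  obtain I2 where I2: "has_ito_integral M F W H v I2"
      "AE \<omega> in M. Y v \<omega> = y0 + I2 \<omega> + integral {0..v} (\<lambda>r. \<beta> (Y r \<omega>))"
    using Y_eq[of v] assms by auto
  have "AE \<omega> in M. noise u v \<omega> = I2 \<omega> - I1 \<omega>"
    using I1(2) I2(2) AE_space
  proof eventually_elim
    fix \<omega> assume *: "Y u \<omega> = y0 + I1 \<omega> + integral {0..u} (\<lambda>r. \<beta> (Y r \<omega>))"
      "Y v \<omega> = y0 + I2 \<omega> + integral {0..v} (\<lambda>r. \<beta> (Y r \<omega>))" "\<omega> \<in> space M"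
    have "integral {0..u} (\<lambda>r. \<beta> (Y r \<omega>)) + integral {u..v} (\<lambda>r. \<beta> (Y r \<omega>)) = integral {0..v} (\<lambda>r. \<beta> (Y r \<omega>))"
      using assms by (intro Henstock_Kurzweil_Integration.integral_combine integrable_continuous_interval path_continuous * drift_continuous) auto
    with * show "noise u v \<omega> = I2 \<omega> - I1 \<omega>" by (simp add: noise_def)
  qed
  then have "(\<integral>\<^sup>+\<omega>. ennreal (G \<omega> * exp (\<theta> * noise u v \<omega>)) \<partial>M) = (\<integral>\<^sup>+\<omega>. ennreal (G \<omega> * exp (\<theta> * (I2 \<omega> - I1 \<omega>))) \<partial>M)"
    by (intro nn_integral_cong_AE) (auto elim: eventually_mono)
  also have "\<dots> \<le> ennreal (exp (\<theta>\<^sup>2 * L\<^sup>2 * (v - u) / 2) * (\<integral>\<omega>. G \<omega> \<partial>M))"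
    by (rule ito_increment_exp_bound[OF I1(1) I2(1) assms(1,2) diffusion_bound G])
  finally show ?thesis .
qed

text \<open>\<open>exp \<bar>x\<bar> \<le> exp x + exp (- x)\<close>, whence the factor 2. The bound
  is uniform over times within one unit of \<open>u\<close>.\<close>

lemma noise_exp_abs_bound:
  assumes "0 \<le> u" "u \<le> v" "v \<le> u + 1"
    and G: "G \<in> borel_measurable (F u)" "\<And>\<omega>. \<omega> \<in> space M \<Longrightarrow> 0 \<le> G \<omega>" "\<And>\<omega>. \<omega> \<in> space M \<Longrightarrow> G \<omega> \<le> g"
  shows "(\<integral>\<^sup>+\<omega>. ennreal (G \<omega> * exp (\<theta> * \<bar>noise u v \<omega>\<bar>)) \<partial>M)
    \<le> ennreal (2 * exp (\<theta>\<^sup>2 * L\<^sup>2 / 2) * (\<integral>\<omega>. G \<omega> \<partial>M))"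
proof -
  have GM [measurable]: "G \<in> borel_measurable M" by (rule measurable_F_M[OF G(1)])
  have nM [measurable]: "noise u v \<in> borel_measurable M" by (rule measurable_F_M[OF noise_measurable[OF assms(1,2)]])
  have G0: "0 \<le> (\<integral>\<omega>. G \<omega> \<partial>M)" using G(2) by (intro integral_nonneg_AE) auto
  have "(\<integral>\<^sup>+\<omega>. ennreal (G \<omega> * exp (\<theta> * \<bar>noise u v \<omega>\<bar>)) \<partial>M)
      \<le> (\<integral>\<^sup>+\<omega>. ennreal (G \<omega> * exp (\<theta> * noise u v \<omega>)) + ennreal (G \<omega> * exp (- \<theta> * noise u v \<omega>)) \<partial>M)"
  proof (rule nn_integral_mono)
    fix \<omega> assume "\<omega> \<in> space M"
    then have "G \<omega> * exp (\<theta> * \<bar>noise u v \<omega>\<bar>) \<le> G \<omega> * (exp (\<theta> * noise u v \<omega>) + exp (- \<theta> * noise u v \<omega>))"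
      using G(2) by (intro mult_left_mono) (auto simp: abs_if add_increasing add_increasing2)
    then show "ennreal (G \<omega> * exp (\<theta> * \<bar>noise u v \<omega>\<bar>))
        \<le> ennreal (G \<omega> * exp (\<theta> * noise u v \<omega>)) + ennreal (G \<omega> * exp (- \<theta> * noise u v \<omega>))"
      using G(2)[OF \<open>\<omega> \<in> space M\<close>] by (simp add: distrib_left flip: ennreal_plus)
  qed
  also have "\<dots> = (\<integral>\<^sup>+\<omega>. ennreal (G \<omega> * exp (\<theta> * noise u v \<omega>)) \<partial>M) + (\<integral>\<^sup>+\<omega>. ennreal (G \<omega> * exp (- \<theta> * noise u v \<omega>)) \<partial>M)"
    by (intro nn_integral_add) measurable
  also have "\<dots> \<le> ennreal (exp (\<theta>\<^sup>2 * L\<^sup>2 * (v - u) / 2) * (\<integral>\<omega>. G \<omega> \<partial>M))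
      + ennreal (exp ((- \<theta>)\<^sup>2 * L\<^sup>2 * (v - u) / 2) * (\<integral>\<omega>. G \<omega> \<partial>M))"
    by (intro add_mono noise_exp_bound[where g = g] assms G)
  also have "\<dots> = ennreal (2 * exp (\<theta>\<^sup>2 * L\<^sup>2 * (v - u) / 2) * (\<integral>\<omega>. G \<omega> \<partial>M))"
    using G0 by (simp flip: ennreal_plus)
  also have "\<dots> \<le> ennreal (2 * exp (\<theta>\<^sup>2 * L\<^sup>2 / 2) * (\<integral>\<omega>. G \<omega> \<partial>M))"
  proof (intro ennreal_leI mult_right_mono mult_left_mono G0)
    have "\<theta>\<^sup>2 * L\<^sup>2 * (v - u) \<le> \<theta>\<^sup>2 * L\<^sup>2 * 1" using assms(3) by (intro mult_left_mono) auto
    then show "exp (\<theta>\<^sup>2 * L\<^sup>2 * (v - u) / 2) \<le> exp (\<theta>\<^sup>2 * L\<^sup>2 / 2)" by simp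
  qed simp
  finally show ?thesis .
qed

text \<open>Tonelli's theorem exchanges time and expectation, and the bound at a single time is
  uniform over the unit interval.\<close>

lemma noise_exp_integral_bound:
  assumes "0 \<le> u"
    and G: "G \<in> borel_measurable (F u)" "\<And>\<omega>. \<omega> \<in> space M \<Longrightarrow> 0 \<le> G \<omega>" "\<And>\<omega>. \<omega> \<in> space M \<Longrightarrow> G \<omega> \<le> g"
  shows "(\<integral>\<^sup>+\<omega>. ennreal (G \<omega> * integral {u..u + 1} (\<lambda>s. exp (\<theta> * \<bar>noise u s \<omega>\<bar>))) \<partial>M)
    \<le> ennreal (2 * exp (\<theta>\<^sup>2 * L\<^sup>2 / 2) * (\<integral>\<omega>. G \<omega> \<partial>M))"
proof -
  define D where "D s = noise u (max u (min s (u + 1)))" for s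
  define f where "f s \<omega> = ennreal (G \<omega> * exp (\<theta> * \<bar>D s \<omega>\<bar>)) * indicator {u..u + 1} s" for s \<omega>
  have GM: "G \<in> borel_measurable M" by (rule measurable_F_M[OF G(1)])
  have "(\<lambda>(s, \<omega>). D s \<omega>) \<in> borel_measurable (borel \<Otimes>\<^sub>M M)"
  proof (rule measurable_continuous_process)
    show "D s \<in> borel_measurable M" for s
      unfolding D_def using assms(1) by (intro measurable_F_M[OF noise_measurable]) auto
    show "continuous_on UNIV (\<lambda>s. D s \<omega>)" if "\<omega> \<in> space M" for \<omega>
      unfolding D_def
      by (rule continuous_on_compose2[OF noise_continuous[OF that assms(1), of "u + 1"]])
         (auto intro!: continuous_intros)
  qed
  then have "(\<lambda>(s, \<omega>). f s \<omega>) \<in> borel_measurable (borel \<Otimes>\<^sub>M M)"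
    unfolding f_def using GM by (simp add: split_beta') measurable
  then have fm: "(\<lambda>(s, \<omega>). f s \<omega>) \<in> borel_measurable (lborel \<Otimes>\<^sub>M M)"
    by (simp add: measurable_cong_sets[OF sets_pair_measure_cong[OF sets_lborel refl] refl])
  interpret pair_sigma_finite lborel M ..
  have "(\<integral>\<^sup>+\<omega>. ennreal (G \<omega> * integral {u..u + 1} (\<lambda>s. exp (\<theta> * \<bar>noise u s \<omega>\<bar>))) \<partial>M) = (\<integral>\<^sup>+\<omega>. (\<integral>\<^sup>+s. f s \<omega> \<partial>lborel) \<partial>M)"
  proof (rule nn_integral_cong)
    fix \<omega> assume \<omega>: "\<omega> \<in> space M"
    have cont: "continuous_on {u..u + 1} (\<lambda>s. G \<omega> * exp (\<theta> * \<bar>noise u s \<omega>\<bar>))"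
      by (intro continuous_intros noise_continuous \<omega> assms(1))
    have "ennreal (G \<omega> * integral {u..u + 1} (\<lambda>s. exp (\<theta> * \<bar>noise u s \<omega>\<bar>)))
        = ennreal (integral {u..u + 1} (\<lambda>s. G \<omega> * exp (\<theta> * \<bar>noise u s \<omega>\<bar>)))"
      by simp
    also have "\<dots> = ennreal (LINT s|lborel. indicator {u..u + 1} s *\<^sub>R (G \<omega> * exp (\<theta> * \<bar>noise u s \<omega>\<bar>)))"
      unfolding integral_eq_lborel[OF cont] set_lebesgue_integral_def ..
    also have "\<dots> = (\<integral>\<^sup>+s. ennreal (indicator {u..u + 1} s *\<^sub>R (G \<omega> * exp (\<theta> * \<bar>noise u s \<omega>\<bar>))) \<partial>lborel)"
      using borel_integrable_atLeastAtMost'[OF cont] G(2)[OF \<omega>]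
      by (intro nn_integral_eq_integral[symmetric]) (auto simp: set_integrable_def)
    also have "\<dots> = (\<integral>\<^sup>+s. f s \<omega> \<partial>lborel)"
      by (intro nn_integral_cong) (auto simp: f_def D_def indicator_def)
    finally show "ennreal (G \<omega> * integral {u..u + 1} (\<lambda>s. exp (\<theta> * \<bar>noise u s \<omega>\<bar>))) = (\<integral>\<^sup>+s. f s \<omega> \<partial>lborel)" .
  qed
  also have "\<dots> = (\<integral>\<^sup>+s. (\<integral>\<^sup>+\<omega>. f s \<omega> \<partial>M) \<partial>lborel)"
    by (rule Fubini'[OF fm])
  also have "\<dots> \<le> (\<integral>\<^sup>+s. ennreal (2 * exp (\<theta>\<^sup>2 * L\<^sup>2 / 2) * (\<integral>\<omega>. G \<omega> \<partial>M)) * indicator {u..u + 1} s \<partial>lborel)"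
  proof (rule nn_integral_mono)
    fix s :: real
    show "(\<integral>\<^sup>+\<omega>. f s \<omega> \<partial>M) \<le> ennreal (2 * exp (\<theta>\<^sup>2 * L\<^sup>2 / 2) * (\<integral>\<omega>. G \<omega> \<partial>M)) * indicator {u..u + 1} s"
    proof (cases "s \<in> {u..u + 1}")
      case True
      then show ?thesis
        using noise_exp_abs_bound[OF assms(1) _ _ G, of s \<theta>] by (simp add: f_def D_def)
    qed (simp add: f_def)
  qed
  also have "\<dots> = ennreal (2 * exp (\<theta>\<^sup>2 * L\<^sup>2 / 2) * (\<integral>\<omega>. G \<omega> \<partial>M))"
    by (simp add: nn_integral_cmult_indicator)
  finally show ?thesis .
qed

end

section \<open>Errors on unit time blocks\<close>

text \<open>\<open>g * \<beta>\<close> is the observable, and \<open>\<phi>\<close> would be its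
  primitive along the noiseless flow. One constant \<open>K\<close> serves as bound of
  \<open>g\<close> and as slope of its modulus; the modulus includes the factor \<open>B\<close>
  because in the error it is multiplied by the drift.\<close>

locale sde_observable = sde_path M F W Y H \<beta> y0 L B
  for M :: "'w measure" and F W and Y H :: "real \<Rightarrow> 'w \<Rightarrow> real" and \<beta> y0 L B +
  fixes \<phi> g :: "real \<Rightarrow> real" and K \<eta> \<Phi> :: real
  assumes \<phi>: "\<And>t. (\<phi> has_real_derivative g t) (at t)" "\<And>t. \<bar>\<phi> t\<bar> \<le> \<Phi>"
    and g: "continuous_on UNIV g" "\<And>t. \<bar>g t\<bar> \<le> K" "\<And>s t. B * \<bar>g s - g t\<bar> \<le> \<eta> + K * \<bar>s - t\<bar>"
    and B_pos: "B > 0"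
begin

definition block_error :: "real \<Rightarrow> 'w \<Rightarrow> real"
  where "block_error u \<omega> = integral {u..u + 1} (\<lambda>s. g (Y s \<omega>) * \<beta> (Y s \<omega>)) - (\<phi> (Y (u + 1) \<omega>) - \<phi> (Y u \<omega>))"

lemma observable_continuous: "continuous_on UNIV (\<lambda>t. g t * \<beta> t)" "continuous_on UNIV \<phi>"
  using g(1) drift_continuous DERIV_imp_continuous_UNIV[OF \<phi>(1)] by (auto intro: continuous_intros)

lemma observable_bound: "\<bar>g t * \<beta> t\<bar> \<le> K * B"
proof -
  have "0 \<le> K" using g(2)[of 0] by linarith
  then show ?thesis
    unfolding abs_mult using g(2)[of t] drift_bound[of t] by (intro mult_mono) auto
qed

lemma integral_observable_bound:
  assumes "\<omega> \<in> space M" "0 \<le> u" "u \<le> v" "v \<le> u + 1"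
  shows "\<bar>integral {u..v} (\<lambda>s. g (Y s \<omega>) * \<beta> (Y s \<omega>))\<bar> \<le> K * B"
proof -
  have "norm (integral {u..v} (\<lambda>s. g (Y s \<omega>) * \<beta> (Y s \<omega>))) \<le> K * B * (v - u)"
    using path_continuous[OF assms(1,2) observable_continuous(1)] observable_bound assms(3)
    by (intro integral_bound) auto
  also have "\<dots> \<le> K * B * 1"
    using assms order_trans[OF abs_ge_zero observable_bound[of 0]] by (intro mult_left_mono) auto
  finally show ?thesis by simp
qed

text \<open>This crude bound makes exponentials of finitely many block errors bounded, so that they
  are admissible weights in the moment estimates.\<close>

lemma block_error_bounded:
  assumes "\<omega> \<in> space M" "0 \<le> u"
  shows "\<bar>block_error u \<omega>\<bar> \<le> K * B + 2 * \<Phi>"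
  using integral_observable_bound[OF assms, of "u + 1"] \<phi>(2)[of "Y (u + 1) \<omega>"] \<phi>(2)[of "Y u \<omega>"]
  by (simp add: block_error_def abs_le_iff)

lemma block_error_measurable:
  assumes "0 \<le> u"
  shows "block_error u \<in> borel_measurable (F (u + 1))"
proof -
  have "Y u \<in> borel_measurable (F (u + 1))" "Y (u + 1) \<in> borel_measurable (F (u + 1))"
    using measurable_F_mono[OF Y_adapted[OF assms]] Y_adapted[of "u + 1"] assms by auto
  then show ?thesis
    unfolding block_error_def[abs_def]
    using path_integral_measurable[OF assms observable_continuous(1), of "u + 1"]
      borel_measurable_continuous_onI[OF observable_continuous(2)]
    by (intro borel_measurable_diff) (auto intro: measurable_compose)
qed

lemma block_error_noise:
  assumes "\<omega> \<in> space M" "0 \<le> u"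
  shows "\<bar>block_error u \<omega>\<bar> \<le> \<eta> + K * integral {u..u + 1} (\<lambda>s. \<bar>noise u s \<omega>\<bar>) + K * \<bar>noise u (u + 1) \<omega>\<bar>"
proof -
  have "\<bar>block_error u \<omega>\<bar> \<le> B * (\<eta> / B) * (u + 1 - u)
      + B * (K / B) * integral {u..u + 1} (\<lambda>s. \<bar>noise u s \<omega>\<bar>) + K * \<bar>noise u (u + 1) \<omega>\<bar>"
    unfolding block_error_def noise_def
  proof (rule noisy_flow_estimate[OF path_continuous[OF assms continuous_on_id] _ drift_continuous drift_bound \<phi>(1) g(1,2)])
    show "\<bar>g s - g t\<bar> \<le> \<eta> / B + K / B * \<bar>s - t\<bar>" for s t
      using g(3)[of s t] B_pos by (simp add: field_simps)
  qed simp
  then show ?thesis using B_pos by simp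
qed

text \<open>The error contains a time average of the noise and its final value. Convexity with
  weights 1/2 separates them, Jensen's inequality moves the exponential inside the average, and both
  parts obey the same exponential bound.\<close>

lemma block_error_exp_bound:
  assumes u: "0 \<le> u" and "0 \<le> \<rho>"
    and G: "G \<in> borel_measurable (F u)" "\<And>\<omega>. \<omega> \<in> space M \<Longrightarrow> 0 \<le> G \<omega>" "\<And>\<omega>. \<omega> \<in> space M \<Longrightarrow> G \<omega> \<le> g'"
  shows "(\<integral>\<^sup>+\<omega>. ennreal (G \<omega> * exp (\<rho> * \<bar>block_error u \<omega>\<bar>)) \<partial>M)
    \<le> ennreal (2 * exp (\<rho> * \<eta> + 2 * \<rho>\<^sup>2 * K\<^sup>2 * L\<^sup>2) * (\<integral>\<omega>. G \<omega> \<partial>M))"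
proof -
  \<comment> \<open>The factor 2 compensates the weights 1/2 of the convex combination.\<close>
  define \<theta> where "\<theta> = 2 * \<rho> * K"
  let ?X = "\<lambda>\<omega>. integral {u..u + 1} (\<lambda>s. exp (\<theta> * \<bar>noise u s \<omega>\<bar>))"
  have "0 \<le> K" using g(2)[of 0] by linarith
  have GM: "G \<in> borel_measurable M" by (rule measurable_F_M[OF G(1)])
  have nM: "noise u (u + 1) \<in> borel_measurable M" using u by (intro measurable_F_M[OF noise_measurable]) auto
  have XM: "?X \<in> borel_measurable M"
  proof (rule measurable_integral_process)
    show "(\<lambda>\<omega>. exp (\<theta> * \<bar>noise u s \<omega>\<bar>)) \<in> borel_measurable M" if "u \<le> s" for s
      using measurable_F_M[OF noise_measurable[OF u that]] by measurable
  qed (intro continuous_intros noise_continuous u)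
  have G0: "0 \<le> (\<integral>\<omega>. G \<omega> \<partial>M)" using G(2) by (intro integral_nonneg_AE) auto
  have "G \<omega> * exp (\<rho> * \<bar>block_error u \<omega>\<bar>)
      \<le> exp (\<rho> * \<eta>) / 2 * (G \<omega> * exp (\<theta> * \<bar>noise u (u + 1) \<omega>\<bar>) + G \<omega> * ?X \<omega>)" if \<omega>: "\<omega> \<in> space M" for \<omega>
  proof -
    let ?n = "\<bar>noise u (u + 1) \<omega>\<bar>" and ?m = "integral {u..u + 1} (\<lambda>s. \<theta> * \<bar>noise u s \<omega>\<bar>)"
    have "\<rho> * \<bar>block_error u \<omega>\<bar> \<le> \<rho> * (\<eta> + K * integral {u..u + 1} (\<lambda>s. \<bar>noise u s \<omega>\<bar>) + K * ?n)"
      using block_error_noise[OF \<omega> u] \<open>0 \<le> \<rho>\<close> by (rule mult_left_mono)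
    also have "\<dots> = \<rho> * \<eta> + ((1 - 1 / 2) * (\<theta> * ?n) + 1 / 2 * ?m)"
      by (simp add: \<theta>_def algebra_simps)
    finally have "exp (\<rho> * \<bar>block_error u \<omega>\<bar>) \<le> exp (\<rho> * \<eta>) * exp ((1 - 1 / 2) * (\<theta> * ?n) + 1 / 2 * ?m)"
      by (simp flip: exp_add)
    also have "\<dots> \<le> exp (\<rho> * \<eta>) * ((1 - 1 / 2) * exp (\<theta> * ?n) + 1 / 2 * exp ?m)"
      by (intro mult_left_mono exp_convex_split) auto
    also have "\<dots> \<le> exp (\<rho> * \<eta>) * ((1 - 1 / 2) * exp (\<theta> * ?n) + 1 / 2 * ?X \<omega>)"
      by (intro mult_left_mono add_left_mono exp_integral_le continuous_intros noise_continuous \<omega> u) auto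
    finally have "G \<omega> * exp (\<rho> * \<bar>block_error u \<omega>\<bar>)
        \<le> G \<omega> * (exp (\<rho> * \<eta>) * ((1 - 1 / 2) * exp (\<theta> * ?n) + 1 / 2 * ?X \<omega>))"
      using G(2)[OF \<omega>] by (rule mult_left_mono)
    then show ?thesis by (simp add: algebra_simps)
  qed
  moreover have "0 \<le> ?X \<omega>" if "\<omega> \<in> space M" for \<omega>
    by (intro Henstock_Kurzweil_Integration.integral_nonneg integrable_continuous_interval
        continuous_intros noise_continuous that u) auto
  ultimately have "(\<integral>\<^sup>+\<omega>. ennreal (G \<omega> * exp (\<rho> * \<bar>block_error u \<omega>\<bar>)) \<partial>M)
      \<le> (\<integral>\<^sup>+\<omega>. ennreal (exp (\<rho> * \<eta>) / 2) * (ennreal (G \<omega> * exp (\<theta> * \<bar>noise u (u + 1) \<omega>\<bar>)) + ennreal (G \<omega> * ?X \<omega>)) \<partial>M)"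
    using G(2) by (intro nn_integral_mono) (simp flip: ennreal_plus ennreal_mult')
  also have "\<dots> = ennreal (exp (\<rho> * \<eta>) / 2) * ((\<integral>\<^sup>+\<omega>. ennreal (G \<omega> * exp (\<theta> * \<bar>noise u (u + 1) \<omega>\<bar>)) \<partial>M)
      + (\<integral>\<^sup>+\<omega>. ennreal (G \<omega> * ?X \<omega>) \<partial>M))"
    using GM nM XM by (simp add: nn_integral_cmult nn_integral_add)
  also have "\<dots> \<le> ennreal (exp (\<rho> * \<eta>) / 2) * (ennreal (2 * exp (\<theta>\<^sup>2 * L\<^sup>2 / 2) * (\<integral>\<omega>. G \<omega> \<partial>M))
      + ennreal (2 * exp (\<theta>\<^sup>2 * L\<^sup>2 / 2) * (\<integral>\<omega>. G \<omega> \<partial>M)))"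
    using u by (intro mult_left_mono add_mono noise_exp_abs_bound[where g = g'] noise_exp_integral_bound[where g = g'] G) auto
  also have "\<dots> = ennreal (2 * exp (\<rho> * \<eta> + \<theta>\<^sup>2 * L\<^sup>2 / 2) * (\<integral>\<omega>. G \<omega> \<partial>M))"
    using G0 by (simp flip: ennreal_plus ennreal_mult' add: exp_add)
  also have "\<theta>\<^sup>2 * L\<^sup>2 / 2 = 2 * \<rho>\<^sup>2 * K\<^sup>2 * L\<^sup>2" by (simp add: \<theta>_def power_mult_distrib)
  finally show ?thesis .
qed

text \<open>The exponential over the first \<open>N\<close> blocks is measurable at time
  \<open>N\<close> and serves as the weight for the next block, so the bounds multiply although the
  blocks are dependent.\<close>

lemma block_errors_exp_bound:
  assumes "0 \<le> \<rho>"
  defines "E \<equiv> \<lambda>N \<omega>. exp (\<rho> * (\<Sum>i<N. \<bar>block_error (real i) \<omega>\<bar>))"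
  shows "integrable M (E N) \<and> (\<integral>\<omega>. E N \<omega> \<partial>M) \<le> (2 * exp (\<rho> * \<eta> + 2 * \<rho>\<^sup>2 * K\<^sup>2 * L\<^sup>2)) ^ N"
proof -
  have Em: "E N \<in> borel_measurable (F (real N))" for N
  proof -
    have "block_error (real i) \<in> borel_measurable (F (real N))" if "i < N" for i
      using measurable_F_mono[OF block_error_measurable[of "real i"], of "real N"] that by simp
    then show ?thesis unfolding E_def by measurable
  qed
  have Eb: "E N \<omega> \<le> exp (\<rho> * (\<Sum>i<N. K * B + 2 * \<Phi>))" if "\<omega> \<in> space M" for N \<omega>
    unfolding E_def using assms(1) that
    by (intro iffD2[OF exp_le_cancel_iff] mult_left_mono sum_mono block_error_bounded) auto
  have E0: "0 \<le> E N \<omega>" for N \<omega> by (simp add: E_def)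
  have Eint: "integrable M (E N)" for N
    using measurable_F_M[OF Em] Eb[of _ N] E0 by (intro integrable_const_bound[where B = "exp (\<rho> * (\<Sum>i<N. K * B + 2 * \<Phi>))"]) auto
  have "(\<integral>\<omega>. E N \<omega> \<partial>M) \<le> (2 * exp (\<rho> * \<eta> + 2 * \<rho>\<^sup>2 * K\<^sup>2 * L\<^sup>2)) ^ N"
  proof (induction N)
    case 0
    then show ?case by (simp add: E_def prob_space)
  next
    case (Suc N)
    let ?c = "2 * exp (\<rho> * \<eta> + 2 * \<rho>\<^sup>2 * K\<^sup>2 * L\<^sup>2)"
    have "ennreal (\<integral>\<omega>. E (Suc N) \<omega> \<partial>M) = (\<integral>\<^sup>+\<omega>. ennreal (E (Suc N) \<omega>) \<partial>M)"
      by (rule nn_integral_eq_integral[OF Eint, symmetric]) (simp add: E0)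
    also have "\<dots> = (\<integral>\<^sup>+\<omega>. ennreal (E N \<omega> * exp (\<rho> * \<bar>block_error (real N) \<omega>\<bar>)) \<partial>M)"
      by (simp add: E_def distrib_left exp_add)
    also have "\<dots> \<le> ennreal (?c * (\<integral>\<omega>. E N \<omega> \<partial>M))"
      by (intro block_error_exp_bound[where g' = "exp (\<rho> * (\<Sum>i<N. K * B + 2 * \<Phi>))"] assms(1) Em E0 Eb) auto
    finally have "(\<integral>\<omega>. E (Suc N) \<omega> \<partial>M) \<le> ?c * (\<integral>\<omega>. E N \<omega> \<partial>M)"
      using E0 by (subst (asm) ennreal_le_iff) (auto intro!: mult_nonneg_nonneg integral_nonneg_AE)
    also have "\<dots> \<le> ?c * ?c ^ N" by (intro mult_left_mono Suc) simp
    finally show ?case by simp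
  qed
  with Eint show ?thesis by simp
qed

text \<open>Markov's inequality for the exponential; the factor per block is small once
  \<open>\<rho> * (\<delta> - \<eta>)\<close> outweighs the other terms.\<close>

lemma block_errors_tail:
  assumes "0 \<le> \<rho>"
  shows "measure M {\<omega> \<in> space M. (\<Sum>i<N. \<bar>block_error (real i) \<omega>\<bar>) \<ge> \<delta> * real N}
    \<le> (2 * exp (\<rho> * \<eta> + 2 * \<rho>\<^sup>2 * K\<^sup>2 * L\<^sup>2 - \<rho> * \<delta>)) ^ N"
proof -
  define E where "E \<omega> = exp (\<rho> * (\<Sum>i<N. \<bar>block_error (real i) \<omega>\<bar>))" for \<omega>
  have E: "integrable M E" "(\<integral>\<omega>. E \<omega> \<partial>M) \<le> (2 * exp (\<rho> * \<eta> + 2 * \<rho>\<^sup>2 * K\<^sup>2 * L\<^sup>2)) ^ N"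
    using block_errors_exp_bound[OF assms, of N] by (simp_all add: E_def[abs_def])
  have bm: "block_error (real i) \<in> borel_measurable M" for i :: nat
    by (rule measurable_F_M[OF block_error_measurable]) simp
  have Sm: "{\<omega> \<in> space M. (\<Sum>i<N. \<bar>block_error (real i) \<omega>\<bar>) \<ge> \<delta> * real N} \<in> events"
    using bm by measurable
  have "measure M {\<omega> \<in> space M. (\<Sum>i<N. \<bar>block_error (real i) \<omega>\<bar>) \<ge> \<delta> * real N}
      = (\<integral>\<omega>. indicator {\<omega> \<in> space M. (\<Sum>i<N. \<bar>block_error (real i) \<omega>\<bar>) \<ge> \<delta> * real N} \<omega> \<partial>M)"
    using Sm by simp
  also have "\<dots> \<le> (\<integral>\<omega>. exp (- (\<rho> * \<delta> * real N)) * E \<omega> \<partial>M)"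
  proof (rule integral_mono)
    show "integrable M (indicat_real {\<omega> \<in> space M. (\<Sum>i<N. \<bar>block_error (real i) \<omega>\<bar>) \<ge> \<delta> * real N})"
      using Sm by (intro integrable_real_indicator) (auto simp: less_top[symmetric])
    show "integrable M (\<lambda>\<omega>. exp (- (\<rho> * \<delta> * real N)) * E \<omega>)" using E(1) by simp
    fix \<omega>
    have "1 \<le> exp (- (\<rho> * \<delta> * real N)) * E \<omega>" if "(\<Sum>i<N. \<bar>block_error (real i) \<omega>\<bar>) \<ge> \<delta> * real N"
      using mult_left_mono[OF that assms] by (simp add: E_def mult.assoc flip: exp_add)
    then show "indicat_real {\<omega> \<in> space M. (\<Sum>i<N. \<bar>block_error (real i) \<omega>\<bar>) \<ge> \<delta> * real N} \<omega> \<le> exp (- (\<rho> * \<delta> * real N)) * E \<omega>"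
      by (auto simp: indicator_def E_def)
  qed
  also have "\<dots> = exp (- (\<rho> * \<delta> * real N)) * (\<integral>\<omega>. E \<omega> \<partial>M)" by simp
  also have "\<dots> \<le> exp (- (\<rho> * \<delta> * real N)) * (2 * exp (\<rho> * \<eta> + 2 * \<rho>\<^sup>2 * K\<^sup>2 * L\<^sup>2)) ^ N"
    using E(2) by (rule mult_left_mono) simp
  also have "\<dots> = (exp (- (\<rho> * \<delta>)) * (2 * exp (\<rho> * \<eta> + 2 * \<rho>\<^sup>2 * K\<^sup>2 * L\<^sup>2))) ^ N"
    by (simp add: power_mult_distrib mult.commute[of _ "real N"] flip: exp_of_nat_mult)
  also have "exp (- (\<rho> * \<delta>)) * (2 * exp (\<rho> * \<eta> + 2 * \<rho>\<^sup>2 * K\<^sup>2 * L\<^sup>2)) = 2 * exp (\<rho> * \<eta> + 2 * \<rho>\<^sup>2 * K\<^sup>2 * L\<^sup>2 - \<rho> * \<delta>)"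
    by (simp add: exp_diff exp_minus field_simps)
  finally show ?thesis .
qed

text \<open>The increments of \<open>\<phi>\<close> over the unit blocks telescope.\<close>

lemma integral_observable_le:
  assumes \<omega>: "\<omega> \<in> space M" and T: "0 \<le> T"
  shows "\<bar>integral {0..T} (\<lambda>s. g (Y s \<omega>) * \<beta> (Y s \<omega>))\<bar>
    \<le> (\<Sum>i<nat \<lfloor>T\<rfloor>. \<bar>block_error (real i) \<omega>\<bar>) + 2 * \<Phi> + K * B"
proof -
  let ?f = "\<lambda>s. g (Y s \<omega>) * \<beta> (Y s \<omega>)"
  have int: "?f integrable_on {u..v}" if "0 \<le> u" for u v
    by (intro integrable_continuous_interval path_continuous[OF \<omega> that observable_continuous(1)])
  have blocks: "integral {0..real N} ?f = (\<Sum>i<N. block_error (real i) \<omega>) + (\<phi> (Y (real N) \<omega>) - \<phi> (Y 0 \<omega>))" for N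
  proof (induction N)
    case (Suc N)
    have "integral {0..real (Suc N)} ?f = integral {0..real N} ?f + integral {real N..real N + 1} ?f"
      using Henstock_Kurzweil_Integration.integral_combine[of 0 "real N" "real N + 1" ?f] int[of 0 "real N + 1"]
      by (simp add: add.commute)
    then show ?case using Suc by (simp add: block_error_def add.commute)
  qed simp
  let ?N = "real (nat \<lfloor>T\<rfloor>)"
  have N: "?N \<le> T" "T \<le> ?N + 1" using T by linarith+
  have "integral {0..T} ?f = integral {0..?N} ?f + integral {?N..T} ?f"
    using Henstock_Kurzweil_Integration.integral_combine[of 0 ?N T ?f] int[of 0 T] N by simp
  moreover have "\<bar>integral {?N..T} ?f\<bar> \<le> K * B" using N by (intro integral_observable_bound[OF \<omega>]) auto
  moreover have "\<bar>\<Sum>i<nat \<lfloor>T\<rfloor>. block_error (real i) \<omega>\<bar> \<le> (\<Sum>i<nat \<lfloor>T\<rfloor>. \<bar>block_error (real i) \<omega>\<bar>)" by (rule sum_abs)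
  ultimately show ?thesis
    using blocks[of "nat \<lfloor>T\<rfloor>"] \<phi>(2)[of "Y ?N \<omega>"] \<phi>(2)[of "Y 0 \<omega>"] by linarith
qed

end

section \<open>Deviations of time averages\<close>

lemma continuous_circle_bounded:
  fixes f :: "circle \<Rightarrow> real"
  assumes "continuous_on UNIV f"
  obtains B where "B > 0" "\<And>z. \<bar>f z\<bar> \<le> B"
proof -
  obtain B where B: "B > 0" "\<And>t. \<bar>f (to_circle t)\<bar> \<le> B"
    using periodic_bounded[OF periodic_lift assms[unfolded continuous_on_circle_iff]] by metis
  then have "\<bar>f z\<bar> \<le> B" for z by (metis to_circle_rep)
  with B(1) show ?thesis by (rule that)
qed

context filtered_brownian_motion
begin

lemma circle_diffusion_imp_sde_path:
  assumes X: "circle_diffusion M F W s b x X" and b: "continuous_on UNIV b" "\<And>z. \<bar>b z\<bar> \<le> B"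
    and s: "\<And>z. \<bar>s z\<bar> \<le> S"
  obtains Y y0 where "sde_path M F W Y (\<lambda>r \<omega>. s (X r \<omega>)) (\<lambda>t. b (to_circle t)) y0 S B"
    "\<And>t \<omega>. 0 \<le> t \<Longrightarrow> \<omega> \<in> space M \<Longrightarrow> X t \<omega> = to_circle (Y t \<omega>)"
proof -
  obtain Y y0 where XY: "\<And>t \<omega>. 0 \<le> t \<Longrightarrow> \<omega> \<in> space M \<Longrightarrow> X t \<omega> = to_circle (Y t \<omega>)"
    and Y: "adapted F Y" "\<And>\<omega>. \<omega> \<in> space M \<Longrightarrow> continuous_on {0..} (\<lambda>t. Y t \<omega>)"
    and eq: "\<And>t. 0 \<le> t \<Longrightarrow> \<exists>I. has_ito_integral M F W (\<lambda>r \<omega>. s (X r \<omega>)) t I \<and>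
      (AE \<omega> in M. Y t \<omega> = y0 + I \<omega> + (LINT r:{0..t}|lborel. b (X r \<omega>)))"
    using X unfolding circle_diffusion_def by blast
  have drift: "(LINT r:{0..t}|lborel. b (X r \<omega>)) = integral {0..t} (\<lambda>r. b (to_circle (Y r \<omega>)))"
    if "\<omega> \<in> space M" for t \<omega>
  proof -
    have "continuous_on {0..t} (\<lambda>r. Y r \<omega>)"
      by (rule continuous_on_subset[OF Y(2)[OF that]]) auto
    then have "continuous_on {0..t} (\<lambda>r. b (to_circle (Y r \<omega>)))"
      by (intro continuous_on_compose2[OF b(1)] continuous_on_compose2[OF continuous_on_to_circle]) auto
    then have "integral {0..t} (\<lambda>r. b (to_circle (Y r \<omega>))) = (LINT r:{0..t}|lborel. b (to_circle (Y r \<omega>)))"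
      by (rule integral_eq_lborel)
    also have "\<dots> = (LINT r:{0..t}|lborel. b (X r \<omega>))"
      by (rule set_lebesgue_integral_cong) (use XY that in auto)
    finally show ?thesis ..
  qed
  have "sde_path M F W Y (\<lambda>r \<omega>. s (X r \<omega>)) (\<lambda>t. b (to_circle t)) y0 S B"
  proof unfold_locales
    show "Y t \<in> borel_measurable (F t)" if "0 \<le> t" for t
      using Y(1) that by (simp add: adapted_def)
    show "continuous_on UNIV (\<lambda>t. b (to_circle t))" using b(1) by (simp add: continuous_on_circle_iff)
    show "\<exists>I. has_ito_integral M F W (\<lambda>r \<omega>. s (X r \<omega>)) t I \<and>
        (AE \<omega> in M. Y t \<omega> = y0 + I \<omega> + integral {0..t} (\<lambda>r. b (to_circle (Y r \<omega>))))" if "0 \<le> t" for t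
    proof -
      obtain I where I: "has_ito_integral M F W (\<lambda>r \<omega>. s (X r \<omega>)) t I"
        "AE \<omega> in M. Y t \<omega> = y0 + I \<omega> + (LINT r:{0..t}|lborel. b (X r \<omega>))"
        using eq[OF \<open>0 \<le> t\<close>] by blast
      from I(2) AE_space have "AE \<omega> in M. Y t \<omega> = y0 + I \<omega> + integral {0..t} (\<lambda>r. b (to_circle (Y r \<omega>)))"
        by eventually_elim (simp add: drift)
      with I(1) show ?thesis by blast
    qed
  qed (use Y b s in auto)
  with XY show ?thesis by (rule that[rotated])
qed

text \<open>
  The function \<open>\<phi>\<close> with \<open>b \<phi>' = c - circle_mean b c\<close> is periodic; this is where the invariant
  measure of the flow of \<open>b\<close> enters.
\<close>

theorem occupation_tail:
  assumes \<sigma>: "continuous_on UNIV \<sigma>" and b: "continuous_on UNIV b" "\<And>z. b z \<noteq> 0"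
    and c: "continuous_on UNIV c" and "\<delta> > 0"
  obtains A \<rho> T0 where "\<rho> > 0"
    "\<And>\<epsilon> x X T. \<epsilon> > 0 \<Longrightarrow> circle_diffusion M F W (\<lambda>z. sqrt \<epsilon> * \<sigma> z) b x X \<Longrightarrow> T \<ge> T0 \<Longrightarrow>
      measure M {\<omega> \<in> space M. \<delta> \<le> \<bar>integral {0..T} (\<lambda>t. c (X t \<omega>)) / T - circle_mean b c\<bar>}
        \<le> exp ((A - \<rho> / sqrt \<epsilon>) * real (nat \<lfloor>T\<rfloor>))"
proof -
  obtain B where B: "B > 0" "\<And>z. \<bar>b z\<bar> \<le> B" using continuous_circle_bounded[OF b(1)] by metis
  obtain S where S: "S > 0" "\<And>z. \<bar>\<sigma> z\<bar> \<le> S" using continuous_circle_bounded[OF \<sigma>] by metis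
  let ?m = "circle_mean b c"
  define g where "g t = (c (to_circle t) - ?m) / b (to_circle t)" for t
  have gp: "periodic g" by (simp add: periodic_def g_def)
  note lifts = b(1)[unfolded continuous_on_circle_iff] c[unfolded continuous_on_circle_iff]
  have gc: "continuous_on UNIV g" unfolding g_def using lifts b(2) by (auto intro!: continuous_intros)
  obtain \<phi> where \<phi>: "\<And>t. (\<phi> has_real_derivative g t) (at t)" using continuous_imp_antiderivative[OF gc] by metis
  have "\<phi> 1 = \<phi> 0"
  proof -
    have conts: "continuous_on UNIV (\<lambda>t. 1 / b (to_circle t))" "continuous_on UNIV (\<lambda>t. c (to_circle t) / b (to_circle t))"
      using lifts b(2) by (auto intro!: continuous_intros)
    then have int: "(\<lambda>t. 1 / b (to_circle t)) integrable_on {0..1}" "(\<lambda>t. c (to_circle t) / b (to_circle t)) integrable_on {0..1}"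
      by (auto intro!: integrable_continuous_interval intro: continuous_on_subset)
    have "integral {0..1} (\<lambda>t. 1 / b (to_circle t)) \<noteq> 0"
      using conts(1) b(2) by (intro integral_nonvanishing periodic_lift[of "\<lambda>z. 1 / b z"]) auto
    then have "integral {0..1} (\<lambda>t. c (to_circle t) / b (to_circle t)) - ?m * integral {0..1} (\<lambda>t. 1 / b (to_circle t)) = 0"
      by (simp add: circle_mean_def)
    moreover have "((\<lambda>t. c (to_circle t) / b (to_circle t) - ?m * (1 / b (to_circle t))) has_integral
        integral {0..1} (\<lambda>t. c (to_circle t) / b (to_circle t)) - ?m * integral {0..1} (\<lambda>t. 1 / b (to_circle t))) {0..1}"
      by (intro has_integral_diff has_integral_mult_right integrable_integral int)
    moreover have "(\<lambda>t. c (to_circle t) / b (to_circle t) - ?m * (1 / b (to_circle t))) = g"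
      by (auto simp: g_def diff_divide_distrib)
    ultimately have "(g has_integral 0) {0..1}" by simp
    moreover have "(g has_integral \<phi> 1 - \<phi> 0) {0..1}" by (rule has_integral_of_derivative[OF _ \<phi>]) simp
    ultimately have "0 = \<phi> 1 - \<phi> 0" by (rule has_integral_unique)
    then show ?thesis by simp
  qed
  from antiderivative_periodic[OF gp \<phi> this] have \<phi>p: "periodic \<phi>" .
  obtain \<Phi> where \<Phi>: "\<And>t. \<bar>\<phi> t\<bar> \<le> \<Phi>"
    using periodic_bounded[OF \<phi>p DERIV_imp_continuous_UNIV[OF \<phi>]] by metis
  obtain K1 where K1: "K1 > 0" "\<And>t. \<bar>g t\<bar> \<le> K1" using periodic_bounded[OF gp gc] by metis
  \<comment> \<open>After multiplication by the drift bound \<open>B\<close> this additive error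
    becomes \<open>\<delta> / 4\<close>, half of the deviation \<open>\<delta> / 2\<close> per block
    that is to be estimated.\<close>
  have eB: "\<delta> / 4 / B > 0" using B(1) \<open>\<delta> > 0\<close> by simp
  obtain C where C: "C > 0" "\<And>s t. \<bar>g s - g t\<bar> \<le> \<delta> / 4 / B + C * \<bar>s - t\<bar>"
    by (rule periodic_Lipschitz_up_to[OF gp gc eB]) (rule that; assumption)
  define K where "K = max K1 (B * C)"
  have gK: "\<bar>g t\<bar> \<le> K" for t using K1(2)[of t] by (simp add: K_def)
  have modulus: "B * \<bar>g s - g t\<bar> \<le> \<delta> / 4 + K * \<bar>s - t\<bar>" for s t
  proof -
    have "B * \<bar>g s - g t\<bar> \<le> B * (\<delta> / 4 / B + C * \<bar>s - t\<bar>)" using C(2) B(1) by (intro mult_left_mono) auto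
    also have "\<dots> = \<delta> / 4 + B * C * \<bar>s - t\<bar>" using B(1) by (simp add: field_simps)
    also have "\<dots> \<le> \<delta> / 4 + K * \<bar>s - t\<bar>" by (intro add_left_mono mult_right_mono) (auto simp: K_def)
    finally show ?thesis .
  qed
  have "0 \<le> \<Phi>" using \<Phi>[of 0] by linarith
  have "0 < K" using K1 by (simp add: K_def less_max_iff_disj)
  \<comment> \<open>From this time on the boundary terms \<open>2 * \<Phi> + K * B\<close> account
    for at most \<open>\<delta> / 2 * T\<close>, which leaves the other half to the blocks.\<close>
  define T0 where "T0 = 2 * (2 * \<Phi> + K * B) / \<delta>"
  have "T0 > 0" using \<open>0 \<le> \<Phi>\<close> \<open>0 < K\<close> B(1) \<open>\<delta> > 0\<close> by (auto simp: T0_def intro!: divide_pos_pos add_nonneg_pos)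
  show ?thesis
  proof (rule that[of "\<delta> / 4" T0 "ln 2 + 2 * K\<^sup>2 * S\<^sup>2"])
    show "\<delta> / 4 > 0" using \<open>\<delta> > 0\<close> by simp
    fix \<epsilon> x X T
    assume \<epsilon>: "\<epsilon> > 0" and X: "circle_diffusion M F W (\<lambda>z. sqrt \<epsilon> * \<sigma> z) b x X" and T: "T \<ge> T0"
    have "\<bar>sqrt \<epsilon> * \<sigma> z\<bar> \<le> sqrt \<epsilon> * S" for z
      unfolding abs_mult using S(2) \<epsilon> by (simp add: mult_left_mono)
    from circle_diffusion_imp_sde_path[OF X b(1) B(2) this] obtain Y y0
      where sde: "sde_path M F W Y (\<lambda>r \<omega>. sqrt \<epsilon> * \<sigma> (X r \<omega>)) (\<lambda>t. b (to_circle t)) y0 (sqrt \<epsilon> * S) B"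
      and XY: "\<And>t \<omega>. 0 \<le> t \<Longrightarrow> \<omega> \<in> space M \<Longrightarrow> X t \<omega> = to_circle (Y t \<omega>)"
      by metis
    interpret sde_path M F W Y "\<lambda>r \<omega>. sqrt \<epsilon> * \<sigma> (X r \<omega>)" "\<lambda>t. b (to_circle t)" y0 "sqrt \<epsilon> * S" B
      by (rule sde)
    interpret sde_observable M F W Y "\<lambda>r \<omega>. sqrt \<epsilon> * \<sigma> (X r \<omega>)" "\<lambda>t. b (to_circle t)" y0 "sqrt \<epsilon> * S" B
        \<phi> g K "\<delta> / 4" \<Phi>
      by unfold_locales (fact \<phi> \<Phi> gc gK modulus B(1))+
    let ?N = "nat \<lfloor>T\<rfloor>"
    let ?E = "{\<omega> \<in> space M. \<delta> / 2 * real ?N \<le> (\<Sum>i<?N. \<bar>block_error (real i) \<omega>\<bar>)}"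
    have "T > 0" using T \<open>T0 > 0\<close> by simp
    have sub: "{\<omega> \<in> space M. \<delta> \<le> \<bar>integral {0..T} (\<lambda>t. c (X t \<omega>)) / T - ?m\<bar>} \<subseteq> ?E"
    proof safe
      fix \<omega> assume \<omega>: "\<omega> \<in> space M" and large: "\<delta> \<le> \<bar>integral {0..T} (\<lambda>t. c (X t \<omega>)) / T - ?m\<bar>"
      have cY: "(\<lambda>t. c (to_circle (Y t \<omega>))) integrable_on {0..T}"
        using path_continuous[OF \<omega> order_refl lifts(2)] by (rule integrable_continuous_interval)
      have "integral {0..T} (\<lambda>t. g (Y t \<omega>) * b (to_circle (Y t \<omega>))) = integral {0..T} (\<lambda>t. c (to_circle (Y t \<omega>)) - ?m)"
        using b(2) by (simp add: g_def)
      also have "\<dots> = integral {0..T} (\<lambda>t. c (to_circle (Y t \<omega>))) - ?m * T"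
        using Henstock_Kurzweil_Integration.integral_diff[OF cY integrable_const_ivl[of ?m 0 T]] \<open>T > 0\<close> by simp
      also have "integral {0..T} (\<lambda>t. c (to_circle (Y t \<omega>))) = integral {0..T} (\<lambda>t. c (X t \<omega>))"
        using XY \<omega> by (intro integral_cong) auto
      finally have "\<bar>integral {0..T} (\<lambda>t. g (Y t \<omega>) * b (to_circle (Y t \<omega>)))\<bar>
          = \<bar>integral {0..T} (\<lambda>t. c (X t \<omega>)) / T - ?m\<bar> * T"
        using \<open>T > 0\<close> by (simp add: abs_mult_pos left_diff_distrib)
      moreover have "\<delta> * T \<le> \<bar>integral {0..T} (\<lambda>t. c (X t \<omega>)) / T - ?m\<bar> * T"
        using large \<open>T > 0\<close> by (intro mult_right_mono) auto
      moreover have "\<delta> / 2 * T0 = 2 * \<Phi> + K * B" using \<open>\<delta> > 0\<close> by (simp add: T0_def)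
      moreover have "\<delta> / 2 * T0 \<le> \<delta> / 2 * T" using T \<open>\<delta> > 0\<close> by (intro mult_left_mono) auto
      ultimately have "\<delta> / 2 * T \<le> (\<Sum>i<?N. \<bar>block_error (real i) \<omega>\<bar>)"
        using integral_observable_le[OF \<omega> less_imp_le[OF \<open>T > 0\<close>]] by linarith
      moreover have "real ?N \<le> T" using \<open>T > 0\<close> by linarith
      then have "\<delta> / 2 * real ?N \<le> \<delta> / 2 * T" using \<open>\<delta> > 0\<close> by (intro mult_left_mono) auto
      ultimately show "\<delta> / 2 * real ?N \<le> (\<Sum>i<?N. \<bar>block_error (real i) \<omega>\<bar>)" by linarith
    qed
    have "?E \<in> events"
    proof -
      have "block_error (real i) \<in> borel_measurable M" for i :: nat
        by (rule measurable_F_M[OF block_error_measurable]) simp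
      then show ?thesis by measurable
    qed
    with sub have "measure M {\<omega> \<in> space M. \<delta> \<le> \<bar>integral {0..T} (\<lambda>t. c (X t \<omega>)) / T - ?m\<bar>} \<le> measure M ?E"
      by (intro finite_measure_mono)
    \<comment> \<open>With parameter \<open>1 / sqrt \<epsilon>\<close> the factor
      \<open>\<epsilon>\<close> from the squared diffusion bound cancels. Of the deviation
      \<open>\<delta> / 2\<close> the modulus consumes \<open>\<delta> / 4\<close>, and the rest
      gives the rate; the factor 2 per block turns into \<open>ln 2\<close>.\<close>
    also have "\<dots> \<le> (2 * exp (1 / sqrt \<epsilon> * (\<delta> / 4) + 2 * (1 / sqrt \<epsilon>)\<^sup>2 * K\<^sup>2 * (sqrt \<epsilon> * S)\<^sup>2 - 1 / sqrt \<epsilon> * (\<delta> / 2))) ^ ?N"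
      by (rule block_errors_tail) (use \<epsilon> in simp)
    also have "1 / sqrt \<epsilon> * (\<delta> / 4) + 2 * (1 / sqrt \<epsilon>)\<^sup>2 * K\<^sup>2 * (sqrt \<epsilon> * S)\<^sup>2 - 1 / sqrt \<epsilon> * (\<delta> / 2)
        = 2 * K\<^sup>2 * S\<^sup>2 - \<delta> / 4 / sqrt \<epsilon>"
      using \<epsilon> by (simp add: power_divide power_mult_distrib field_simps)
    also have "2 * exp (2 * K\<^sup>2 * S\<^sup>2 - \<delta> / 4 / sqrt \<epsilon>) = exp (ln 2 + 2 * K\<^sup>2 * S\<^sup>2 - \<delta> / 4 / sqrt \<epsilon>)"
      by (simp add: add_diff_eq[symmetric] exp_add)
    also have "\<dots> ^ ?N = exp ((ln 2 + 2 * K\<^sup>2 * S\<^sup>2 - \<delta> / 4 / sqrt \<epsilon>) * real ?N)"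
      by (simp add: exp_of_nat_mult mult.commute[of _ "real ?N"])
    finally show "measure M {\<omega> \<in> space M. \<delta> \<le> \<bar>integral {0..T} (\<lambda>t. c (X t \<omega>)) / T - ?m\<bar>}
        \<le> exp ((ln 2 + 2 * K\<^sup>2 * S\<^sup>2 - \<delta> / 4 / sqrt \<epsilon>) * real ?N)" .
  qed
qed

end

section \<open>The weak topology and empirical measures\<close>

lemma scale_measure_eq_density: "scale_measure r N = density N (\<lambda>_. r)"
  by (rule measure_eqI) (simp_all add: emeasure_density_const)

lemma path_measurable:
  assumes "continuous_on {0..T} y" "\<And>t. t \<in> {0..T} \<Longrightarrow> p t = to_circle (y t)"
  shows "p \<in> restrict_space lborel {0..T} \<rightarrow>\<^sub>M borel"
proof -
  have "continuous_on {0..T} (\<lambda>t. to_circle (y t))"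
    using continuous_on_compose2[OF continuous_on_to_circle assms(1) subset_UNIV] .
  then have "continuous_on {0..T} p"
    using assms(2) by (subst continuous_on_cong[OF refl]) auto
  then have "p \<in> restrict_space borel {0..T} \<rightarrow>\<^sub>M borel" by (rule borel_measurable_continuous_on_restrict)
  then show ?thesis
    by (simp cong: measurable_cong_sets add: measurable_cong_sets[OF sets_restrict_space_cong[OF sets_lborel] refl])
qed

lemma
  fixes f :: "circle \<Rightarrow> real"
  assumes "T > 0" and p: "p \<in> restrict_space lborel {0..T} \<rightarrow>\<^sub>M borel"
  shows empirical_measure_prob: "empirical_measure p T \<in> circle_prob_measures"
    and integral_empirical_measure: "f \<in> borel_measurable borel \<Longrightarrow>
      integral\<^sup>L (empirical_measure p T) f = (LINT t:{0..T}|lborel. f (p t)) / T"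
proof -
  let ?N = "scale_measure (ennreal (1 / T)) (restrict_space lborel {0..T})"
  have pN: "p \<in> ?N \<rightarrow>\<^sub>M borel"
    using p by (simp add: measurable_cong_sets[OF sets_scale_measure refl])
  have "emeasure ?N (space ?N) = ennreal (1 / T) * ennreal T"
    using assms(1) by (simp add: space_scale_measure emeasure_restrict_space space_restrict_space)
  also have "\<dots> = 1" using assms(1) by (simp flip: ennreal_mult)
  finally have "prob_space ?N" by (rule prob_spaceI)
  then show "empirical_measure p T \<in> circle_prob_measures"
    unfolding empirical_measure_def circle_prob_measures_def
    using prob_space.prob_space_distr[OF _ pN] by simp
  assume f: "f \<in> borel_measurable borel"
  have fp: "(\<lambda>t. f (p t)) \<in> borel_measurable (restrict_space lborel {0..T})"
    by (rule measurable_compose[OF p f])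
  have "integral\<^sup>L (empirical_measure p T) f = integral\<^sup>L ?N (\<lambda>t. f (p t))"
    unfolding empirical_measure_def by (rule integral_distr[OF pN f])
  also have "\<dots> = (LINT t|restrict_space lborel {0..T}. (1 / T) *\<^sub>R f (p t))"
    unfolding scale_measure_eq_density using assms(1) by (intro integral_density fp) auto
  also have "\<dots> = (LINT t|restrict_space lborel {0..T}. f (p t)) / T" by simp
  also have "(LINT t|restrict_space lborel {0..T}. f (p t)) = (LINT t:{0..T}|lborel. f (p t))"
    by (simp add: integral_restrict_space set_lebesgue_integral_def)
  finally show "integral\<^sup>L (empirical_measure p T) f = (LINT t:{0..T}|lborel. f (p t)) / T" .
qed

lemma topspace_weak_topology: "topspace weak_topology = circle_prob_measures"
proof -
  have "circle_prob_measures \<in> {{\<mu> \<in> circle_prob_measures. integral\<^sup>L \<mu> c \<in> U} | (c :: circle \<Rightarrow> real) (U :: real set).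
       continuous_on UNIV c \<and> open U}"
    by (intro CollectI exI[of _ "\<lambda>_. 0"] exI[of _ UNIV]) auto
  then show ?thesis unfolding weak_topology_def topology_generated_by_topspace by blast
qed

definition weak_ball :: "(circle \<Rightarrow> real) set \<Rightarrow> real \<Rightarrow> circle measure \<Rightarrow> circle measure set"
  where "weak_ball C \<delta> \<mu> = {\<nu> \<in> circle_prob_measures. \<forall>c\<in>C. \<bar>integral\<^sup>L \<nu> c - integral\<^sup>L \<mu> c\<bar> < \<delta>}"

text \<open>Induction over the generation of the topology from its subbasis: an intersection merges
  the two finite families and takes the smaller radius.\<close>

lemma weak_topology_neighbourhood:
  assumes "openin weak_topology G" "\<mu> \<in> G"
  obtains C \<delta> where "finite C" "\<And>c. c \<in> C \<Longrightarrow> continuous_on UNIV c" "\<delta> > 0" "weak_ball C \<delta> \<mu> \<subseteq> G"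
proof -
  let ?S = "{{\<mu> \<in> circle_prob_measures. integral\<^sup>L \<mu> c \<in> U} | (c :: circle \<Rightarrow> real) (U :: real set).
       continuous_on UNIV c \<and> open U}"
  have "generate_topology_on ?S G"
    using assms(1) unfolding weak_topology_def by (simp only: openin_topology_generated_by_iff)
  then have "\<exists>C \<delta>. finite C \<and> (\<forall>c\<in>C. continuous_on UNIV c) \<and> \<delta> > 0 \<and> weak_ball C \<delta> \<mu> \<subseteq> G"
    using assms(2)
  proof (induction rule: generate_topology_on.induct)
    case (Int a b)
    from Int.prems have "\<mu> \<in> a" "\<mu> \<in> b" by auto
    from Int.IH(1)[OF this(1)] Int.IH(2)[OF this(2)]
    obtain C D \<delta> \<eta> where "finite C" "\<forall>c\<in>C. continuous_on UNIV c" "\<delta> > 0" "weak_ball C \<delta> \<mu> \<subseteq> a"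
      "finite D" "\<forall>c\<in>D. continuous_on UNIV c" "\<eta> > 0" "weak_ball D \<eta> \<mu> \<subseteq> b" by auto
    moreover have "weak_ball (C \<union> D) (min \<delta> \<eta>) \<mu> \<subseteq> weak_ball C \<delta> \<mu> \<inter> weak_ball D \<eta> \<mu>"
      by (auto simp: weak_ball_def)
    ultimately show ?case by (intro exI[of _ "C \<union> D"] exI[of _ "min \<delta> \<eta>"]) auto
  next
    case (UN K)
    then obtain k where "k \<in> K" "\<mu> \<in> k" by blast
    with UN.IH[OF this] show ?case by (meson Union_upper order_trans)
  next
    case (Basis s)
    then obtain c U where c: "s = {\<mu> \<in> circle_prob_measures. integral\<^sup>L \<mu> c \<in> U}"
      "continuous_on UNIV (c :: circle \<Rightarrow> real)" "open U" by blast
    then have "integral\<^sup>L \<mu> c \<in> U" using Basis.prems by simp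
    with c(3) obtain e where "e > 0" "\<And>x. dist x (integral\<^sup>L \<mu> c) < e \<Longrightarrow> x \<in> U"
      unfolding open_dist by blast
    with c show ?case
      by (intro exI[of _ "{c}"] exI[of _ e]) (auto simp: dist_real_def weak_ball_def)
  qed simp
  then show ?thesis using that by blast
qed

text \<open>
  The events \<open>empirical_measure \<in> G\<close> are measurable because a weakly open set is a countable
  union of sets that are given by rational conditions on the masses of finitely many arcs.
\<close>

definition angle :: "circle \<Rightarrow> real"
  where "angle z = frac (rep_circle z)"

lemma angle_to_circle: "angle (to_circle t) = frac t"
  unfolding angle_def by (rule periodic_rep_circle) (simp add: periodic_def frac_1_eq)

lemma to_circle_angle [simp]: "to_circle (angle z) = z"
proof -
  have "to_circle (frac (rep_circle z)) = to_circle (rep_circle z)"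
    by (rule periodic_mod_1) (simp add: periodic_def)
  then show ?thesis by (simp add: angle_def)
qed

text \<open>\<open>angle\<close> is discontinuous only at the base point, where it drops to 0; hence
  for \<open>\<alpha> \<ge> 0\<close> the set where it exceeds \<open>\<alpha>\<close> is
  open.\<close>

lemma measurable_angle [measurable]: "angle \<in> borel_measurable borel"
  unfolding borel_measurable_iff_greater
proof
  fix \<alpha> :: real
  show "{z \<in> space borel. \<alpha> < angle z} \<in> sets borel"
  proof (cases "\<alpha> < 0")
    case True
    then have "{z \<in> space borel. \<alpha> < angle z} = UNIV" by (auto simp: angle_def intro: less_le_trans)
    then show ?thesis by simp
  next
    case False
    have "to_circle -` {z. \<alpha> < angle z} = (\<Union>n::int. {of_int n + \<alpha><..<of_int n + 1})"
    proof (intro set_eqI iffI)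
      fix t assume "t \<in> to_circle -` {z. \<alpha> < angle z}"
      then have "\<alpha> < frac t" by (simp add: angle_to_circle)
      then have "t \<in> {of_int \<lfloor>t\<rfloor> + \<alpha><..<of_int \<lfloor>t\<rfloor> + 1}" by (simp add: frac_def)
      then show "t \<in> (\<Union>n::int. {of_int n + \<alpha><..<of_int n + 1})" by blast
    next
      fix t assume "t \<in> (\<Union>n::int. {of_int n + \<alpha><..<of_int n + 1})"
      then obtain n :: int where n: "of_int n + \<alpha> < t" "t < of_int n + 1" by auto
      then have "\<lfloor>t\<rfloor> = n" using False by linarith
      with n show "t \<in> to_circle -` {z. \<alpha> < angle z}" by (simp add: angle_to_circle frac_def)
    qed
    then have "open {z. \<alpha> < angle z}" unfolding open_circle_def by auto
    then show ?thesis by simp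
  qed
qed

text \<open>For \<open>i < n\<close> these are the half-open arcs from \<open>i / n\<close> to
  \<open>(i + 1) / n\<close>, which partition the circle.\<close>

definition arc :: "nat \<Rightarrow> nat \<Rightarrow> circle set"
  where "arc n i = {z. \<lfloor>real n * angle z\<rfloor> = int i}"

lemma arc_sets [measurable]: "arc n i \<in> sets borel"
proof -
  have "arc n i = {z \<in> space borel. \<lfloor>real n * angle z\<rfloor> = int i}" by (simp add: arc_def)
  also have "\<dots> \<in> sets borel" by measurable
  finally show ?thesis .
qed

lemma integrable_circle:
  fixes f :: "circle \<Rightarrow> real"
  assumes \<mu>: "\<mu> \<in> circle_prob_measures" and f: "f \<in> borel_measurable borel" "\<And>z. \<bar>f z\<bar> \<le> B"
  shows "integrable \<mu> f"
proof -
  interpret prob_space \<mu> using \<mu> by (simp add: circle_prob_measures_def)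
  show ?thesis
  proof (rule integrable_const_bound[of _ B])
    show "f \<in> borel_measurable \<mu>"
      using f(1) \<mu> by (simp add: circle_prob_measures_def cong: measurable_cong_sets)
  qed (use f(2) in simp)
qed

text \<open>A Riemann sum with the value at the left end of each arc. The error is the oscillation
  of \<open>c\<close> over an arc and thus the same for every \<open>\<mu>\<close>.\<close>

lemma integral_arcs_approximation:
  fixes c :: "circle \<Rightarrow> real"
  assumes \<mu>: "\<mu> \<in> circle_prob_measures" and c: "continuous_on UNIV c" and "n > 0"
    and d: "\<And>s t. \<bar>s - t\<bar> \<le> 1 / real n \<Longrightarrow> \<bar>c (to_circle s) - c (to_circle t)\<bar> \<le> e"
  shows "\<bar>integral\<^sup>L \<mu> c - (\<Sum>i<n. c (to_circle (real i / real n)) * measure \<mu> (arc n i))\<bar> \<le> e"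
proof -
  interpret prob_space \<mu> using \<mu> by (simp add: circle_prob_measures_def)
  define h where "h z = (\<Sum>i<n. c (to_circle (real i / real n)) * indicator (arc n i) z)" for z
  have arcs: "arc n i \<in> sets \<mu>" for i using \<mu> by (simp add: circle_prob_measures_def)
  have close: "\<bar>c z - h z\<bar> \<le> e" for z
  proof -
    have *: "0 \<le> real n * angle z" "real n * angle z < real n * 1"
      unfolding angle_def using \<open>n > 0\<close> by (auto intro: frac_lt_1)
    define j where "j = nat \<lfloor>real n * angle z\<rfloor>"
    have j: "j < n" "\<lfloor>real n * angle z\<rfloor> = int j" using * unfolding j_def by linarith+
    have "h z = (\<Sum>i<n. if i = j then c (to_circle (real i / real n)) else 0)"
      unfolding h_def using j by (intro sum.cong) (auto simp: arc_def indicator_def)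
    also have "\<dots> = c (to_circle (real j / real n))" using j by simp
    finally have "h z = c (to_circle (real j / real n))" .
    moreover have "\<bar>angle z - real j / real n\<bar> \<le> 1 / real n"
    proof -
      have "real j \<le> real n * angle z" "real n * angle z \<le> real j + 1" using j(2) by linarith+
      then have "\<bar>real n * angle z - real j\<bar> / real n \<le> 1 / real n" by (intro divide_right_mono) auto
      then show ?thesis using \<open>n > 0\<close> by (simp add: abs_div_pos diff_divide_distrib)
    qed
    ultimately show ?thesis using d[of "angle z" "real j / real n"] by simp
  qed
  obtain B where B: "\<And>z. \<bar>c z\<bar> \<le> B" using continuous_circle_bounded[OF c] by metis
  have ci: "integrable \<mu> c" using borel_measurable_continuous_onI[OF c] B by (rule integrable_circle[OF \<mu>])
  have hi: "integrable \<mu> h" unfolding h_def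
    using arcs by (intro Bochner_Integration.integrable_sum integrable_mult_right integrable_real_indicator) (auto simp: less_top[symmetric])
  have "integral\<^sup>L \<mu> h = (\<Sum>i<n. c (to_circle (real i / real n)) * measure \<mu> (arc n i))"
    unfolding h_def using arcs by (subst Bochner_Integration.integral_sum) (auto simp: less_top[symmetric])
  moreover have "\<bar>integral\<^sup>L \<mu> c - integral\<^sup>L \<mu> h\<bar> \<le> e"
  proof -
    have "\<bar>integral\<^sup>L \<mu> (\<lambda>z. c z - h z)\<bar> \<le> integral\<^sup>L \<mu> (\<lambda>z. \<bar>c z - h z\<bar>)" by (rule integral_abs_bound)
    also have "\<dots> \<le> integral\<^sup>L \<mu> (\<lambda>z. e)" using ci hi close by (intro integral_mono) auto
    also have "\<dots> = e" by (simp add: prob_space)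
    finally show ?thesis using ci hi by simp
  qed
  ultimately show ?thesis by simp
qed

text \<open>The length of the list gives the number of arcs and its entries the approximate masses,
  so the index type is countable. The boxes are in general not weakly open, since masses of arcs are
  not weakly continuous.\<close>

definition arc_box :: "rat list \<times> nat \<Rightarrow> circle measure set"
  where "arc_box = (\<lambda>(q, m). {\<nu> \<in> circle_prob_measures.
    \<forall>i<length q. \<bar>measure \<nu> (arc (length q) i) - real_of_rat (q ! i)\<bar> < 1 / real (Suc m)})"

lemma weak_topology_arc_box:
  assumes G: "openin weak_topology G" and \<mu>: "\<mu> \<in> G"
  obtains p where "\<mu> \<in> arc_box p" "arc_box p \<subseteq> G"
proof -
  have \<mu>P: "\<mu> \<in> circle_prob_measures"
    using openin_subset[OF G] \<mu> by (auto simp: topspace_weak_topology)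
  obtain C \<delta> where C: "finite C" "\<And>c. c \<in> C \<Longrightarrow> continuous_on UNIV c" and "\<delta> > 0"
    and CG: "weak_ball C \<delta> \<mu> \<subseteq> G"
    using weak_topology_neighbourhood[OF G \<mu>] by blast
  have "\<exists>B. \<forall>z. \<bar>c z\<bar> \<le> B" if "c \<in> C" for c
    using continuous_circle_bounded[OF C(2)[OF that]] by metis
  then obtain B where B: "\<And>c z. c \<in> C \<Longrightarrow> \<bar>c z\<bar> \<le> B c" by metis
  define K where "K = Max (insert 1 (B ` C))"
  have K: "\<bar>c z\<bar> \<le> K" if "c \<in> C" for c z
  proof -
    have "B c \<le> K" unfolding K_def using C(1) that by (intro Max_ge) auto
    then show ?thesis using B[OF that, of z] by linarith
  qed
  have "K > 0"
  proof -
    have "1 \<le> K" unfolding K_def using C(1) by (intro Max_ge) auto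
    then show ?thesis by simp
  qed
  have "\<exists>d>0. \<forall>s t. \<bar>s - t\<bar> < d \<longrightarrow> \<bar>c (to_circle s) - c (to_circle t)\<bar> < \<delta> / 4" if "c \<in> C" for c
    using periodic_uniformly_continuous[OF periodic_lift C(2)[OF that, unfolded continuous_on_circle_iff], of "\<delta> / 4"]
      \<open>\<delta> > 0\<close> by (metis divide_pos_pos zero_less_numeral)
  then obtain d where d: "\<And>c. c \<in> C \<Longrightarrow> d c > 0"
    "\<And>c s t. c \<in> C \<Longrightarrow> \<bar>s - t\<bar> < d c \<Longrightarrow> \<bar>c (to_circle s) - c (to_circle t)\<bar> < \<delta> / 4" by metis
  define d0 where "d0 = Min (insert 1 (d ` C))"
  have "d0 > 0" unfolding d0_def using C(1) d(1) by (subst Min_gr_iff) auto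
  have d0: "d0 \<le> d c" if "c \<in> C" for c unfolding d0_def using C(1) that by (intro Min_le) auto
  obtain n where n: "1 / real (Suc n) < d0" using \<open>d0 > 0\<close> nat_approx_posE by blast
  let ?n = "Suc n"
  have osc: "\<bar>c (to_circle s) - c (to_circle t)\<bar> \<le> \<delta> / 4" if "c \<in> C" "\<bar>s - t\<bar> \<le> 1 / real ?n" for c s t
    using d(2)[OF that(1), of s t] d0[OF that(1)] that(2) n by simp
  \<comment> \<open>The two Riemann sums cost \<open>\<delta> / 4\<close> each. This
    \<open>m\<close> keeps the change of the sum below \<open>\<delta> / 2\<close>: there are
    \<open>?n\<close> masses with coefficients at most \<open>K\<close>, and each differs by at most
    twice \<open>1 / real (Suc m)\<close>.\<close>
  obtain m where m: "1 / real (Suc m) < \<delta> / (4 * real ?n * K)"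
    using nat_approx_posE[of "\<delta> / (4 * real ?n * K)"] \<open>\<delta> > 0\<close> \<open>K > 0\<close> by auto
  have "\<exists>r::rat. \<bar>measure \<mu> (arc ?n i) - real_of_rat r\<bar> < 1 / real (Suc m)" for i
  proof -
    obtain r where r: "measure \<mu> (arc ?n i) < real_of_rat r" "real_of_rat r < measure \<mu> (arc ?n i) + 1 / real (Suc m)"
      using of_rat_dense[of "measure \<mu> (arc ?n i)" "measure \<mu> (arc ?n i) + 1 / real (Suc m)"] by auto
    then show ?thesis by (intro exI[of _ r]) linarith
  qed
  then obtain r :: "nat \<Rightarrow> rat" where r: "\<And>i. \<bar>measure \<mu> (arc ?n i) - real_of_rat (r i)\<bar> < 1 / real (Suc m)" by metis
  let ?p = "(map r [0..<?n], m)"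
  show ?thesis
  proof (rule that[of ?p])
    show "\<mu> \<in> arc_box ?p" using r \<mu>P by (simp add: arc_box_def del: upt_Suc of_nat_Suc)
    show "arc_box ?p \<subseteq> G"
    proof
      fix \<nu> assume "\<nu> \<in> arc_box ?p"
      then have \<nu>P: "\<nu> \<in> circle_prob_measures"
        and \<nu>: "\<And>i. i < ?n \<Longrightarrow> \<bar>measure \<nu> (arc ?n i) - real_of_rat (r i)\<bar> < 1 / real (Suc m)"
        by (auto simp: arc_box_def simp del: upt_Suc of_nat_Suc)
      have "\<bar>integral\<^sup>L \<nu> c - integral\<^sup>L \<mu> c\<bar> < \<delta>" if c: "c \<in> C" for c
      proof -
        let ?a = "\<lambda>i. c (to_circle (real i / real ?n))"
        have 1: "\<bar>integral\<^sup>L \<nu> c - (\<Sum>i<?n. ?a i * measure \<nu> (arc ?n i))\<bar> \<le> \<delta> / 4"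
          by (rule integral_arcs_approximation[OF \<nu>P C(2)[OF c] zero_less_Suc osc[OF c]])
        have 2: "\<bar>integral\<^sup>L \<mu> c - (\<Sum>i<?n. ?a i * measure \<mu> (arc ?n i))\<bar> \<le> \<delta> / 4"
          by (rule integral_arcs_approximation[OF \<mu>P C(2)[OF c] zero_less_Suc osc[OF c]])
        have "\<bar>(\<Sum>i<?n. ?a i * measure \<nu> (arc ?n i)) - (\<Sum>i<?n. ?a i * measure \<mu> (arc ?n i))\<bar>
            = \<bar>\<Sum>i<?n. ?a i * (measure \<nu> (arc ?n i) - measure \<mu> (arc ?n i))\<bar>"
          by (simp only: sum_subtractf right_diff_distrib)
        also have "\<dots> \<le> (\<Sum>i<?n. K * (2 * (1 / real (Suc m))))"
        proof (rule order_trans[OF sum_abs], rule sum_mono)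
          fix i assume "i \<in> {..<?n}"
          then have "\<bar>measure \<nu> (arc ?n i) - measure \<mu> (arc ?n i)\<bar> \<le> 2 * (1 / real (Suc m))"
            using \<nu>[of i] r[of i] unfolding lessThan_iff by linarith
          then show "\<bar>?a i * (measure \<nu> (arc ?n i) - measure \<mu> (arc ?n i))\<bar> \<le> K * (2 * (1 / real (Suc m)))"
            unfolding abs_mult using K[OF c] \<open>K > 0\<close> by (intro mult_mono) auto
        qed
        also have "\<dots> = 2 * real ?n * K * (1 / real (Suc m))" by (simp del: of_nat_Suc)
        also have "\<dots> < 2 * real ?n * K * (\<delta> / (4 * real ?n * K))"
          using m \<open>K > 0\<close> by (intro mult_strict_left_mono) auto
        also have "\<dots> = \<delta> / 2" using \<open>K > 0\<close> by (simp del: of_nat_Suc)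
        finally show ?thesis using 1 2 by linarith
      qed
      with \<nu>P CG show "\<nu> \<in> G" by (auto simp: weak_ball_def)
    qed
  qed
qed

section \<open>The large deviation bounds\<close>

context filtered_brownian_motion
begin

lemma circle_diffusion_path:
  assumes X: "circle_diffusion M F W s b x X" and \<omega>: "\<omega> \<in> space M"
  shows "(\<lambda>t. X t \<omega>) \<in> restrict_space lborel {0..T} \<rightarrow>\<^sub>M borel"
    and "continuous_on UNIV c \<Longrightarrow> continuous_on {0..T} (\<lambda>t. c (X t \<omega>) :: real)"
proof -
  obtain Y where XY: "\<And>t \<omega>. 0 \<le> t \<Longrightarrow> \<omega> \<in> space M \<Longrightarrow> X t \<omega> = to_circle (Y t \<omega>)"
    and Y: "\<And>\<omega>. \<omega> \<in> space M \<Longrightarrow> continuous_on {0..} (\<lambda>t. Y t \<omega>)"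
    using X unfolding circle_diffusion_def by blast
  have cont: "continuous_on {0..T} (\<lambda>t. Y t \<omega>)" by (rule continuous_on_subset[OF Y[OF \<omega>]]) auto
  show "(\<lambda>t. X t \<omega>) \<in> restrict_space lborel {0..T} \<rightarrow>\<^sub>M borel"
    by (rule path_measurable[OF cont]) (use XY \<omega> in auto)
  assume c: "continuous_on UNIV c"
  have "continuous_on {0..T} (\<lambda>t. c (to_circle (Y t \<omega>)))"
    by (intro continuous_on_compose2[OF c] continuous_on_compose2[OF continuous_on_to_circle cont]) auto
  then show "continuous_on {0..T} (\<lambda>t. c (X t \<omega>))"
    using XY \<omega> by (subst continuous_on_cong[OF refl]) auto
qed

lemma occupation_measurable:
  fixes f :: "circle \<Rightarrow> real"
  assumes X: "circle_diffusion M F W s b x X" and f: "f \<in> borel_measurable borel"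
  shows "(\<lambda>\<omega>. LINT t:{0..T}|lborel. f (X t \<omega>)) \<in> borel_measurable M"
proof -
  obtain Y where XY: "\<And>t \<omega>. 0 \<le> t \<Longrightarrow> \<omega> \<in> space M \<Longrightarrow> X t \<omega> = to_circle (Y t \<omega>)"
    and Y: "adapted F Y" "\<And>\<omega>. \<omega> \<in> space M \<Longrightarrow> continuous_on {0..} (\<lambda>t. Y t \<omega>)"
    using X unfolding circle_diffusion_def by blast
  have "(\<lambda>(t, \<omega>). Y (max 0 t) \<omega>) \<in> borel_measurable (borel \<Otimes>\<^sub>M M)"
  proof (rule measurable_continuous_process)
    show "Y (max 0 t) \<in> borel_measurable M" for t
      using Y(1) by (intro measurable_F_M[of _ "max 0 t"]) (simp add: adapted_def)
    show "continuous_on UNIV (\<lambda>t. Y (max 0 t) \<omega>)" if "\<omega> \<in> space M" for \<omega>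
      by (rule continuous_on_compose2[OF Y(2)[OF that]]) (auto intro!: continuous_intros)
  qed
  then have "(\<lambda>x. f (to_circle ((\<lambda>(t, \<omega>). Y (max 0 t) \<omega>) x))) \<in> borel_measurable (borel \<Otimes>\<^sub>M M)"
    by (rule measurable_compose[OF measurable_compose[OF _ measurable_to_circle] f])
  then have "(\<lambda>(t, \<omega>). indicator {0..T} t *\<^sub>R f (to_circle (Y (max 0 t) \<omega>))) \<in> borel_measurable (borel \<Otimes>\<^sub>M M)"
    by (simp add: split_beta') measurable
  from measurable_pair_swap[OF this]
  have "(\<lambda>(\<omega>, t). indicator {0..T} t *\<^sub>R f (to_circle (Y (max 0 t) \<omega>))) \<in> borel_measurable (M \<Otimes>\<^sub>M lborel)"
    by (simp add: measurable_cong_sets[OF sets_pair_measure_cong[OF refl sets_lborel] refl])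
  then have "(\<lambda>\<omega>. LINT t:{0..T}|lborel. f (to_circle (Y (max 0 t) \<omega>))) \<in> borel_measurable M"
    unfolding set_lebesgue_integral_def by (rule lborel.borel_measurable_lebesgue_integral)
  moreover have "(LINT t:{0..T}|lborel. f (X t \<omega>)) = (LINT t:{0..T}|lborel. f (to_circle (Y (max 0 t) \<omega>)))"
    if "\<omega> \<in> space M" for \<omega>
    by (rule set_lebesgue_integral_cong) (use XY that in \<open>auto simp: max_def\<close>)
  ultimately show ?thesis by (simp cong: measurable_cong)
qed

lemma integral_empirical_measurable:
  fixes f :: "circle \<Rightarrow> real"
  assumes X: "circle_diffusion M F W s b x X" and "T > 0" and f: "f \<in> borel_measurable borel"
  shows "(\<lambda>\<omega>. integral\<^sup>L (empirical_measure (\<lambda>t. X t \<omega>) T) f) \<in> borel_measurable M"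
proof -
  have "(\<lambda>\<omega>. (LINT t:{0..T}|lborel. f (X t \<omega>)) / T) \<in> borel_measurable M"
    using occupation_measurable[OF X f] by (intro borel_measurable_divide) auto
  then show ?thesis
    using integral_empirical_measure[OF \<open>T > 0\<close> circle_diffusion_path(1)[OF X] f] by (simp cong: measurable_cong)
qed

text \<open>Needed for the lower bound, where the probability of an event is computed from that of
  its complement.\<close>

lemma empirical_event_measurable:
  assumes X: "circle_diffusion M F W s b x X" and "T > 0" and G: "openin weak_topology G"
  shows "{\<omega> \<in> space M. empirical_measure (\<lambda>t. X t \<omega>) T \<in> G} \<in> events"
proof -
  let ?\<mu> = "\<lambda>\<omega>. empirical_measure (\<lambda>t. X t \<omega>) T"
  have \<mu>P: "?\<mu> \<omega> \<in> circle_prob_measures" if "\<omega> \<in> space M" for \<omega>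
    by (rule empirical_measure_prob[OF \<open>T > 0\<close> circle_diffusion_path(1)[OF X that]])
  have mass: "(\<lambda>\<omega>. measure (?\<mu> \<omega>) (arc n i)) \<in> borel_measurable M" for n i
  proof -
    have "(\<lambda>\<omega>. integral\<^sup>L (?\<mu> \<omega>) (indicat_real (arc n i))) \<in> borel_measurable M"
      by (rule integral_empirical_measurable[OF X \<open>T > 0\<close>]) measurable
    moreover have "integral\<^sup>L (?\<mu> \<omega>) (indicat_real (arc n i)) = measure (?\<mu> \<omega>) (arc n i)" for \<omega>
      by (simp add: empirical_measure_def)
    ultimately show ?thesis by simp
  qed
  have box: "{\<omega> \<in> space M. ?\<mu> \<omega> \<in> arc_box p} \<in> events" for p
  proof -
    obtain q m where p: "p = (q, m)" by fastforce
    have "{\<omega> \<in> space M. ?\<mu> \<omega> \<in> arc_box p} = {\<omega> \<in> space M. \<forall>i<length q.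
        \<bar>measure (?\<mu> \<omega>) (arc (length q) i) - real_of_rat (q ! i)\<bar> < 1 / real (Suc m)}"
      using \<mu>P by (auto simp: p arc_box_def)
    also have "\<dots> \<in> events" using mass by measurable
    finally show ?thesis .
  qed
  have "{\<omega> \<in> space M. ?\<mu> \<omega> \<in> G} = (\<Union>p\<in>{p. arc_box p \<subseteq> G}. {\<omega> \<in> space M. ?\<mu> \<omega> \<in> arc_box p})"
    using weak_topology_arc_box[OF G] by blast
  also have "\<dots> \<in> events" using box by (intro sets.countable_UN') auto
  finally show ?thesis .
qed

text \<open>A union bound over \<open>C\<close> with the worst constants; the summand 1 keeps the
  prefactor positive when \<open>C\<close> is empty.\<close>

lemma empirical_deviation_bound:
  fixes C :: "(circle \<Rightarrow> real) set"
  assumes \<sigma>: "continuous_on UNIV \<sigma>" and b: "continuous_on UNIV b" "\<And>z. b z \<noteq> 0"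
    and C: "finite C" "\<And>c. c \<in> C \<Longrightarrow> continuous_on UNIV c" and "\<delta> > 0"
  obtains A \<rho> T0 where "\<rho> > 0" "T0 > 0"
    "\<And>\<epsilon> x X T. \<epsilon> > 0 \<Longrightarrow> circle_diffusion M F W (\<lambda>z. sqrt \<epsilon> * \<sigma> z) b x X \<Longrightarrow> T \<ge> T0 \<Longrightarrow>
      measure M {\<omega> \<in> space M. \<exists>c\<in>C. \<delta> \<le> \<bar>integral\<^sup>L (empirical_measure (\<lambda>t. X t \<omega>) T) c - circle_mean b c\<bar>}
        \<le> (real (card C) + 1) * exp ((A - \<rho> / sqrt \<epsilon>) * real (nat \<lfloor>T\<rfloor>))"
proof -
  define tail where "tail c A \<rho> T0 \<longleftrightarrow> (\<forall>\<epsilon> x X T. \<epsilon> > 0 \<longrightarrow>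
      circle_diffusion M F W (\<lambda>z. sqrt \<epsilon> * \<sigma> z) b x X \<longrightarrow> T \<ge> T0 \<longrightarrow>
      measure M {\<omega> \<in> space M. \<delta> \<le> \<bar>integral {0..T} (\<lambda>t. c (X t \<omega>)) / T - circle_mean b c\<bar>}
        \<le> exp ((A - \<rho> / sqrt \<epsilon>) * real (nat \<lfloor>T\<rfloor>)))" for c A \<rho> T0
  have "\<exists>A \<rho> T0. \<rho> > 0 \<and> tail c A \<rho> T0" if "c \<in> C" for c
  proof (rule occupation_tail[OF \<sigma> b C(2)[OF that] \<open>\<delta> > 0\<close>])
    fix A \<rho> T0 :: real
    assume "\<rho> > 0" and *: "\<And>\<epsilon> x X T. \<epsilon> > 0 \<Longrightarrow> circle_diffusion M F W (\<lambda>z. sqrt \<epsilon> * \<sigma> z) b x X \<Longrightarrow> T \<ge> T0 \<Longrightarrow>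
      measure M {\<omega> \<in> space M. \<delta> \<le> \<bar>integral {0..T} (\<lambda>t. c (X t \<omega>)) / T - circle_mean b c\<bar>}
        \<le> exp ((A - \<rho> / sqrt \<epsilon>) * real (nat \<lfloor>T\<rfloor>))"
    have "tail c A \<rho> T0" unfolding tail_def by (intro allI impI *)
    with \<open>\<rho> > 0\<close> show ?thesis by blast
  qed
  then obtain A \<rho> T0 where \<rho>: "\<And>c. c \<in> C \<Longrightarrow> \<rho> c > 0"
    and tail: "\<And>c. c \<in> C \<Longrightarrow> tail c (A c) (\<rho> c) (T0 c)"
    by metis
  \<comment> \<open>The inserted elements make these extrema meaningful for empty \<open>C\<close>
    and force \<open>T' > 0\<close>.\<close>
  define A' where "A' = Max (insert 0 (A ` C))"
  define \<rho>' where "\<rho>' = Min (insert 1 (\<rho> ` C))"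
  define T' where "T' = Max (insert 1 (T0 ` C))"
  have A': "A c \<le> A'" and \<rho>': "\<rho>' \<le> \<rho> c" and T': "T0 c \<le> T'" if "c \<in> C" for c
    using C(1) that by (auto simp: A'_def \<rho>'_def T'_def)
  show ?thesis
  proof (rule that[of \<rho>' T' A'])
    show "\<rho>' > 0" unfolding \<rho>'_def using C(1) \<rho> by (subst Min_gr_iff) auto
    show "T' > 0"
    proof -
      have "1 \<le> T'" unfolding T'_def using C(1) by (intro Max_ge) auto
      then show ?thesis by simp
    qed
    fix \<epsilon> x X T
    assume \<epsilon>: "\<epsilon> > 0" and X: "circle_diffusion M F W (\<lambda>z. sqrt \<epsilon> * \<sigma> z) b x X" and T: "T \<ge> T'"
    have "T > 0" using T \<open>T' > 0\<close> by simp
    let ?\<mu> = "\<lambda>\<omega>. empirical_measure (\<lambda>t. X t \<omega>) T"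
    let ?E = "\<lambda>c. {\<omega> \<in> space M. \<delta> \<le> \<bar>integral\<^sup>L (?\<mu> \<omega>) c - circle_mean b c\<bar>}"
    have E: "?E c \<in> events" if "c \<in> C" for c
      using integral_empirical_measurable[OF X \<open>T > 0\<close> borel_measurable_continuous_onI[OF C(2)[OF that]]]
      by measurable
    have "measure M (?E c) \<le> exp ((A' - \<rho>' / sqrt \<epsilon>) * real (nat \<lfloor>T\<rfloor>))" if c: "c \<in> C" for c
    proof -
      have "integral\<^sup>L (?\<mu> \<omega>) c = integral {0..T} (\<lambda>t. c (X t \<omega>)) / T" if "\<omega> \<in> space M" for \<omega>
        using integral_empirical_measure[OF \<open>T > 0\<close> circle_diffusion_path(1)[OF X that]
            borel_measurable_continuous_onI[OF C(2)[OF c]]]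
          integral_eq_lborel[OF circle_diffusion_path(2)[OF X that C(2)[OF c]]] by simp
      then have "?E c = {\<omega> \<in> space M. \<delta> \<le> \<bar>integral {0..T} (\<lambda>t. c (X t \<omega>)) / T - circle_mean b c\<bar>}"
        by auto
      then have "measure M (?E c) \<le> exp ((A c - \<rho> c / sqrt \<epsilon>) * real (nat \<lfloor>T\<rfloor>))"
        using tail[OF c, unfolded tail_def, rule_format, OF \<epsilon> X] T'[OF c] T by simp
      also have "\<dots> \<le> exp ((A' - \<rho>' / sqrt \<epsilon>) * real (nat \<lfloor>T\<rfloor>))"
        using A'[OF c] \<rho>'[OF c] \<epsilon> by (simp add: mult_right_mono diff_mono divide_right_mono)
      finally show ?thesis .
    qed
    then have sums: "(\<Sum>c\<in>C. measure M (?E c)) \<le> (\<Sum>c\<in>C. exp ((A' - \<rho>' / sqrt \<epsilon>) * real (nat \<lfloor>T\<rfloor>)))"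
      by (rule sum_mono)
    have union: "{\<omega> \<in> space M. \<exists>c\<in>C. \<delta> \<le> \<bar>integral\<^sup>L (?\<mu> \<omega>) c - circle_mean b c\<bar>} = (\<Union>c\<in>C. ?E c)"
      by auto
    have "measure M (\<Union>c\<in>C. ?E c) \<le> (\<Sum>c\<in>C. measure M (?E c))"
      using C(1) E by (intro finite_measure_subadditive_finite) auto
    moreover have "(\<Sum>c\<in>C. exp ((A' - \<rho>' / sqrt \<epsilon>) * real (nat \<lfloor>T\<rfloor>)))
        \<le> (real (card C) + 1) * exp ((A' - \<rho>' / sqrt \<epsilon>) * real (nat \<lfloor>T\<rfloor>))"
      by (simp add: distrib_right)
    ultimately show "measure M {\<omega> \<in> space M. \<exists>c\<in>C. \<delta> \<le> \<bar>integral\<^sup>L (?\<mu> \<omega>) c - circle_mean b c\<bar>}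
        \<le> (real (card C) + 1) * exp ((A' - \<rho>' / sqrt \<epsilon>) * real (nat \<lfloor>T\<rfloor>))"
      unfolding union using sums by linarith
  qed
qed

end

section \<open>The invariant measure of the flow\<close>

text \<open>Take the image under \<open>to_circle\<close> of the density \<open>1 / b\<close> on
  [0, 1], divided by its integral \<open>I\<close>; the quotient is positive for either sign of
  \<open>b\<close>.\<close>

lemma flow_invariant_measure:
  assumes b: "continuous_on UNIV b" "\<And>z. b z \<noteq> (0 :: real)"
  obtains \<mu> where "\<mu> \<in> circle_prob_measures"
    "\<And>c. continuous_on UNIV c \<Longrightarrow> integral\<^sup>L \<mu> c = circle_mean b c"
proof -
  define I where "I = integral {0..1} (\<lambda>t. 1 / b (to_circle t))"
  have cont: "continuous_on UNIV (\<lambda>t. 1 / b (to_circle t))"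
    using b unfolding continuous_on_circle_iff by (auto intro!: continuous_intros)
  have per: "periodic (\<lambda>t. 1 / b (to_circle t))" by (rule periodic_lift[of "\<lambda>z. 1 / b z"])
  have "I \<noteq> 0" unfolding I_def using b(2) by (intro integral_nonvanishing per cont) auto
  have pos: "1 / b (to_circle t) / I > 0" for t
  proof -
    have nz: "\<And>t. 1 / b (to_circle t) \<noteq> 0" using b(2) by simp
    from nonvanishing_sign[OF cont nz] show ?thesis
    proof
      assume *: "\<forall>t. 1 / b (to_circle t) > 0"
      then have "I > 0" unfolding I_def by (intro integral_pos per cont) auto
      with * show ?thesis using divide_pos_pos by blast
    next
      assume *: "\<forall>t. 1 / b (to_circle t) < 0"
      then have "integral {0..1} (\<lambda>t. - (1 / b (to_circle t))) > 0"
        using per cont by (intro integral_pos) (auto simp: periodic_def intro!: continuous_intros)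
      then have "I < 0" by (simp add: I_def)
      with * show ?thesis using divide_neg_neg by blast
    qed
  qed
  define w where "w t = indicator {0..1} t * (1 / b (to_circle t) / I)" for t
  have wm: "w \<in> borel_measurable lborel"
    unfolding w_def using borel_measurable_continuous_onI[OF cont] by measurable
  have w0: "0 \<le> w t" for t using less_imp_le[OF pos[of t]] by (simp add: w_def)
  have w_integral: "(LINT t|lborel. w t * f t) = integral {0..1} (\<lambda>t. f t / b (to_circle t)) / I"
    and w_integrable: "integrable lborel (\<lambda>t. w t * f t)"
    if f: "continuous_on UNIV f" for f :: "real \<Rightarrow> real"
  proof -
    have fb: "continuous_on {0..1} (\<lambda>t. f t / b (to_circle t))"
      by (rule continuous_on_subset[of UNIV])
         (use f b in \<open>auto simp: continuous_on_circle_iff intro!: continuous_intros\<close>)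
    have eq: "w t * f t = (indicator {0..1} t *\<^sub>R (f t / b (to_circle t))) / I" for t by (simp add: w_def)
    show "(LINT t|lborel. w t * f t) = integral {0..1} (\<lambda>t. f t / b (to_circle t)) / I"
      unfolding eq integral_eq_lborel[OF fb] set_lebesgue_integral_def by (rule integral_divide_zero)
    show "integrable lborel (\<lambda>t. w t * f t)"
      unfolding eq using borel_integrable_atLeastAtMost'[OF fb] unfolding set_integrable_def
      by (rule integrable_divide_zero)
  qed
  define \<mu> where "\<mu> = distr (density lborel (\<lambda>t. ennreal (w t))) borel to_circle"
  have tc: "to_circle \<in> density lborel (\<lambda>t. ennreal (w t)) \<rightarrow>\<^sub>M borel"
    using measurable_to_circle by (simp cong: measurable_cong_sets)
  have "(LINT t|lborel. w t) = 1"
    using w_integral[of "\<lambda>_. 1"] \<open>I \<noteq> 0\<close> by (simp add: I_def)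
  then have "emeasure (density lborel (\<lambda>t. ennreal (w t))) UNIV = 1"
    using nn_integral_eq_integral[OF w_integrable[of "\<lambda>_. 1"]] w0 wm by (simp add: emeasure_density)
  then have "prob_space (density lborel (\<lambda>t. ennreal (w t)))" by (intro prob_spaceI) simp
  then have "\<mu> \<in> circle_prob_measures"
    using prob_space.prob_space_distr[OF _ tc] by (simp add: \<mu>_def circle_prob_measures_def)
  moreover have "integral\<^sup>L \<mu> c = circle_mean b c" if c: "continuous_on UNIV c" for c
  proof -
    have cm: "c \<in> borel_measurable borel" by (rule borel_measurable_continuous_onI[OF c])
    have "integral\<^sup>L \<mu> c = (LINT t|lborel. w t *\<^sub>R c (to_circle t))"
      unfolding \<mu>_def integral_distr[OF tc cm]
      using measurable_compose[OF measurable_to_circle cm] wm w0 by (intro integral_density) auto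
    then show ?thesis
      using w_integral[OF c[unfolded continuous_on_circle_iff]] by (simp add: circle_mean_def I_def)
  qed
  ultimately show ?thesis by (rule that)
qed

section \<open>Asymptotics of logarithmic probabilities\<close>

lemma ereal_ln_le:
  assumes "0 \<le> p" "p \<le> q" "0 < q"
  shows "ereal_ln p \<le> ereal (ln q)"
  using assms by (auto simp: ereal_ln_def)

text \<open>Rounding \<open>T\<close> down loses at most one unit, which by
  \<open>\<kappa> \<le> 0\<close> amounts to a constant factor; such factors, like \<open>k\<close>,
  disappear after division by \<open>T\<close>.\<close>

lemma Limsup_ln_exp_le:
  fixes p :: "real \<Rightarrow> real"
  assumes p: "\<And>T. T \<ge> T0 \<Longrightarrow> p T \<le> k * exp (\<kappa> * real (nat \<lfloor>T\<rfloor>))" "\<And>T. 0 \<le> p T" and "k > 0" "\<kappa> \<le> 0"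
  shows "Limsup at_top (\<lambda>T. ereal (1 / T) * ereal_ln (p T)) \<le> ereal \<kappa>"
proof -
  have "ereal (1 / T) * ereal_ln (p T) \<le> ereal ((ln k - \<kappa>) / T + \<kappa>)" if T: "T \<ge> max T0 1" for T
  proof -
    have "\<kappa> * real (nat \<lfloor>T\<rfloor>) \<le> \<kappa> * (T - 1)"
      using \<open>\<kappa> \<le> 0\<close> T by (intro mult_left_mono_neg) linarith+
    then have "k * exp (\<kappa> * real (nat \<lfloor>T\<rfloor>)) \<le> k * exp (\<kappa> * (T - 1))"
      using \<open>k > 0\<close> by simp
    then have "p T \<le> k * exp (\<kappa> * (T - 1))"
      using p(1)[of T] T by (meson max.boundedE order_trans)
    then have "ereal_ln (p T) \<le> ereal (ln (k * exp (\<kappa> * (T - 1))))"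
      using p(2) \<open>k > 0\<close> by (intro ereal_ln_le) auto
    also have "ln (k * exp (\<kappa> * (T - 1))) = ln k + \<kappa> * (T - 1)" using \<open>k > 0\<close> by (simp add: ln_mult)
    finally have "ereal (1 / T) * ereal_ln (p T) \<le> ereal (1 / T) * ereal (ln k + \<kappa> * (T - 1))"
      using T by (intro ereal_mult_left_mono) auto
    also have "\<dots> = ereal ((ln k - \<kappa>) / T + \<kappa>)" using T by (simp add: field_simps)
    finally show ?thesis .
  qed
  then have "Limsup at_top (\<lambda>T. ereal (1 / T) * ereal_ln (p T)) \<le> Limsup at_top (\<lambda>T. ereal ((ln k - \<kappa>) / T + \<kappa>))"
    by (intro Limsup_mono eventually_at_top_linorderI[of "max T0 1"])
  also have "\<dots> = ereal \<kappa>"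
  proof (rule lim_imp_Limsup)
    have "((\<lambda>T. (ln k - \<kappa>) / T + \<kappa>) \<longlongrightarrow> 0 + \<kappa>) at_top"
      by (intro tendsto_add tendsto_const tendsto_divide_0[OF tendsto_const]
          filterlim_at_top_imp_at_infinity filterlim_ident)
    then show "((\<lambda>T. ereal ((ln k - \<kappa>) / T + \<kappa>)) \<longlongrightarrow> ereal \<kappa>) at_top" by (simp add: tendsto_ereal)
  qed simp
  finally show ?thesis .
qed

lemma Liminf_ln_ge_0:
  fixes p :: "real \<Rightarrow> real"
  assumes "\<forall>\<^sub>F T in at_top. r \<le> p T" "0 < r"
  shows "0 \<le> Liminf at_top (\<lambda>T. ereal (1 / T) * ereal_ln (p T))"
proof -
  have "Liminf at_top (\<lambda>T. ereal (ln r / T)) = 0"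
  proof (rule lim_imp_Liminf)
    have "((\<lambda>T. ln r / T) \<longlongrightarrow> 0) at_top"
      by (intro tendsto_divide_0[OF tendsto_const] filterlim_at_top_imp_at_infinity filterlim_ident)
    then show "((\<lambda>T. ereal (ln r / T)) \<longlongrightarrow> 0) at_top"
      unfolding zero_ereal_def by (rule tendsto_ereal)
  qed simp
  moreover have "Liminf at_top (\<lambda>T. ereal (ln r / T)) \<le> Liminf at_top (\<lambda>T. ereal (1 / T) * ereal_ln (p T))"
  proof (rule Liminf_mono)
    show "\<forall>\<^sub>F T in at_top. ereal (ln r / T) \<le> ereal (1 / T) * ereal_ln (p T)"
      using assms(1) eventually_gt_at_top[of 0]
    proof eventually_elim
      fix T :: real assume T: "r \<le> p T" "0 < T"
      then have "ln r \<le> ln (p T)" using assms(2) by simp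
      then show "ereal (ln r / T) \<le> ereal (1 / T) * ereal_ln (p T)"
        using T assms(2) by (simp add: ereal_ln_def divide_right_mono)
    qed
  qed
  ultimately show ?thesis by simp
qed

lemma eventually_rate_le:
  fixes A \<rho> B :: real
  assumes "\<rho> > 0"
  shows "\<forall>\<^sub>F \<epsilon> in at_right 0. A - \<rho> / sqrt \<epsilon> \<le> B"
proof -
  have "LIM \<epsilon> at_right 0. inverse (sqrt \<epsilon>) :> at_top"
    by (rule filterlim_inverse_at_top)
       (auto intro!: tendsto_eq_intros simp: eventually_at_right_less eventually_at_filter)
  then have "\<forall>\<^sub>F \<epsilon> in at_right 0. (A - B) / \<rho> \<le> inverse (sqrt \<epsilon>)"
    by (simp add: filterlim_at_top)
  then show ?thesis
    using assms by (auto elim!: eventually_mono simp: field_simps inverse_eq_divide)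
qed

theorem corollary6p5:
  fixes \<sigma> a b :: "circle \<Rightarrow> real"
    and x :: circle
    and M :: "'w measure"
    and F :: "real \<Rightarrow> 'w measure"
    and W :: "real \<Rightarrow> 'w \<Rightarrow> real"
    and X :: "real \<Rightarrow> real \<Rightarrow> 'w \<Rightarrow> circle"
  assumes "C2_circle \<sigma>" and "C2_circle b"
    and "\<And>z. a z = (\<sigma> z)\<^sup>2 / 2" and "\<And>z. a z > 0"
    and "\<And>z. b z \<noteq> 0"
    and "prob_space M"
    and "filtration (space M) F" and "\<And>t. subalgebra M (F t)"
    and "standard_brownian_motion M F W"
    and "\<And>\<epsilon>. \<epsilon> > 0 \<Longrightarrow> circle_diffusion M F W (\<lambda>z. sqrt \<epsilon> * \<sigma> z) b x (X \<epsilon>)"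
  shows "(\<forall>G. openin weak_topology G \<longrightarrow>
           Liminf (at_right 0) (\<lambda>\<epsilon>. Liminf at_top (\<lambda>T.
             ereal (1 / T) *
             ereal_ln (measure M {\<omega> \<in> space M. empirical_measure (\<lambda>t. X \<epsilon> t \<omega>) T \<in> G})))
           \<ge> - (INF \<mu>\<in>G. rate_function a b \<mu>)) \<and>
         (\<forall>C. closedin weak_topology C \<longrightarrow>
           Limsup (at_right 0) (\<lambda>\<epsilon>. Limsup at_top (\<lambda>T.
             ereal (1 / T) *
             ereal_ln (measure M {\<omega> \<in> space M. empirical_measure (\<lambda>t. X \<epsilon> t \<omega>) T \<in> C})))
           \<le> - (INF \<mu>\<in>C. rate_function a b \<mu>))"
proof -
  interpret filtered_brownian_motion M F W
    using assms(6-9) by (simp add: filtered_brownian_motion_def filtered_brownian_motion_axioms_def)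
  note X = assms(10)
  have \<sigma>c: "continuous_on UNIV \<sigma>" and bc: "continuous_on UNIV b"
    using assms(1,2) has_circle_derivative_continuous by (auto simp: C2_circle_def)
  obtain \<mu>0 where \<mu>0: "\<mu>0 \<in> circle_prob_measures"
    "\<And>c. continuous_on UNIV c \<Longrightarrow> integral\<^sup>L \<mu>0 c = circle_mean b c"
    using flow_invariant_measure[OF bc assms(5)] by metis
  \<comment> \<open>The limit eigenvalue of \<open>c\<close> is its integral against
    \<open>\<mu>0\<close>, so the supremum of a linear functional of \<open>c\<close> is taken,
    which is 0 or infinite.\<close>
  have rate: "rate_function a b \<mu> = (SUP c\<in>{c. continuous_on UNIV c}. ereal (integral\<^sup>L \<mu> c - integral\<^sup>L \<mu>0 c))" for \<mu>
    unfolding rate_function_def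
    using limit_eigenvalue_eq[OF assms(1-5)] \<mu>0(2) by (intro SUP_cong) auto
  have rate_nonneg: "0 \<le> rate_function a b \<mu>" for \<mu>
    unfolding rate by (rule SUP_upper2[of "\<lambda>_. 0"]) auto
  have rate_0: "rate_function a b \<mu>0 = 0"
    by (rule antisym[OF _ rate_nonneg]) (auto simp: rate intro!: SUP_least)
  have rate_top: "rate_function a b \<mu> = \<infinity>" if c: "continuous_on UNIV c" "integral\<^sup>L \<mu> c \<noteq> integral\<^sup>L \<mu>0 c"
    for \<mu> and c :: "circle \<Rightarrow> real"
  proof -
    define d where "d = integral\<^sup>L \<mu> c - integral\<^sup>L \<mu>0 c"
    have "ereal B \<le> rate_function a b \<mu>" for B
    proof -
      \<comment> \<open>Rescaling a test function that separates \<open>\<mu>\<close> from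
        \<open>\<mu>0\<close> attains the prescribed value \<open>B\<close>.\<close>
      have "continuous_on UNIV (\<lambda>z. B / d * c z)" using c(1) by (intro continuous_intros)
      moreover have "integral\<^sup>L \<mu> (\<lambda>z. B / d * c z) - integral\<^sup>L \<mu>0 (\<lambda>z. B / d * c z) = B / d * d"
        by (simp add: d_def right_diff_distrib diff_divide_distrib)
      then have "integral\<^sup>L \<mu> (\<lambda>z. B / d * c z) - integral\<^sup>L \<mu>0 (\<lambda>z. B / d * c z) = B"
        using c(2) by (simp add: d_def)
      ultimately show ?thesis unfolding rate by (intro SUP_upper2[of "\<lambda>z. B / d * c z"]) auto
    qed
    then show ?thesis by (rule ereal_top)
  qed
  \<comment> \<open>The probabilistic input of both bounds: the lower bound uses it for the open set
    itself, the upper bound for the complement of the closed set.\<close>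
  have small: "\<exists>A \<rho> T0 k. \<rho> > 0 \<and> k > 0 \<and> T0 > 0 \<and> (\<forall>\<epsilon> T. \<epsilon> > 0 \<longrightarrow> T \<ge> T0 \<longrightarrow>
      measure M {\<omega> \<in> space M. empirical_measure (\<lambda>t. X \<epsilon> t \<omega>) T \<notin> G} \<le> k * exp ((A - \<rho> / sqrt \<epsilon>) * real (nat \<lfloor>T\<rfloor>)))"
    if G: "openin weak_topology G" "\<mu>0 \<in> G" for G
  proof -
    obtain C \<delta> where C: "finite C" "\<And>c. c \<in> C \<Longrightarrow> continuous_on UNIV c" "\<delta> > 0" "weak_ball C \<delta> \<mu>0 \<subseteq> G"
      using weak_topology_neighbourhood[OF G] by metis
    obtain A \<rho> T0 where "\<rho> > 0" "T0 > 0" and bound: "\<And>\<epsilon> x X T. \<epsilon> > 0 \<Longrightarrow>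
        circle_diffusion M F W (\<lambda>z. sqrt \<epsilon> * \<sigma> z) b x X \<Longrightarrow> T \<ge> T0 \<Longrightarrow>
        measure M {\<omega> \<in> space M. \<exists>c\<in>C. \<delta> \<le> \<bar>integral\<^sup>L (empirical_measure (\<lambda>t. X t \<omega>) T) c - circle_mean b c\<bar>}
        \<le> (real (card C) + 1) * exp ((A - \<rho> / sqrt \<epsilon>) * real (nat \<lfloor>T\<rfloor>))"
      by (rule empirical_deviation_bound[OF \<sigma>c bc assms(5) C(1) _ C(3)]) (erule C(2), (rule that; assumption))
    have "measure M {\<omega> \<in> space M. empirical_measure (\<lambda>t. X \<epsilon> t \<omega>) T \<notin> G}
        \<le> (real (card C) + 1) * exp ((A - \<rho> / sqrt \<epsilon>) * real (nat \<lfloor>T\<rfloor>))" if \<epsilon>: "\<epsilon> > 0" and T: "T \<ge> T0" for \<epsilon> T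
    proof -
      have "T > 0" using T \<open>T0 > 0\<close> by simp
      let ?\<mu> = "\<lambda>\<omega>. empirical_measure (\<lambda>t. X \<epsilon> t \<omega>) T"
      let ?E = "{\<omega> \<in> space M. \<exists>c\<in>C. \<delta> \<le> \<bar>integral\<^sup>L (?\<mu> \<omega>) c - circle_mean b c\<bar>}"
      have "{\<omega> \<in> space M. ?\<mu> \<omega> \<notin> G} \<subseteq> ?E"
      proof safe
        fix \<omega> assume \<omega>: "\<omega> \<in> space M" "?\<mu> \<omega> \<notin> G"
        have "?\<mu> \<omega> \<in> circle_prob_measures"
          by (rule empirical_measure_prob[OF \<open>T > 0\<close> circle_diffusion_path(1)[OF X[OF \<epsilon>] \<omega>(1)]])
        with \<omega>(2) C(4) have "\<exists>c\<in>C. \<not> \<bar>integral\<^sup>L (?\<mu> \<omega>) c - integral\<^sup>L \<mu>0 c\<bar> < \<delta>"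
          by (auto simp: weak_ball_def)
        then show "\<exists>c\<in>C. \<delta> \<le> \<bar>integral\<^sup>L (?\<mu> \<omega>) c - circle_mean b c\<bar>"
          using \<mu>0(2) C(2) by (metis linorder_not_less)
      qed
      moreover have "?E \<in> events"
      proof -
        have "{\<omega> \<in> space M. \<delta> \<le> \<bar>integral\<^sup>L (?\<mu> \<omega>) c - circle_mean b c\<bar>} \<in> events" if "c \<in> C" for c
          using integral_empirical_measurable[OF X[OF \<epsilon>] \<open>T > 0\<close> borel_measurable_continuous_onI[OF C(2)[OF that]]]
          by measurable
        then have "(\<Union>c\<in>C. {\<omega> \<in> space M. \<delta> \<le> \<bar>integral\<^sup>L (?\<mu> \<omega>) c - circle_mean b c\<bar>}) \<in> events"
          using C(1) by (intro sets.finite_UN) auto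
        moreover have "(\<Union>c\<in>C. {\<omega> \<in> space M. \<delta> \<le> \<bar>integral\<^sup>L (?\<mu> \<omega>) c - circle_mean b c\<bar>}) = ?E" by auto
        ultimately show ?thesis by simp
      qed
      ultimately have "measure M {\<omega> \<in> space M. ?\<mu> \<omega> \<notin> G} \<le> measure M ?E" by (rule finite_measure_mono)
      also have "\<dots> \<le> (real (card C) + 1) * exp ((A - \<rho> / sqrt \<epsilon>) * real (nat \<lfloor>T\<rfloor>))"
        by (rule bound[OF \<epsilon> X[OF \<epsilon>] T])
      finally show ?thesis .
    qed
    with \<open>\<rho> > 0\<close> \<open>T0 > 0\<close> show ?thesis
      by (intro exI[of _ A] exI[of _ \<rho>] exI[of _ T0] exI[of _ "real (card C) + 1"]) auto
  qed
  show ?thesis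
  proof (intro conjI allI impI)
    fix G assume G: "openin weak_topology G"
    let ?p = "\<lambda>\<epsilon> T. measure M {\<omega> \<in> space M. empirical_measure (\<lambda>t. X \<epsilon> t \<omega>) T \<in> G}"
    show "- (INF \<mu>\<in>G. rate_function a b \<mu>)
        \<le> Liminf (at_right 0) (\<lambda>\<epsilon>. Liminf at_top (\<lambda>T. ereal (1 / T) * ereal_ln (?p \<epsilon> T)))"
    proof (cases "\<mu>0 \<in> G")
      case True
      obtain A \<rho> T0 k where "\<rho> > 0" "k > 0" "T0 > 0" and bound: "\<And>\<epsilon> T. \<epsilon> > 0 \<Longrightarrow> T \<ge> T0 \<Longrightarrow>
          measure M {\<omega> \<in> space M. empirical_measure (\<lambda>t. X \<epsilon> t \<omega>) T \<notin> G} \<le> k * exp ((A - \<rho> / sqrt \<epsilon>) * real (nat \<lfloor>T\<rfloor>))"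
        using small[OF G True] by blast
      have "0 \<le> (INF \<mu>\<in>G. rate_function a b \<mu>)" using rate_nonneg by (intro INF_greatest)
      then have "- (INF \<mu>\<in>G. rate_function a b \<mu>) \<le> 0" by simp
      also have "0 \<le> Liminf (at_right 0) (\<lambda>\<epsilon>. Liminf at_top (\<lambda>T. ereal (1 / T) * ereal_ln (?p \<epsilon> T)))"
      proof (rule Liminf_bounded)
        show "\<forall>\<^sub>F \<epsilon> in at_right 0. 0 \<le> Liminf at_top (\<lambda>T. ereal (1 / T) * ereal_ln (?p \<epsilon> T))"
          using eventually_rate_le[OF \<open>\<rho> > 0\<close>, of A "-1"] eventually_at_right_less[of 0]
        proof eventually_elim
          fix \<epsilon> :: real assume \<epsilon>: "A - \<rho> / sqrt \<epsilon> \<le> - 1" "0 < \<epsilon>"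
          \<comment> \<open>The rate is at most -1 and rounding loses at most 1, so for these
            \<open>T\<close> the exponent is at most \<open>- ln (2 * k)\<close> and the complement
            has probability at most 1/2.\<close>
          have "1 / 2 \<le> ?p \<epsilon> T" if T: "T \<ge> max T0 (1 + ln (2 * k))" for T
          proof -
            have "T > 0" using T \<open>T0 > 0\<close> by simp
            have "(A - \<rho> / sqrt \<epsilon>) * real (nat \<lfloor>T\<rfloor>) \<le> - 1 * real (nat \<lfloor>T\<rfloor>)"
              using \<epsilon>(1) by (intro mult_right_mono) auto
            also have "\<dots> \<le> - ln (2 * k)" using T \<open>T > 0\<close> by simp linarith
            finally have "k * exp ((A - \<rho> / sqrt \<epsilon>) * real (nat \<lfloor>T\<rfloor>)) \<le> k * exp (- ln (2 * k))"
              using \<open>k > 0\<close> by simp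
            also have "\<dots> = 1 / 2" using \<open>k > 0\<close> by (simp add: exp_minus field_simps)
            finally have "measure M {\<omega> \<in> space M. empirical_measure (\<lambda>t. X \<epsilon> t \<omega>) T \<notin> G} \<le> 1 / 2"
              using bound[OF \<epsilon>(2), of T] T by simp
            moreover have "measure M {\<omega> \<in> space M. empirical_measure (\<lambda>t. X \<epsilon> t \<omega>) T \<notin> G} = 1 - ?p \<epsilon> T"
            proof -
              have "{\<omega> \<in> space M. empirical_measure (\<lambda>t. X \<epsilon> t \<omega>) T \<notin> G}
                  = space M - {\<omega> \<in> space M. empirical_measure (\<lambda>t. X \<epsilon> t \<omega>) T \<in> G}" by auto
              then show ?thesis
                using prob_compl[OF empirical_event_measurable[OF X[OF \<epsilon>(2)] \<open>T > 0\<close> G]] by simp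
            qed
            ultimately show ?thesis by simp
          qed
          then have "\<forall>\<^sub>F T in at_top. 1 / 2 \<le> ?p \<epsilon> T" unfolding eventually_at_top_linorder by blast
          then show "0 \<le> Liminf at_top (\<lambda>T. ereal (1 / T) * ereal_ln (?p \<epsilon> T))"
            by (rule Liminf_ln_ge_0) simp
        qed
      qed
      finally show ?thesis .
    next
      case False
      \<comment> \<open>A basic neighbourhood of \<open>\<mu>\<close> inside \<open>G\<close> misses
        \<open>\<mu>0\<close>, so a continuous function separates the two measures, and the claimed
        lower bound is minus infinity.\<close>
      have "rate_function a b \<mu> = \<infinity>" if \<mu>: "\<mu> \<in> G" for \<mu>
      proof -
        obtain C \<delta> where C: "finite C" "\<And>c. c \<in> C \<Longrightarrow> continuous_on UNIV c" "\<delta> > 0" "weak_ball C \<delta> \<mu> \<subseteq> G"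
          using weak_topology_neighbourhood[OF G \<mu>] by metis
        have "\<mu>0 \<notin> weak_ball C \<delta> \<mu>" using C(4) False by blast
        then obtain c where "c \<in> C" "\<delta> \<le> \<bar>integral\<^sup>L \<mu>0 c - integral\<^sup>L \<mu> c\<bar>"
          using \<mu>0(1) by (auto simp: weak_ball_def not_less)
        then show ?thesis using rate_top[of c \<mu>] C(2,3) by auto
      qed
      then have "(INF \<mu>\<in>G. rate_function a b \<mu>) = \<infinity>"
        by (metis INF_top_conv(2) top_ereal_def)
      then show ?thesis by simp
    qed
  next
    fix C assume C: "closedin weak_topology C"
    let ?p = "\<lambda>\<epsilon> T. measure M {\<omega> \<in> space M. empirical_measure (\<lambda>t. X \<epsilon> t \<omega>) T \<in> C}"
    show "Limsup (at_right 0) (\<lambda>\<epsilon>. Limsup at_top (\<lambda>T. ereal (1 / T) * ereal_ln (?p \<epsilon> T)))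
        \<le> - (INF \<mu>\<in>C. rate_function a b \<mu>)"
    proof (cases "\<mu>0 \<in> C")
      \<comment> \<open>The right-hand side is at least 0 here, and probabilities are at most
        1.\<close>
      case True
      then have "(INF \<mu>\<in>C. rate_function a b \<mu>) \<le> 0" using rate_0 by (metis INF_lower)
      then have J: "0 \<le> - (INF \<mu>\<in>C. rate_function a b \<mu>)"
        by (metis ereal_0_le_uminus_iff)
      have "ereal (1 / T) * ereal_ln (?p \<epsilon> T) \<le> 0" if "T > 0" for \<epsilon> T
      proof -
        have "ereal_ln (?p \<epsilon> T) \<le> ereal (ln 1)" by (rule ereal_ln_le) auto
        then have "ereal (1 / T) * ereal_ln (?p \<epsilon> T) \<le> ereal (1 / T) * ereal (ln 1)"
          using that by (intro ereal_mult_left_mono) auto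
        then show ?thesis by (simp flip: zero_ereal_def)
      qed
      then have L: "Limsup at_top (\<lambda>T. ereal (1 / T) * ereal_ln (?p \<epsilon> T)) \<le> 0" for \<epsilon>
        by (intro Limsup_bounded eventually_mono[OF eventually_gt_at_top[of 0]])
      have "Limsup (at_right 0) (\<lambda>\<epsilon>. Limsup at_top (\<lambda>T. ereal (1 / T) * ereal_ln (?p \<epsilon> T))) \<le> 0"
        by (rule Limsup_bounded[OF always_eventually]) (use L in blast)
      then show ?thesis using J by (rule order_trans)
    next
      case False
      define G where "G = topspace weak_topology - C"
      have G: "openin weak_topology G" "\<mu>0 \<in> G"
        using C False \<mu>0(1) by (auto simp: G_def closedin_def topspace_weak_topology)
      obtain A \<rho> T0 k where "\<rho> > 0" "k > 0" "T0 > 0" and bound: "\<And>\<epsilon> T. \<epsilon> > 0 \<Longrightarrow> T \<ge> T0 \<Longrightarrow>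
          measure M {\<omega> \<in> space M. empirical_measure (\<lambda>t. X \<epsilon> t \<omega>) T \<notin> G} \<le> k * exp ((A - \<rho> / sqrt \<epsilon>) * real (nat \<lfloor>T\<rfloor>))"
        using small[OF G] by blast
      have p: "?p \<epsilon> T \<le> k * exp ((A - \<rho> / sqrt \<epsilon>) * real (nat \<lfloor>T\<rfloor>))" if "\<epsilon> > 0" "T \<ge> T0" for \<epsilon> T
      proof -
        have "T > 0" using that \<open>T0 > 0\<close> by simp
        then have "empirical_measure (\<lambda>t. X \<epsilon> t \<omega>) T \<in> circle_prob_measures" if "\<omega> \<in> space M" for \<omega>
          by (rule empirical_measure_prob[OF _ circle_diffusion_path(1)[OF X[OF \<open>\<epsilon> > 0\<close>] that]])
        then have "{\<omega> \<in> space M. empirical_measure (\<lambda>t. X \<epsilon> t \<omega>) T \<in> C}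
            = {\<omega> \<in> space M. empirical_measure (\<lambda>t. X \<epsilon> t \<omega>) T \<notin> G}"
          by (auto simp: G_def topspace_weak_topology)
        then show ?thesis using bound[OF that] by simp
      qed
      \<comment> \<open>Any real \<open>B\<close> is an upper bound, so the upper limit is minus
        infinity. The minimum with 0 supplies the nonpositive rate that
        \<open>Limsup_ln_exp_le\<close> asks for.\<close>
      have "Limsup (at_right 0) (\<lambda>\<epsilon>. Limsup at_top (\<lambda>T. ereal (1 / T) * ereal_ln (?p \<epsilon> T))) \<le> ereal B" for B
      proof (rule Limsup_bounded)
        show "\<forall>\<^sub>F \<epsilon> in at_right 0. Limsup at_top (\<lambda>T. ereal (1 / T) * ereal_ln (?p \<epsilon> T)) \<le> ereal B"
          using eventually_rate_le[OF \<open>\<rho> > 0\<close>, of A "min B 0"] eventually_at_right_less[of 0]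
        proof eventually_elim
          fix \<epsilon> :: real assume \<epsilon>: "A - \<rho> / sqrt \<epsilon> \<le> min B 0" "0 < \<epsilon>"
          have "Limsup at_top (\<lambda>T. ereal (1 / T) * ereal_ln (?p \<epsilon> T)) \<le> ereal (A - \<rho> / sqrt \<epsilon>)"
            using \<epsilon> by (intro Limsup_ln_exp_le[OF p[OF \<epsilon>(2)] _ \<open>k > 0\<close>]) auto
          also have "\<dots> \<le> ereal B" using \<epsilon>(1) by simp
          finally show "Limsup at_top (\<lambda>T. ereal (1 / T) * ereal_ln (?p \<epsilon> T)) \<le> ereal B" .
        qed
      qed
      then have "Limsup (at_right 0) (\<lambda>\<epsilon>. Limsup at_top (\<lambda>T. ereal (1 / T) * ereal_ln (?p \<epsilon> T))) = - \<infinity>"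
        by (rule ereal_bot)
      then show ?thesis by simp
    qed
  qed
qed

end
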